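(* There is a smooth foliation $\mathcal{F}$ on the $2$-torus $T^2$ such that the group $\mathcal{D}_{\mathcal{F}}$ cannot be endowed with a structure of a topological group (i.e. there is no topology on $\mathcal{D}_{\mathcal F}$ making it, with composition of diffeomorphisms, a topological group) fulfilling all of the following: (i) the inclusion $\mathcal{D}_{\mathcal{F}} \hookrightarrow \mathcal{D}(T^2)$ is continuous; (ii) $\mathcal{D}_{\mathcal{F}}$ has second countable topology; (iii) $\mathcal{D}_{\mathcal{F}}$ is locally path-connected.
   Context: For a closed smooth manifold $M$, $\mathcal{D}(M)$ denotes the group of all $C^\infty$ diffeomorphisms of $M$, endowed with the $C^\infty$ topology. For a smooth foliation $\mathcal{F}$ on $M$, $\mathcal{D}_{\mathcal{F}} = \{f\in\mathcal{D}(M) \mid f_*\mathcal{F}=\mathcal{F}\}$ is the group of diffeomorphisms preserving the foliation (mapping leaves to leaves). *)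

theory Defs
  imports "HOL-Analysis.Analysis" "HOL-Algebra.Bij"
begin

section \<open>Smooth maps between open subsets of Euclidean spaces\<close>

primrec iterated_derivative ::
  "'a list \<Rightarrow> ('a::real_normed_vector \<Rightarrow> 'b::real_normed_vector) \<Rightarrow> 'a \<Rightarrow> 'b" where
  "iterated_derivative [] f = f"
| "iterated_derivative (v # vs) f = iterated_derivative vs (\<lambda>x. frechet_derivative f (at x) v)"

text \<open>Only meaningful for open \<open>S\<close>: the derivatives are two-sided at every point of \<open>S\<close>.\<close>

definition smooth_on ::
  "'a::real_normed_vector set \<Rightarrow> ('a \<Rightarrow> 'b::real_normed_vector) \<Rightarrow> bool" where
  "smooth_on S f \<longleftrightarrow> (\<forall>vs. \<forall>x\<in>S. iterated_derivative vs f differentiable at x)"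


section \<open>Smooth manifolds\<close>

text \<open>
  A manifold is a topology \<open>X\<close> together with a smooth atlas \<open>A\<close>, modelled on a Euclidean space.
  A chart is a pair of its domain and its coordinate map; the coordinate map is irrelevant outside
  the domain.
\<close>

type_synonym ('a, 'e) chart = "'a set \<times> ('a \<Rightarrow> 'e)"

text \<open>The charts of the differential structure (maximal atlas) determined by \<open>A\<close>.\<close>

definition smooth_charts ::
  "'a topology \<Rightarrow> ('a, 'e::euclidean_space) chart set \<Rightarrow> ('a, 'e) chart set" where
  "smooth_charts X A = {(U, \<phi>).
     openin X U \<and> open (\<phi> ` U) \<and>
     homeomorphic_map (subtopology X U) (top_of_set (\<phi> ` U)) \<phi> \<and>
     (\<forall>(V, \<psi>)\<in>A.
        smooth_on (\<phi> ` (U \<inter> V)) (\<psi> \<circ> inv_into U \<phi>) \<and>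
        smooth_on (\<psi> ` (U \<inter> V)) (\<phi> \<circ> inv_into V \<psi>))}"

definition smooth_manifold :: "'a topology \<Rightarrow> ('a, 'e::euclidean_space) chart set \<Rightarrow> bool" where
  "smooth_manifold X A \<longleftrightarrow>
     Hausdorff_space X \<and> second_countable X \<and>
     A \<subseteq> smooth_charts X A \<and> (\<Union>(U, \<phi>)\<in>A. U) = topspace X"

definition closed_smooth_manifold ::
  "'a topology \<Rightarrow> ('a, 'e::euclidean_space) chart set \<Rightarrow> bool" where
  "closed_smooth_manifold X A \<longleftrightarrow> smooth_manifold X A \<and> compact_space X"

definition smooth_map ::
  "'a topology \<Rightarrow> ('a, 'e::euclidean_space) chart set \<Rightarrow>
   'b topology \<Rightarrow> ('b, 'f::euclidean_space) chart set \<Rightarrow> ('a \<Rightarrow> 'b) \<Rightarrow> bool" where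
  "smooth_map X A Y B f \<longleftrightarrow>
     continuous_map X Y f \<and>
     (\<forall>(U, \<phi>)\<in>A. \<forall>(V, \<psi>)\<in>B.
        smooth_on (\<phi> ` {x \<in> U. f x \<in> V}) (\<psi> \<circ> f \<circ> inv_into U \<phi>))"


section \<open>The diffeomorphism group and its topology\<close>

text \<open>
  As in \<^const>\<open>Bij\<close>, maps are taken to be extensional on the carrier, so that a self-map of the
  manifold is represented by exactly one function.
\<close>

definition diffeos :: "'a topology \<Rightarrow> ('a, 'e::euclidean_space) chart set \<Rightarrow> ('a \<Rightarrow> 'a) set" where
  "diffeos X A = {f \<in> Bij (topspace X).
     smooth_map X A X A f \<and> smooth_map X A X A (inv_into (topspace X) f)}"

definition smooth_maps ::
  "'a topology \<Rightarrow> ('a, 'e::euclidean_space) chart set \<Rightarrow>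
   'b topology \<Rightarrow> ('b, 'f::euclidean_space) chart set \<Rightarrow> ('a \<Rightarrow> 'b) set" where
  "smooth_maps X A Y B = {f \<in> extensional (topspace X). smooth_map X A Y B f}"

text \<open>
  The standard subbasic neighbourhoods of the (weak) \<open>C\<^sup>\<infinity>\<close> topology: the maps that are
  \<open>\<epsilon>\<close>-close to \<open>f\<close> on the compact set \<open>K\<close>, in the charts \<open>(U, \<phi>)\<close> and \<open>(V, \<psi>)\<close>, together with
  all partial derivatives of order at most \<open>r\<close>.  On a compact source the weak and the strong
  topology coincide.
\<close>

definition C_infinity_nbhd ::
  "'a topology \<Rightarrow> ('a, 'e::euclidean_space) chart set \<Rightarrow>
   'b topology \<Rightarrow> ('b, 'f::euclidean_space) chart set \<Rightarrow>
   ('a \<Rightarrow> 'b) \<Rightarrow> ('a, 'e) chart \<Rightarrow> ('b, 'f) chart \<Rightarrow> 'a set \<Rightarrow> nat \<Rightarrow> real \<Rightarrow> ('a \<Rightarrow> 'b) set" where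
  "C_infinity_nbhd X A Y B f c d K r \<epsilon> =
     (case (c, d) of ((U, \<phi>), (V, \<psi>)) \<Rightarrow>
       {g \<in> smooth_maps X A Y B. g ` K \<subseteq> V \<and>
          (\<forall>x\<in>K. \<forall>vs. set vs \<subseteq> Basis \<and> length vs \<le> r \<longrightarrow>
             norm (iterated_derivative vs (\<psi> \<circ> g \<circ> inv_into U \<phi>) (\<phi> x)
                 - iterated_derivative vs (\<psi> \<circ> f \<circ> inv_into U \<phi>) (\<phi> x)) < \<epsilon>)})"

definition C_infinity_topology ::
  "'a topology \<Rightarrow> ('a, 'e::euclidean_space) chart set \<Rightarrow>
   'b topology \<Rightarrow> ('b, 'f::euclidean_space) chart set \<Rightarrow> ('a \<Rightarrow> 'b) topology" where
  "C_infinity_topology X A Y B = topology_generated_by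
     {C_infinity_nbhd X A Y B f (U, \<phi>) (V, \<psi>) K r \<epsilon> | f U \<phi> V \<psi> K r \<epsilon>.
        f \<in> smooth_maps X A Y B \<and>
        (U, \<phi>) \<in> smooth_charts X A \<and> (V, \<psi>) \<in> smooth_charts Y B \<and>
        compactin X K \<and> K \<subseteq> U \<and> f ` K \<subseteq> V \<and> \<epsilon> > 0}"

definition diffeo_topology ::
  "'a topology \<Rightarrow> ('a, 'e::euclidean_space) chart set \<Rightarrow> ('a \<Rightarrow> 'a) topology" where
  "diffeo_topology X A = subtopology (C_infinity_topology X A X A) (diffeos X A)"


section \<open>Foliations\<close>

text \<open>
  Foliated atlas of dimension \<open>dim E\<close>: instead of splitting the model space as
  \<open>\<real>\<^sup>p \<times> \<real>\<^sup>q\<close> with the leaves locally given by \<open>\<real>\<^sup>p \<times> {y}\<close>, fix a linear subspace \<open>E\<close>; locally the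
  leaves are given by the translates of \<open>E\<close>.  The last condition is the usual requirement that
  coordinate changes have the form \<open>(x, y) \<mapsto> (h\<^sub>1 (x, y), h\<^sub>2 y)\<close> locally.  Convexity of
  the chart images makes the plaques, that is, the sets \<open>{y \<in> U. \<phi> y - \<phi> x \<in> E}\<close>, connected.
\<close>

definition foliated_atlas ::
  "'a topology \<Rightarrow> ('a, 'e::euclidean_space) chart set \<Rightarrow> 'e set \<Rightarrow> ('a, 'e) chart set \<Rightarrow> bool" where
  "foliated_atlas X A E \<A> \<longleftrightarrow>
     subspace E \<and> \<A> \<subseteq> smooth_charts X A \<and> (\<Union>(U, \<phi>)\<in>\<A>. U) = topspace X \<and>
     (\<forall>(U, \<phi>)\<in>\<A>. convex (\<phi> ` U)) \<and>
     (\<forall>(U, \<phi>)\<in>\<A>. \<forall>(V, \<psi>)\<in>\<A>. \<forall>x\<in>U \<inter> V.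
        \<exists>W. openin X W \<and> x \<in> W \<and> W \<subseteq> U \<inter> V \<and>
            (\<forall>y\<in>W. \<forall>z\<in>W. \<phi> y - \<phi> z \<in> E \<longrightarrow> \<psi> y - \<psi> z \<in> E))"

text \<open>Two points lie in the same leaf iff they are joined by a finite chain of plaques.\<close>

definition same_plaque :: "'e::euclidean_space set \<Rightarrow> ('a, 'e) chart set \<Rightarrow> ('a \<times> 'a) set" where
  "same_plaque E \<A> = {(x, y). \<exists>(U, \<phi>)\<in>\<A>. x \<in> U \<and> y \<in> U \<and> \<phi> x - \<phi> y \<in> E}"

definition leaves ::
  "'a topology \<Rightarrow> 'e::euclidean_space set \<Rightarrow> ('a, 'e) chart set \<Rightarrow> 'a set set" where
  "leaves X E \<A> = topspace X // (same_plaque E \<A>)\<^sup>+"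

text \<open>A smooth foliation, represented by its set of leaves.\<close>

definition smooth_foliation ::
  "'a topology \<Rightarrow> ('a, 'e::euclidean_space) chart set \<Rightarrow> 'a set set \<Rightarrow> bool" where
  "smooth_foliation X A \<F> \<longleftrightarrow> (\<exists>E \<A>. foliated_atlas X A E \<A> \<and> \<F> = leaves X E \<A>)"

definition foliation_diffeos ::
  "'a topology \<Rightarrow> ('a, 'e::euclidean_space) chart set \<Rightarrow> 'a set set \<Rightarrow> ('a \<Rightarrow> 'a) set" where
  "foliation_diffeos X A \<F> = {f \<in> diffeos X A. (\<lambda>L. f ` L) ` \<F> = \<F>}"

definition foliation_diffeo_group ::
  "'a topology \<Rightarrow> ('a, 'e::euclidean_space) chart set \<Rightarrow> 'a set set \<Rightarrow> ('a \<Rightarrow> 'a) monoid" where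
  "foliation_diffeo_group X A \<F> = BijGroup (topspace X) \<lparr>carrier := foliation_diffeos X A \<F>\<rparr>"


section \<open>Topological groups\<close>

text \<open>\<open>T\<close> is a topology on the group \<open>G\<close> that makes \<open>G\<close> a topological group.\<close>

definition group_topology :: "('a, 'b) monoid_scheme \<Rightarrow> 'a topology \<Rightarrow> bool" where
  "group_topology G T \<longleftrightarrow>
     topspace T = carrier G \<and>
     continuous_map (prod_topology T T) T (\<lambda>(x, y). x \<otimes>\<^bsub>G\<^esub> y) \<and>
     continuous_map T T (\<lambda>x. inv\<^bsub>G\<^esub> x)"


section \<open>The 2-torus\<close>

definition torus :: "(complex \<times> complex) topology" where
  "torus = top_of_set (sphere 0 1 \<times> sphere 0 1)"

definition torus_cover :: "real \<times> real \<Rightarrow> complex \<times> complex" where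
  "torus_cover = (\<lambda>(s, t). (cis (2 * pi * s), cis (2 * pi * t)))"

text \<open>The charts are the local inverses of the covering map on open unit squares.\<close>

definition torus_atlas :: "(complex \<times> complex, real \<times> real) chart set" where
  "torus_atlas =
     {(torus_cover ` Q, inv_into Q torus_cover) | Q. \<exists>a b. Q = {a<..<a+1} \<times> {b<..<b+1}}"

text \<open>\<open>torus_atlas\<close> does define a closed smooth manifold.\<close>

lemma iterated_derivative_cong:
  assumes "open S" "\<And>x. x \<in> S \<Longrightarrow> f x = g x" "x \<in> S"
  shows "iterated_derivative vs f x = iterated_derivative vs g x"
  using assms(2,3)
proof (induction vs arbitrary: f g x)
  case (Cons v vs)
  have "frechet_derivative f (at y) = frechet_derivative g (at y)" if "y \<in> S" for y
  proof -
    have "(f has_derivative D) (at y) \<longleftrightarrow> (g has_derivative D) (at y)" for D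
      by (rule iffI; erule has_derivative_transform_within_open[OF _ \<open>open S\<close> that])
        (simp_all add: Cons.prems(1))
    then show ?thesis by (simp add: frechet_derivative_def)
  qed
  then have "frechet_derivative f (at y) v = frechet_derivative g (at y) v" if "y \<in> S" for y
    using that by simp
  then show ?case
    unfolding iterated_derivative.simps by (rule Cons.IH) (use Cons.prems(2) in auto)
qed simp

lemma smooth_on_translation:
  assumes "open S"
    and loc: "\<And>z. z \<in> S \<Longrightarrow> \<exists>W n. open W \<and> z \<in> W \<and> (\<forall>w\<in>W. f w = w + n)"
  shows "smooth_on S f"
  unfolding smooth_on_def
proof (intro allI ballI)
  fix vs and z :: 'a
  assume "z \<in> S"
  from loc[OF this] obtain W n where "open W \<and> z \<in> W \<and> (\<forall>w\<in>W. f w = w + n)"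
    by (elim exE)
  then have W: "open W" "z \<in> W" "\<And>w. w \<in> W \<Longrightarrow> f w = w + n" by simp_all
  have const: "\<exists>d. iterated_derivative us (\<lambda>w::'a. c::'a) = (\<lambda>w. d)" for us c
    by (induction us arbitrary: c) auto
  have "iterated_derivative vs (\<lambda>w. w + n) differentiable at z"
  proof (cases vs)
    case Nil
    then show ?thesis by (auto intro!: derivative_intros)
  next
    case (Cons u us)
    have "frechet_derivative (\<lambda>w::'a. w + n) (at y) = (\<lambda>h. h)" for y
      by (rule frechet_derivative_at[symmetric]) (auto intro!: derivative_eq_intros)
    then have "iterated_derivative vs (\<lambda>w. w + n) = iterated_derivative us (\<lambda>w. u)"
      by (simp add: Cons)
    with const[of us u] show ?thesis by auto
  qed
  then obtain D where "(iterated_derivative vs (\<lambda>w. w + n) has_derivative D) (at z)"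
    by (auto simp: differentiable_def)
  then have "(iterated_derivative vs f has_derivative D) (at z)"
    by (rule has_derivative_transform_within_open[OF _ W(1,2)])
      (use iterated_derivative_cong[OF W(1), of f "\<lambda>w. w + n"] W(3) in simp)
  then show "iterated_derivative vs f differentiable at z"
    by (auto simp: differentiable_def)
qed

definition circle_coord :: "real \<Rightarrow> complex \<Rightarrow> real" where
  "circle_coord a z = a + Arg2pi (z * cis (- (2 * pi * a))) / (2 * pi)"

lemma circle_coord_cis:
  assumes "a < s" "s < a + 1"
  shows "circle_coord a (cis (2 * pi * s)) = s"
proof -
  have "Arg2pi (cis (2 * pi * (s - a))) = 2 * pi * (s - a)"
    by (rule Arg2pi_unique[of 1]) (use assms in \<open>auto simp: cis_conv_exp\<close>)
  moreover have "cis (2 * pi * s) * cis (- (2 * pi * a)) = cis (2 * pi * (s - a))"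
    by (simp add: cis_mult algebra_simps)
  ultimately show ?thesis by (simp add: circle_coord_def)
qed

lemma cis_not_endpoint:
  assumes "a < s" "s < a + 1"
  shows "cis (2 * pi * s) \<noteq> cis (2 * pi * a)"
proof
  assume "cis (2 * pi * s) = cis (2 * pi * a)"
  then have "circle_coord a (cis (2 * pi * s)) = a"
    by (simp add: circle_coord_def cis_mult Arg2pi_of_real[of 1, simplified])
  with circle_coord_cis[OF assms] assms show False by simp
qed

lemma circle_coord_not_nonneg:
  assumes "norm z = 1" "z \<noteq> cis (2 * pi * a)"
  shows "z * cis (- (2 * pi * a)) \<notin> \<real>\<^sub>\<ge>\<^sub>0"
proof
  assume "z * cis (- (2 * pi * a)) \<in> \<real>\<^sub>\<ge>\<^sub>0"
  then obtain r where r: "z * cis (- (2 * pi * a)) = of_real r" "r \<ge> 0"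
    by (auto simp: nonneg_Reals_def)
  then have "\<bar>r\<bar> = 1"
    using assms(1) by (metis norm_cis norm_mult norm_of_real mult_1)
  with r have "z * cis (- (2 * pi * a)) = 1" by simp
  then have "z * (cis (- (2 * pi * a)) * cis (2 * pi * a)) = cis (2 * pi * a)"
    by (metis mult.assoc mult_1)
  then show False using assms(2) by (simp add: cis_mult)
qed

lemma cis_circle_coord:
  assumes "norm z = 1" "z \<noteq> cis (2 * pi * a)"
  shows "circle_coord a z \<in> {a<..<a+1}" "cis (2 * pi * circle_coord a z) = z"
proof -
  define w where "w = z * cis (- (2 * pi * a))"
  have w: "norm w = 1" "w \<notin> \<real>\<^sub>\<ge>\<^sub>0"
    using assms circle_coord_not_nonneg by (auto simp: w_def norm_mult)
  have "Arg2pi w \<noteq> 0"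
    using w(2) Arg2pi_eq_0[of w] by (auto simp: complex_nonneg_Reals_iff complex_is_Real_iff)
  then have "0 < Arg2pi w" "Arg2pi w < 2 * pi"
    using Arg2pi[of w] by auto
  then show "circle_coord a z \<in> {a<..<a+1}"
    by (simp add: circle_coord_def flip: w_def)
  have "cis (Arg2pi w) = w"
    using w(1) complex_norm_eq_1_exp[of w] by (simp add: cis_conv_exp)
  moreover have "2 * pi * circle_coord a z = Arg2pi w + 2 * pi * a"
    by (simp add: circle_coord_def distrib_left flip: w_def)
  ultimately have "cis (2 * pi * circle_coord a z) = w * cis (2 * pi * a)"
    by (simp flip: cis_mult)
  then show "cis (2 * pi * circle_coord a z) = z"
    by (simp add: w_def mult.assoc cis_mult)
qed

lemma continuous_on_circle_coord:
  "continuous_on {z. norm z = 1 \<and> z \<noteq> cis (2 * pi * a)} (circle_coord a)"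
proof -
  have "continuous_on (- \<real>\<^sub>\<ge>\<^sub>0) Arg2pi"
    by (auto intro!: continuous_at_imp_continuous_on continuous_at_Arg2pi)
  moreover have "continuous_on S (\<lambda>z. z * cis (- (2 * pi * a)))" for S
    by (rule continuous_on_mult_right[OF continuous_on_id])
  ultimately have "continuous_on {z. norm z = 1 \<and> z \<noteq> cis (2 * pi * a)}
      (\<lambda>z. Arg2pi (z * cis (- (2 * pi * a))))"
    by (rule continuous_on_compose2) (use circle_coord_not_nonneg in blast)
  then show ?thesis
    unfolding circle_coord_def
    by (intro continuous_on_add continuous_on_divide continuous_on_const) simp_all
qed

lemma torus_chart_domain:
  "torus_cover ` ({a<..<a+1} \<times> {b<..<b+1}) =
     {(z, w). norm z = 1 \<and> norm w = 1 \<and> z \<noteq> cis (2 * pi * a) \<and> w \<noteq> cis (2 * pi * b)}"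
  (is "?L = ?R")
proof
  show "?L \<subseteq> ?R" by (auto simp: torus_cover_def dest: cis_not_endpoint)
  show "?R \<subseteq> ?L"
  proof clarify
    fix z w assume *: "norm z = 1" "norm w = 1" "z \<noteq> cis (2 * pi * a)" "w \<noteq> cis (2 * pi * b)"
    have "(z, w) = torus_cover (circle_coord a z, circle_coord b w)"
      using * by (simp add: torus_cover_def cis_circle_coord)
    then show "(z, w) \<in> ?L" using * cis_circle_coord(1) by blast
  qed
qed

lemma torus_cover_inj: "inj_on torus_cover ({a<..<a+1} \<times> {b<..<b+1})"
proof (rule inj_on_inverseI[where g = "\<lambda>(z, w). (circle_coord a z, circle_coord b w)"])
  fix x assume "x \<in> {a<..<a+1} \<times> {b<..<b+1}"
  then show "(case torus_cover x of (z, w) \<Rightarrow> (circle_coord a z, circle_coord b w)) = x"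
    by (auto simp: torus_cover_def circle_coord_cis)
qed

lemma continuous_on_torus_cover: "continuous_on S torus_cover"
  unfolding torus_cover_def case_prod_unfold by (intro continuous_intros)

lemma torus_chart_homeomorphic:
  fixes a b
  defines "Q \<equiv> {a<..<a+1} \<times> {b<..<b+1}"
  shows "homeomorphic_map (subtopology torus (torus_cover ` Q)) (top_of_set Q) (inv_into Q torus_cover)"
proof -
  have inv: "inv_into Q torus_cover x = (circle_coord a (fst x), circle_coord b (snd x))"
    if x: "x \<in> torus_cover ` Q" for x
  proof -
    obtain y where y: "y \<in> Q" "x = torus_cover y" using x by blast
    then have "inv_into Q torus_cover x = y"
      using torus_cover_inj[of a b] by (simp add: Q_def inv_into_f_f)
    also have "y = (circle_coord a (fst x), circle_coord b (snd x))"
      using y by (auto simp: Q_def torus_cover_def circle_coord_cis)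
    finally show ?thesis .
  qed
  have 1: "continuous_on (torus_cover ` Q) (\<lambda>x. (circle_coord a (fst x), circle_coord b (snd x)))"
    unfolding Q_def torus_chart_domain
    by (intro continuous_on_Pair continuous_on_compose2[OF continuous_on_circle_coord]
        continuous_intros) auto
  have 2: "continuous_on (torus_cover ` Q) (inv_into Q torus_cover)"
    using 1 inv continuous_on_cong by (metis (no_types, lifting))
  have sub: "torus_cover ` Q \<subseteq> sphere 0 1 \<times> sphere 0 1"
    by (auto simp: torus_cover_def)
  then have top: "subtopology torus (torus_cover ` Q) = top_of_set (torus_cover ` Q)"
    by (simp add: torus_def subtopology_subtopology inf_absorb2)
  have "homeomorphic_maps (top_of_set (torus_cover ` Q)) (top_of_set Q)
          (inv_into Q torus_cover) torus_cover"
    unfolding homeomorphic_maps_def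
    using 2 continuous_on_torus_cover torus_cover_inj[of a b] 
    by (auto simp: Q_def[symmetric] f_inv_into_f inv_into_into inv_into_f_f)
  then show ?thesis unfolding top by (rule homeomorphic_maps_imp_map)
qed

lemma torus_chart_open: "openin torus (torus_cover ` ({a<..<a+1} \<times> {b<..<b+1}))"
proof -
  have "torus_cover ` ({a<..<a+1} \<times> {b<..<b+1}) =
    (sphere 0 1 \<times> sphere 0 1) \<inter> ((- {cis (2 * pi * a)}) \<times> (- {cis (2 * pi * b)}))"
    unfolding torus_chart_domain by auto
  then show ?thesis
    unfolding torus_def by (auto intro!: openin_open_Int open_Times)
qed

lemma torus_cover_periodic: "torus_cover y = torus_cover x \<longleftrightarrow>
   (\<exists>m n. y = x + (of_int m, of_int n))"
proof -
  have "cis (2 * pi * t) = cis (2 * pi * s) \<longleftrightarrow> (\<exists>m. t = s + of_int m)" for s t :: real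
  proof -
    have "cis (2 * pi * t) = cis (2 * pi * s) \<longleftrightarrow>
            sin (2 * pi * t) = sin (2 * pi * s) \<and> cos (2 * pi * t) = cos (2 * pi * s)"
      by (auto simp: complex_eq_iff)
    also have "\<dots> \<longleftrightarrow> (\<exists>m::int. 2 * pi * t = 2 * pi * s + 2 * pi * m)"
      by (rule sin_cos_eq_iff)
    also have "\<dots> \<longleftrightarrow> (\<exists>m::int. t = s + of_int m)"
      by (simp flip: distrib_left)
    finally show ?thesis .
  qed
  then show ?thesis by (cases x; cases y) (auto simp: torus_cover_def)
qed

lemma torus_transition_smooth:
  fixes a b a' b'
  defines "Q \<equiv> {a<..<a+1} \<times> {b<..<b+1}" and "Q' \<equiv> {a'<..<a'+1} \<times> {b'<..<b'+1}"
  shows "smooth_on (inv_into Q torus_cover ` (torus_cover ` Q \<inter> torus_cover ` Q'))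
          (inv_into Q' torus_cover \<circ> inv_into (torus_cover ` Q) (inv_into Q torus_cover))"
    (is "smooth_on ?S ?f")
proof -
  have op: "open Q" "open Q'" by (auto simp: Q_def Q'_def intro!: open_Times)
  have inj: "inj_on torus_cover Q" "inj_on torus_cover Q'"
    unfolding Q_def Q'_def by (rule torus_cover_inj)+
  have f: "?f z = inv_into Q' torus_cover (torus_cover z)" if "z \<in> Q" for z
  proof -
    have "inv_into (torus_cover ` Q) (inv_into Q torus_cover) (inv_into Q torus_cover (torus_cover z))
            = torus_cover z"
      by (rule inv_into_f_f) (use that in \<open>auto intro!: inj_on_inv_into\<close>)
    then show ?thesis using that inj by (simp add: inv_into_f_f)
  qed
  have S: "?S = {z \<in> Q. torus_cover z \<in> torus_cover ` Q'}" (is "_ = ?S'")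
  proof
    show "?S \<subseteq> ?S'"
    proof
      fix z assume "z \<in> ?S"
      then obtain x where "x \<in> Q" "torus_cover x \<in> torus_cover ` Q'"
        "z = inv_into Q torus_cover (torus_cover x)" by blast
      then show "z \<in> ?S'" using inj by (simp add: inv_into_f_f)
    qed
    show "?S' \<subseteq> ?S"
    proof
      fix z assume z: "z \<in> ?S'"
      then have "inv_into Q torus_cover (torus_cover z) = z" using inj by (simp add: inv_into_f_f)
      then show "z \<in> ?S" using z by (intro rev_image_eqI[of "torus_cover z"]) auto
    qed
  qed
  have loc: "\<exists>W n. open W \<and> z \<in> W \<and> W \<subseteq> ?S \<and> (\<forall>w\<in>W. ?f w = w + n)" if "z \<in> ?S" for z
  proof -
    from that S obtain y where z: "z \<in> Q" and y: "y \<in> Q'" "torus_cover y = torus_cover z" by auto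
    then obtain m n :: int where mn: "y = z + (of_int m, of_int n)"
      using torus_cover_periodic by blast
    let ?n = "(real_of_int m, real_of_int n)"
    let ?W = "Q \<inter> (\<lambda>w. w + ?n) -` Q'"
    have "open ?W"
      using op by (intro open_Int open_vimage continuous_intros)
    moreover have "z \<in> ?W" using z y mn by auto
    moreover have "?f w = w + ?n \<and> w \<in> ?S" if "w \<in> ?W" for w
    proof -
      have "torus_cover (w + ?n) = torus_cover w"
        using torus_cover_periodic by blast
      then have "inv_into Q' torus_cover (torus_cover w) = w + ?n" "torus_cover w \<in> torus_cover ` Q'"
        using that inv_into_f_f[OF inj(2), of "w + ?n"] imageI[of "w + ?n" Q' torus_cover] by auto
      with that f[of w] S show ?thesis by auto
    qed
    ultimately show ?thesis by blast
  qed
  then have "open ?S" by (subst open_subopen) blast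
  then show ?thesis
  proof (rule smooth_on_translation)
    fix z assume "z \<in> ?S"
    from loc[OF this] show "\<exists>W n. open W \<and> z \<in> W \<and> (\<forall>w\<in>W. ?f w = w + n)"
      by (elim exE conjE, intro exI conjI)
  qed
qed

lemma closed_smooth_manifold_torus: "closed_smooth_manifold torus torus_atlas"
  unfolding closed_smooth_manifold_def smooth_manifold_def
proof (intro conjI)
  show "compact_space torus"
    by (simp add: torus_def compact_space_subtopology compact_Times)
  show "Hausdorff_space torus"
    by (simp add: torus_def Hausdorff_space_subtopology)
  show "second_countable torus"
    unfolding torus_def
  proof (rule second_countable_subtopology)
    show "second_countable (euclidean :: (complex \<times> complex) topology)"
      unfolding second_countable_def
    proof -
      obtain \<B> :: "(complex \<times> complex) set set" where
        \<B>: "countable \<B>" "\<And>C. C \<in> \<B> \<Longrightarrow> open C" "\<And>S. open S \<Longrightarrow> \<exists>U. U \<subseteq> \<B> \<and> S = \<Union>U"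
        by (rule univ_second_countable) blast
      have "\<exists>V\<in>\<B>. x \<in> V \<and> V \<subseteq> U" if "open U" "x \<in> U" for U x
        using \<B>(3)[OF that(1)] that(2) by blast
      with \<B>(1,2) show "\<exists>\<B>. countable \<B> \<and> (\<forall>V\<in>\<B>. openin euclidean V) \<and>
          (\<forall>U x::complex \<times> complex. openin euclidean U \<and> x \<in> U \<longrightarrow> (\<exists>V\<in>\<B>. x \<in> V \<and> V \<subseteq> U))"
        by (intro exI[of _ \<B>]) auto
    qed
  qed
  show "(\<Union>(U, \<phi>)\<in>torus_atlas. U) = topspace torus"
  proof
    show "(\<Union>(U, \<phi>)\<in>torus_atlas. U) \<subseteq> topspace torus"
      using torus_chart_open openin_subset by (fastforce simp: torus_atlas_def)
    show "topspace torus \<subseteq> (\<Union>(U, \<phi>)\<in>torus_atlas. U)"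
    proof
      fix x assume "x \<in> topspace torus"
      then obtain z w where x: "x = (z, w)" "norm z = 1" "norm w = 1"
        by (cases x) (auto simp: torus_def)
      have ex: "\<exists>a. u \<noteq> cis (2 * pi * a)" for u
      proof (cases "u = cis (2 * pi * 0)")
        case True
        then have "u \<noteq> cis (2 * pi * (1/2))" using cis_not_endpoint[of 0 "1/2"] by simp
        then show ?thesis by blast
      qed blast
      obtain a b where "z \<noteq> cis (2 * pi * a)" "w \<noteq> cis (2 * pi * b)" using ex by metis
      then have "x \<in> torus_cover ` ({a<..<a+1} \<times> {b<..<b+1})"
        using x unfolding torus_chart_domain by auto
      moreover have "(torus_cover ` ({a<..<a+1} \<times> {b<..<b+1}),
          inv_into ({a<..<a+1} \<times> {b<..<b+1}) torus_cover) \<in> torus_atlas"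
        unfolding torus_atlas_def by blast
      ultimately show "x \<in> (\<Union>(U, \<phi>)\<in>torus_atlas. U)" by blast
    qed
  qed
  show "torus_atlas \<subseteq> smooth_charts torus torus_atlas"
  proof
    fix c assume "c \<in> torus_atlas"
    then obtain a b where c: "c = (torus_cover ` ({a<..<a+1} \<times> {b<..<b+1}),
        inv_into ({a<..<a+1} \<times> {b<..<b+1}) torus_cover)"
      by (auto simp: torus_atlas_def)
    have im: "inv_into Q torus_cover ` torus_cover ` Q = Q" if "inj_on torus_cover Q" for Q
      using that by (auto simp: image_iff inv_into_f_f)
    note im = im[OF torus_cover_inj]
    show "c \<in> smooth_charts torus torus_atlas"
      unfolding c smooth_charts_def
    proof (intro CollectI case_prodI conjI ballI, goal_cases)
      case 1 show ?case by (rule torus_chart_open)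
    next
      case 2 show ?case by (simp add: im open_Times)
    next
      case 3 show ?case unfolding im by (rule torus_chart_homeomorphic)
    next
      case (4 d)
      then obtain a' b' where d: "d = (torus_cover ` ({a'<..<a'+1} \<times> {b'<..<b'+1}),
          inv_into ({a'<..<a'+1} \<times> {b'<..<b'+1}) torus_cover)"
        by (auto simp: torus_atlas_def)
      show ?case
        unfolding d prod.case
        using torus_transition_smooth[of a b a' b'] torus_transition_smooth[of a' b' a b]
        by (simp only: Int_commute)
    qed
  qed
qed

end

theory Submission
  imports Defs "HOL-Computational_Algebra.Polynomial"
begin

text \<open>The obstruction is a count of path components: in a second countable, locally path-connected space any family of
  points no two of which are joined by a path is countable
  (\<open>countable_if_pairwise_not_path_joined\<close>), and a path for a topology that is finer than the
  \<open>C\<^sup>\<infinity>\<close> topology is a path of diffeomorphisms in the \<open>C\<^sup>\<infinity>\<close> topology.  So it suffices to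
  find a foliation and uncountably many diffeomorphisms preserving it, no two of which are joined by
  a \<open>C\<^sup>\<infinity>\<close> path of diffeomorphisms preserving the foliation.

  The foliation is the suspension of a circle diffeomorphism \<open>g = h \<circ> h\<close>.  The map \<open>h\<close> is the
  identity except on infinitely many disjoint intervals, the strips, which accumulate at a point and on
  which \<open>h\<close> is so close to the identity that for every set \<open>S\<close> of strips the map \<open>h\<^sub>S\<close>, which
  is \<open>h\<close> on the strips in \<open>S\<close> and the identity elsewhere, is smooth
  (\<open>twisted_strips_exist\<close>).  These maps commute with \<open>g\<close>, so each of them extends to a diffeomorphism
  \<open>f\<^sub>S\<close> of the torus that preserves the foliation (\<open>diffeo_preserves_suspension\<close>).

  Conversely, a path from \<open>f\<^sub>S\<close> to \<open>f\<^sub>U\<close> induces, after lifting to the plane and composing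
  with the inverse of \<open>h\<^sub>S\<close>, a path of maps of the transversal that starts at the identity and
  consists of maps commuting with \<open>g\<close>.  On a strip, \<open>h\<close> is a
  hyperbolic Moebius transformation between two fixed points, modified by a bump inside half of a
  fundamental domain.  A commuting map that is differentiable at the fixed points belongs near each of them to
  the one-parameter group of that Moebius transformation
  (\<open>commuting_is_translation_near_lower_end\<close>); the bump is compatible with no small nonzero
  parameter (\<open>small_commuting_is_identity\<close>).  Hence the path is constant on the strips.  Its end
  point shows that on each strip \<open>h\<^sub>S\<close> and \<open>h\<^sub>U\<close> differ by an iterate of \<open>g\<close>; since \<open>h\<close> is not
  an iterate of its own square, \<open>S = U\<close> (\<open>path_joins_only_equal_sets\<close>).\<close>

section \<open>Calculus of smooth maps\<close>

text \<open>Finite orders of differentiability are what the product, chain and inverse function rules can be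
  proved for by induction; smoothness is the conjunction over all orders.\<close>

definition differentiable_upto ::
  "nat \<Rightarrow> 'a::real_normed_vector set \<Rightarrow> ('a \<Rightarrow> 'b::real_normed_vector) \<Rightarrow> bool" where
  "differentiable_upto k S f \<longleftrightarrow>
     (\<forall>vs. length vs \<le> k \<longrightarrow> (\<forall>x\<in>S. iterated_derivative vs f differentiable at x))"

lemma smooth_on_iff_upto: "smooth_on S f \<longleftrightarrow> (\<forall>k. differentiable_upto k S f)"
  unfolding smooth_on_def differentiable_upto_def by (meson le_refl)

lemma differentiable_upto_0: "differentiable_upto 0 S f \<longleftrightarrow> (\<forall>x\<in>S. f differentiable at x)"
  by (auto simp: differentiable_upto_def)

lemma differentiable_upto_Suc:
  "differentiable_upto (Suc k) S f \<longleftrightarrow> (\<forall>x\<in>S. f differentiable at x) \<and>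
     (\<forall>v. differentiable_upto k S (\<lambda>x. frechet_derivative f (at x) v))"
  (is "?L \<longleftrightarrow> ?R")
proof
  assume L: ?L
  have "f differentiable at x" if "x \<in> S" for x
    using L that unfolding differentiable_upto_def
    by (metis iterated_derivative.simps(1) le0 list.size(3))
  moreover have "differentiable_upto k S (\<lambda>x. frechet_derivative f (at x) v)" for v
    unfolding differentiable_upto_def
  proof (intro allI impI ballI)
    fix vs :: "'a list" and x assume "length vs \<le> k" "x \<in> S"
    then show "iterated_derivative vs (\<lambda>x. frechet_derivative f (at x) v) differentiable at x"
      using L unfolding differentiable_upto_def
      by (metis Suc_le_mono iterated_derivative.simps(2) length_Cons)
  qed
  ultimately show ?R by blast
next
  assume R: ?R
  show ?L
    unfolding differentiable_upto_def
  proof (intro allI impI ballI)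
    fix vs :: "'a list" and x assume *: "length vs \<le> Suc k" "x \<in> S"
    show "iterated_derivative vs f differentiable at x"
    proof (cases vs)
      case Nil
      then show ?thesis using R * by simp
    next
      case (Cons v us)
      then show ?thesis using R * by (auto simp: differentiable_upto_def)
    qed
  qed
qed

lemma differentiable_upto_mono: "differentiable_upto k S f \<Longrightarrow> j \<le> k \<Longrightarrow> T \<subseteq> S \<Longrightarrow> differentiable_upto j T f"
  by (auto simp: differentiable_upto_def)

lemma smooth_on_iff_derivatives:
  "smooth_on S f \<longleftrightarrow> (\<forall>x\<in>S. f differentiable at x) \<and>
     (\<forall>v. smooth_on S (\<lambda>x. frechet_derivative f (at x) v))"
  unfolding smooth_on_iff_upto
  by (metis differentiable_upto_Suc differentiable_upto_mono le_SucI order_refl)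

lemma smooth_on_imp_differentiable: "smooth_on S f \<Longrightarrow> x \<in> S \<Longrightarrow> f differentiable at x"
  using smooth_on_iff_derivatives by blast

lemma smooth_on_subset: "smooth_on S f \<Longrightarrow> T \<subseteq> S \<Longrightarrow> smooth_on T f"
  by (auto simp: smooth_on_def)

lemma smooth_on_imp_continuous_on: "smooth_on S f \<Longrightarrow> continuous_on S f"
  by (meson continuous_at_imp_continuous_on differentiable_imp_continuous_within
      smooth_on_imp_differentiable)

lemma differentiable_at_cong_open:
  assumes "open S" "x \<in> S" "\<And>y. y \<in> S \<Longrightarrow> f y = g y" "f differentiable at x"
  shows "g differentiable at x"
  using assms by (meson differentiable_def has_derivative_transform_within_open)

lemma differentiable_upto_cong:
  assumes "open S" "\<And>x. x \<in> S \<Longrightarrow> f x = g x"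
  shows "differentiable_upto k S f \<longleftrightarrow> differentiable_upto k S g"
proof -
  have "differentiable_upto k S v" if "\<And>x. x \<in> S \<Longrightarrow> u x = v x" "differentiable_upto k S u"
    for u v :: "'a \<Rightarrow> 'b"
    unfolding differentiable_upto_def
  proof (intro allI impI ballI)
    fix vs :: "'a list" and x assume *: "length vs \<le> k" "x \<in> S"
    show "iterated_derivative vs v differentiable at x"
    proof (rule differentiable_at_cong_open[OF assms(1) *(2)])
      show "iterated_derivative vs u y = iterated_derivative vs v y" if "y \<in> S" for y
        by (rule iterated_derivative_cong[OF assms(1) _ that]) (fact \<open>\<And>x. x \<in> S \<Longrightarrow> u x = v x\<close>)
      show "iterated_derivative vs u differentiable at x"
        using * that(2) by (simp add: differentiable_upto_def)
    qed
  qed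
  from this[of f g] this[of g f] assms(2) show ?thesis by auto
qed

lemma smooth_on_cong:
  "open S \<Longrightarrow> (\<And>x. x \<in> S \<Longrightarrow> f x = g x) \<Longrightarrow> smooth_on S f \<longleftrightarrow> smooth_on S g"
  unfolding smooth_on_iff_upto using differentiable_upto_cong by blast

text \<open>For maps that are given by different formulas on different open sets.\<close>

lemma smooth_on_local:
  assumes "\<And>x. x \<in> S \<Longrightarrow> \<exists>W g. open W \<and> x \<in> W \<and> smooth_on W g \<and> (\<forall>y\<in>W. f y = g y)"
  shows "smooth_on S f"
  unfolding smooth_on_def
proof (intro allI ballI)
  fix vs and x :: 'a assume "x \<in> S"
  from assms[OF this] obtain W g where W: "open W" "x \<in> W" "smooth_on W g" "\<forall>y\<in>W. f y = g y"
    by blast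
  then have "smooth_on W f" using smooth_on_cong by blast
  then show "iterated_derivative vs f differentiable at x"
    using W by (auto simp: smooth_on_def)
qed

lemma frechet_derivative_eqI: "(f has_derivative D) (at x) \<Longrightarrow> frechet_derivative f (at x) v = D v"
  using frechet_derivative_at by metis

lemma differentiable_upto_SucI:
  assumes "open S" "\<And>x. x \<in> S \<Longrightarrow> (f has_derivative D x) (at x)"
    and "\<And>v. differentiable_upto k S (\<lambda>x. D x v)"
  shows "differentiable_upto (Suc k) S f"
  unfolding differentiable_upto_Suc
proof (intro conjI ballI allI)
  show "f differentiable at x" if "x \<in> S" for x using assms(2) that by (auto simp: differentiable_def)
  show "differentiable_upto k S (\<lambda>x. frechet_derivative f (at x) v)" for v
    using differentiable_upto_cong[OF assms(1), of "\<lambda>x. D x v"] assms(2,3) frechet_derivative_eqI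
    by (metis (no_types, lifting))
qed

lemma differentiable_upto_const: "differentiable_upto k S (\<lambda>x. c)"
proof (induction k arbitrary: c)
  case (Suc k)
  then show ?case by (simp add: differentiable_upto_Suc)
qed (simp add: differentiable_upto_0)

lemma frechet_has_derivative:
  "f differentiable at x \<Longrightarrow> (f has_derivative (\<lambda>v. frechet_derivative f (at x) v)) (at x)"
  by (simp add: frechet_derivative_works)

lemma differentiable_upto_bounded_linear:
  assumes "bounded_linear L" "open S" "differentiable_upto k S f"
  shows "differentiable_upto k S (\<lambda>x. L (f x))"
  using assms(3)
proof (induction k arbitrary: f)
  case 0
  then show ?case
    using assms(1) unfolding differentiable_upto_0 differentiable_def
    by (blast dest: bounded_linear.has_derivative)
next
  case (Suc k)
  then have f: "\<forall>x\<in>S. f differentiable at x"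
     "\<And>v. differentiable_upto k S (\<lambda>x. frechet_derivative f (at x) v)"
    by (simp_all add: differentiable_upto_Suc)
  show ?case
  proof (rule differentiable_upto_SucI[OF assms(2)])
    show "((\<lambda>x. L (f x)) has_derivative (\<lambda>v. L (frechet_derivative f (at x) v))) (at x)" if "x \<in> S" for x
      using f(1) that by (intro bounded_linear.has_derivative[OF assms(1)] frechet_has_derivative) auto
  qed (use Suc.IH f(2) in auto)
qed

lemma differentiable_upto_add:
  assumes "open S" "differentiable_upto k S f" "differentiable_upto k S g"
  shows "differentiable_upto k S (\<lambda>x. f x + g x)"
  using assms(2,3)
proof (induction k arbitrary: f g)
  case 0
  then show ?case by (simp add: differentiable_upto_0)
next
  case (Suc k)
  then have fg: "\<forall>x\<in>S. f differentiable at x" "\<forall>x\<in>S. g differentiable at x"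
     "\<And>v. differentiable_upto k S (\<lambda>x. frechet_derivative f (at x) v)"
     "\<And>v. differentiable_upto k S (\<lambda>x. frechet_derivative g (at x) v)"
    by (simp_all add: differentiable_upto_Suc)
  show ?case
  proof (rule differentiable_upto_SucI[OF assms(1)])
    show "((\<lambda>x. f x + g x) has_derivative
       (\<lambda>v. frechet_derivative f (at x) v + frechet_derivative g (at x) v)) (at x)" if "x \<in> S" for x
      using fg that by (intro has_derivative_add frechet_has_derivative) auto
  qed (use Suc.IH fg in auto)
qed

lemma differentiable_upto_sum:
  assumes "open S" "finite I" "\<And>i. i \<in> I \<Longrightarrow> differentiable_upto k S (f i)"
  shows "differentiable_upto k S (\<lambda>x. \<Sum>i\<in>I. f i x)"
  using assms(2,3)
  by (induction I rule: finite_induct)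
    (auto simp: differentiable_upto_const intro!: differentiable_upto_add[OF assms(1)])

lemma differentiable_upto_Pair:
  assumes "open S" "differentiable_upto k S f" "differentiable_upto k S g"
  shows "differentiable_upto k S (\<lambda>x. (f x, g x))"
  using assms(2,3)
proof (induction k arbitrary: f g)
  case 0
  then show ?case unfolding differentiable_upto_0 differentiable_def
    by (blast intro: has_derivative_Pair)
next
  case (Suc k)
  then have fg: "\<forall>x\<in>S. f differentiable at x" "\<forall>x\<in>S. g differentiable at x"
     "\<And>v. differentiable_upto k S (\<lambda>x. frechet_derivative f (at x) v)"
     "\<And>v. differentiable_upto k S (\<lambda>x. frechet_derivative g (at x) v)"
    by (simp_all add: differentiable_upto_Suc)
  show ?case
  proof (rule differentiable_upto_SucI[OF assms(1)])
    show "((\<lambda>x. (f x, g x)) has_derivative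
       (\<lambda>v. (frechet_derivative f (at x) v, frechet_derivative g (at x) v))) (at x)" if "x \<in> S" for x
      using fg that by (intro has_derivative_Pair frechet_has_derivative) auto
  qed (use Suc.IH fg in auto)
qed

lemma differentiable_upto_scaleR:
  fixes f :: "'a::real_normed_vector \<Rightarrow> real"
  assumes "open S" "differentiable_upto k S f" "differentiable_upto k S g"
  shows "differentiable_upto k S (\<lambda>x. f x *\<^sub>R g x)"
  using assms(2,3)
proof (induction k arbitrary: f g)
  case 0
  then show ?case by (auto simp add: differentiable_upto_0 intro: differentiable_scaleR)
next
  case (Suc k)
  then have fg: "\<forall>x\<in>S. f differentiable at x" "\<forall>x\<in>S. g differentiable at x"
     "\<And>v. differentiable_upto k S (\<lambda>x. frechet_derivative f (at x) v)"
     "\<And>v. differentiable_upto k S (\<lambda>x. frechet_derivative g (at x) v)"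
    by (simp_all add: differentiable_upto_Suc)
  have fgk: "differentiable_upto k S f" "differentiable_upto k S g"
    using Suc.prems by (auto elim: differentiable_upto_mono)
  show ?case
  proof (rule differentiable_upto_SucI[OF assms(1)])
    show "((\<lambda>x. f x *\<^sub>R g x) has_derivative
       (\<lambda>v. f x *\<^sub>R frechet_derivative g (at x) v + frechet_derivative f (at x) v *\<^sub>R g x)) (at x)"
      if "x \<in> S" for x
      using fg that by (intro has_derivative_scaleR frechet_has_derivative) auto
    show "differentiable_upto k S
       (\<lambda>x. f x *\<^sub>R frechet_derivative g (at x) v + frechet_derivative f (at x) v *\<^sub>R g x)" for v
      using fg fgk by (intro differentiable_upto_add[OF assms(1)] Suc.IH) auto
  qed
qed

text \<open>The chain rule expresses the derivatives of a composition by sums of products of compositions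
  with one derivative less, which makes the induction on the order work.\<close>

lemma differentiable_upto_compose:
  fixes f :: "'a::real_normed_vector \<Rightarrow> 'b::euclidean_space"
  assumes "open S" "open T" "f ` S \<subseteq> T" "differentiable_upto k S f" "differentiable_upto k T g"
  shows "differentiable_upto k S (\<lambda>x. g (f x))"
  using assms(4,5)
proof (induction k arbitrary: g)
  case 0
  then have "(g \<circ> f) differentiable at x" if "x \<in> S" for x
    using that assms(3) by (intro differentiable_chain_at) (auto simp: differentiable_upto_0)
  then show ?case by (simp add: differentiable_upto_0 o_def)
next
  case (Suc k)
  then have fg: "\<forall>x\<in>S. f differentiable at x" "\<forall>x\<in>T. g differentiable at x"
     "\<And>v. differentiable_upto k S (\<lambda>x. frechet_derivative f (at x) v)"
     "\<And>v. differentiable_upto k T (\<lambda>x. frechet_derivative g (at x) v)"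
    by (simp_all add: differentiable_upto_Suc)
  have fk: "differentiable_upto k S f"
    using Suc.prems by (auto elim: differentiable_upto_mono)
  show ?case
  proof (rule differentiable_upto_SucI[OF assms(1)])
    show "((\<lambda>x. g (f x)) has_derivative
       (\<lambda>v. \<Sum>b\<in>Basis. (frechet_derivative f (at x) v \<bullet> b) *\<^sub>R frechet_derivative g (at (f x)) b)) (at x)"
      if "x \<in> S" for x
    proof -
      have lin: "linear (frechet_derivative g (at (f x)))"
        using fg(2) assms(3) that linear_frechet_derivative by blast
      have "(g \<circ> f has_derivative (frechet_derivative g (at (f x)) \<circ> frechet_derivative f (at x))) (at x)"
        using fg(1,2) assms(3) that
        by (intro diff_chain_at) (auto simp flip: frechet_derivative_works)
      moreover have rep: "frechet_derivative g (at (f x)) w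
          = (\<Sum>b\<in>Basis. (w \<bullet> b) *\<^sub>R frechet_derivative g (at (f x)) b)" for w
        by (subst (1) euclidean_representation[symmetric])
          (simp add: linear_sum[OF lin] linear_scale[OF lin])
      have "frechet_derivative g (at (f x)) \<circ> frechet_derivative f (at x) =
         (\<lambda>v. \<Sum>b\<in>Basis. (frechet_derivative f (at x) v \<bullet> b) *\<^sub>R frechet_derivative g (at (f x)) b)"
        by (rule ext) (simp only: o_apply rep[symmetric])
      ultimately show ?thesis by (simp add: o_def)
    qed
    show "differentiable_upto k S (\<lambda>x. \<Sum>b\<in>Basis.
       (frechet_derivative f (at x) v \<bullet> b) *\<^sub>R frechet_derivative g (at (f x)) b)" for v
      using Suc.IH[OF fk fg(4)] fg(3)
      by (intro differentiable_upto_sum[OF assms(1)] differentiable_upto_scaleR[OF assms(1)]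
          differentiable_upto_bounded_linear[OF bounded_linear_inner_left assms(1)]) auto
  qed
qed

lemma differentiable_upto_inverse:
  fixes f :: "'a::real_normed_vector \<Rightarrow> real"
  assumes "open S" "differentiable_upto k S f" "\<And>x. x \<in> S \<Longrightarrow> f x \<noteq> 0"
  shows "differentiable_upto k S (\<lambda>x. inverse (f x))"
  using assms(2)
proof (induction k)
  case 0
  then show ?case using assms(3) by (auto simp: differentiable_upto_0 intro!: differentiable_inverse)
next
  case (Suc k)
  then have f: "\<forall>x\<in>S. f differentiable at x"
     "\<And>v. differentiable_upto k S (\<lambda>x. frechet_derivative f (at x) v)"
    by (simp_all add: differentiable_upto_Suc)
  have IH: "differentiable_upto k S (\<lambda>x. inverse (f x))"
    using Suc.prems by (intro Suc.IH) (auto elim: differentiable_upto_mono)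
  show ?case
  proof (rule differentiable_upto_SucI[OF assms(1)])
    show "((\<lambda>x. inverse (f x)) has_derivative
      (\<lambda>v. - (inverse (f x) *\<^sub>R (frechet_derivative f (at x) v *\<^sub>R inverse (f x))))) (at x)"
      if "x \<in> S" for x
      using Deriv.has_derivative_inverse[of f x, OF assms(3)[OF that]
          frechet_has_derivative[of f x]] f(1) that
      by (simp add: mult.assoc)
    show "differentiable_upto k S
       (\<lambda>x. - (inverse (f x) *\<^sub>R (frechet_derivative f (at x) v *\<^sub>R inverse (f x))))" for v
      by (intro differentiable_upto_bounded_linear[OF bounded_linear_minus[OF bounded_linear_ident] assms(1)]
        differentiable_upto_scaleR assms(1) IH f(2))
  qed
qed

lemma smooth_on_const: "smooth_on S (\<lambda>x. c)"
  by (simp add: smooth_on_iff_upto differentiable_upto_const)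

lemma smooth_on_bounded_linear_compose:
  "bounded_linear L \<Longrightarrow> open S \<Longrightarrow> smooth_on S f \<Longrightarrow> smooth_on S (\<lambda>x. L (f x))"
  by (simp add: smooth_on_iff_upto differentiable_upto_bounded_linear)

lemma smooth_on_ident: "smooth_on S (\<lambda>x::'a::real_normed_vector. x)"
proof (rule smooth_on_local)
  have "smooth_on UNIV (\<lambda>x::'a. x)"
  proof -
    have "frechet_derivative (\<lambda>x::'a. x) (at x) v = v" for x v
      by (rule frechet_derivative_eqI) (auto intro!: derivative_eq_intros)
    then show ?thesis
      unfolding smooth_on_iff_derivatives[of UNIV "\<lambda>x::'a. x"] by (simp add: smooth_on_const)
  qed
  then show "\<exists>W g. open W \<and> x \<in> W \<and> smooth_on W g \<and> (\<forall>y\<in>W. y = g y)" for x :: 'a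
    by (intro exI[of _ UNIV] exI[of _ "\<lambda>x. x"]) auto
qed

lemma smooth_on_add: "open S \<Longrightarrow> smooth_on S f \<Longrightarrow> smooth_on S g \<Longrightarrow> smooth_on S (\<lambda>x. f x + g x)"
  by (simp add: smooth_on_iff_upto differentiable_upto_add)

lemma smooth_on_minus: "open S \<Longrightarrow> smooth_on S f \<Longrightarrow> smooth_on S (\<lambda>x. - f x)"
  by (rule smooth_on_bounded_linear_compose[OF bounded_linear_minus[OF bounded_linear_ident]])

lemma smooth_on_diff: "open S \<Longrightarrow> smooth_on S f \<Longrightarrow> smooth_on S g \<Longrightarrow> smooth_on S (\<lambda>x. f x - g x)"
  using smooth_on_add[OF _ _ smooth_on_minus, of S f g] by simp

lemma smooth_on_mult:
  fixes f g :: "'a::real_normed_vector \<Rightarrow> real"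
  shows "open S \<Longrightarrow> smooth_on S f \<Longrightarrow> smooth_on S g \<Longrightarrow> smooth_on S (\<lambda>x. f x * g x)"
  using differentiable_upto_scaleR[of S _ f g] by (simp add: smooth_on_iff_upto)

lemma smooth_on_divide:
  fixes f g :: "'a::real_normed_vector \<Rightarrow> real"
  assumes "open S" "smooth_on S f" "smooth_on S g" "\<And>x. x \<in> S \<Longrightarrow> g x \<noteq> 0"
  shows "smooth_on S (\<lambda>x. f x / g x)"
  using smooth_on_mult[of S f "\<lambda>x. inverse (g x)"] assms differentiable_upto_inverse[of S _ g]
  by (simp add: smooth_on_iff_upto divide_inverse)

lemma smooth_on_Pair: "open S \<Longrightarrow> smooth_on S f \<Longrightarrow> smooth_on S g \<Longrightarrow> smooth_on S (\<lambda>x. (f x, g x))"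
  by (simp add: smooth_on_iff_upto differentiable_upto_Pair)

lemma smooth_on_fst: "open S \<Longrightarrow> smooth_on S f \<Longrightarrow> smooth_on S (\<lambda>x. fst (f x))"
  by (rule smooth_on_bounded_linear_compose[OF bounded_linear_fst])

lemma smooth_on_snd: "open S \<Longrightarrow> smooth_on S f \<Longrightarrow> smooth_on S (\<lambda>x. snd (f x))"
  by (rule smooth_on_bounded_linear_compose[OF bounded_linear_snd])

lemma smooth_on_compose:
  fixes f :: "'a::real_normed_vector \<Rightarrow> 'b::euclidean_space"
  shows "open S \<Longrightarrow> open T \<Longrightarrow> smooth_on T g \<Longrightarrow> smooth_on S f \<Longrightarrow> f ` S \<subseteq> T \<Longrightarrow> smooth_on S (\<lambda>x. g (f x))"
  by (simp add: smooth_on_iff_upto differentiable_upto_compose)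

lemma smooth_on_compose_UNIV:
  fixes f :: "'a::real_normed_vector \<Rightarrow> 'b::euclidean_space"
  shows "open S \<Longrightarrow> smooth_on UNIV g \<Longrightarrow> smooth_on S f \<Longrightarrow> smooth_on S (\<lambda>x. g (f x))"
  by (rule smooth_on_compose[of S UNIV]) auto

lemmas smooth_intros = smooth_on_const smooth_on_ident smooth_on_add smooth_on_diff smooth_on_minus
  smooth_on_mult smooth_on_divide smooth_on_Pair smooth_on_fst smooth_on_snd

lemma smooth_on_derivative_sequence:
  fixes D :: "nat \<Rightarrow> real \<Rightarrow> real"
  assumes "\<And>k x. (D k has_real_derivative D (Suc k) x) (at x)"
  shows "smooth_on S (D k)"
proof -
  have fre: "frechet_derivative (\<lambda>x. c * D k x) (at x) v = c * v * D (Suc k) x" for c k x v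
    by (rule frechet_derivative_eqI)
      (auto intro!: derivative_eq_intros assms[unfolded has_field_derivative_def])
  have "iterated_derivative vs (\<lambda>x. c * D k x) = (\<lambda>x. c * prod_list vs * D (k + length vs) x)" for vs c k
  proof (induction vs arbitrary: c k)
    case (Cons a vs)
    from Cons[of "c * a" "Suc k"] show ?case by (simp add: fre mult.assoc)
  qed simp
  from this[of _ 1 k] have "iterated_derivative vs (D k) = (\<lambda>x. prod_list vs * D (k + length vs) x)" for vs
    by simp
  moreover have "D j differentiable at x" for j x
    using assms real_differentiable_def by blast
  ultimately show ?thesis by (auto simp: smooth_on_def)
qed

lemma iterated_derivative_append:
  "iterated_derivative (us @ vs) f = iterated_derivative vs (iterated_derivative us f)"
  by (induction us arbitrary: f) auto

abbreviation nth_deriv :: "nat \<Rightarrow> (real \<Rightarrow> real) \<Rightarrow> real \<Rightarrow> real" where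
  "nth_deriv k \<equiv> iterated_derivative (replicate k 1)"

lemma has_real_derivative_frechet:
  "f differentiable at x \<Longrightarrow> (f has_real_derivative frechet_derivative f (at x) 1) (at x)"
proof -
  assume "f differentiable at x"
  then obtain d where d: "(f has_real_derivative d) (at x)" by (auto simp: real_differentiable_def)
  then have "frechet_derivative f (at x) 1 = d * 1"
    by (intro frechet_derivative_eqI) (simp add: has_field_derivative_def)
  with d show ?thesis by simp
qed

lemma nth_deriv_has_real_derivative:
  assumes "smooth_on UNIV f"
  shows "(nth_deriv k f has_real_derivative nth_deriv (Suc k) f x) (at x)"
proof -
  have "nth_deriv (Suc k) f = iterated_derivative [1] (nth_deriv k f)"
    by (simp only: replicate_Suc iterated_derivative_append flip: replicate_append_same)
  then show ?thesis
    using has_real_derivative_frechet[of "nth_deriv k f" x] assms by (simp add: smooth_on_def)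
qed

lemma nth_deriv_unique:
  assumes "\<And>k x. (D k has_real_derivative D (Suc k) x) (at x)"
  shows "nth_deriv k (D 0) = D k"
proof -
  have "nth_deriv k (D j) = D (j + k)" for j
  proof (induction k arbitrary: j)
    case (Suc k)
    have "frechet_derivative (D j) (at x) 1 = D (Suc j) x" for x
      using frechet_derivative_eqI[of "D j" _ x 1] assms[of j x] by (simp add: has_field_derivative_def)
    then show ?case using Suc[of "Suc j"] by simp
  qed simp
  then show ?thesis by simp
qed

text \<open>Smooth dependence of an inverse function on a parameter: the derivative of the inverse of
  \<open>(x, y) \<mapsto> (x, G (x, y))\<close> is given by an expression in the derivatives of \<open>G\<close> at the
  inverse itself, so its regularity bootstraps.\<close>

lemma smooth_on_fibrewise_inverse:
  fixes G K :: "real \<times> real \<Rightarrow> real"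
  assumes G: "smooth_on UNIV G"
    and pos: "\<And>z. frechet_derivative G (at z) (0, 1) \<noteq> 0"
    and GK: "\<And>x z. G (x, K (x, z)) = z" and KG: "\<And>x y. K (x, G (x, y)) = y"
  shows "smooth_on UNIV K"
proof -
  define f where "f z = (fst z, G z)" for z
  define g where "g z = (fst z, K z)" for z
  define DG where "DG z = frechet_derivative G (at z)" for z
  define Dg where "Dg z v = (fst v, (snd v - DG (g z) (fst v, 0)) / DG (g z) (0, 1))" for z and v :: "real \<times> real"
  have DG: "(G has_derivative DG z) (at z)" for z
    using smooth_on_imp_differentiable[OF G UNIV_I] frechet_derivative_works unfolding DG_def by blast
  have lin: "linear (DG z)" for z using DG has_derivative_linear by blast
  have split: "DG z (a, b) = DG z (a, 0) + b * DG z (0, 1)" for z a b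
    using linear_add[OF lin, of z "(a, 0)" "(0, b)"] linear_scale[OF lin, of z b "(0, 1)"] by simp
  have fg: "f (g z) = z" "g (f z) = z" for z
    by (cases z; simp add: f_def g_def GK KG)+
  have "(g has_derivative Dg (f (g z))) (at (f (g z)))" for z
  proof (rule has_derivative_inverse_strong[of UNIV "g z" f g])
    show "(f has_derivative (\<lambda>v. (fst v, DG (g z) v))) (at (g z))"
      unfolding f_def by (intro has_derivative_Pair has_derivative_fst has_derivative_ident DG)
    show "continuous_on UNIV f"
      unfolding f_def
      by (intro continuous_on_Pair continuous_on_fst continuous_on_id smooth_on_imp_continuous_on[OF G])
    have "DG (g z) (a, (b - DG (g z) (a, 0)) / DG (g z) (0, 1)) = b" for a b
      using pos by (subst split) (simp add: DG_def)
    then show "(\<lambda>v. (fst v, DG (g z) v)) \<circ> Dg (f (g z)) = id"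
      by (auto simp: Dg_def fg fun_eq_iff)
  qed (simp_all add: fg)
  then have Dg: "(g has_derivative Dg z) (at z)" for z by (simp add: fg)
  have "differentiable_upto k UNIV g" for k
  proof (induction k)
    case 0
    show ?case using Dg by (auto simp: differentiable_upto_0 differentiable_def)
  next
    case (Suc k)
    have DGk: "differentiable_upto k UNIV (\<lambda>z. DG (g z) v)" for v
    proof (rule differentiable_upto_compose[OF open_UNIV open_UNIV _ Suc])
      show "differentiable_upto k UNIV (\<lambda>z. DG z v)"
        using iffD1[OF smooth_on_iff_derivatives G] by (cases v) (simp add: DG_def smooth_on_iff_upto)
    qed simp
    have "differentiable_upto k UNIV (\<lambda>z. (fst v, inverse (DG (g z) (0, 1)) *\<^sub>R (snd v + (-1) *\<^sub>R DG (g z) (fst v, 0))))"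
      for v :: "real \<times> real"
      using pos
      by (intro differentiable_upto_Pair differentiable_upto_const differentiable_upto_scaleR
          differentiable_upto_inverse differentiable_upto_add DGk) (auto simp: DG_def)
    then show ?case
      using differentiable_upto_SucI[OF open_UNIV Dg, of k] by (simp add: Dg_def divide_inverse_commute)
  qed
  then have "smooth_on UNIV g" by (simp add: smooth_on_iff_upto)
  from smooth_on_snd[OF open_UNIV this] show ?thesis by (simp add: g_def)
qed

section \<open>Flat functions, cut-off functions and sums of small functions\<close>

definition flat :: "real \<Rightarrow> real" where
  "flat y = (if y > 0 then exp (- (1 / y)) else 0)"

lemma poly_times_exp_minus_at_top: "((\<lambda>x::real. poly p x * exp (- x)) \<longlongrightarrow> 0) at_top"
proof -
  have "((\<lambda>x::real. \<Sum>i\<le>degree p. coeff p i * (x ^ i / exp x)) \<longlongrightarrow> (\<Sum>i\<le>degree p. coeff p i * 0)) at_top"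
    by (intro tendsto_sum tendsto_mult tendsto_const tendsto_power_div_exp_0)
  then show ?thesis
    by (simp add: poly_altdef sum_distrib_right exp_minus divide_inverse mult.assoc)
qed

text \<open>All derivatives of \<^const>\<open>flat\<close> are of the form \<open>P (1 / y) exp (- 1 / y)\<close> with a polynomial
  \<open>P\<close>, and such a function has derivative \<open>0\<close> at \<open>0\<close>.\<close>

lemma smooth_on_flat: "smooth_on S flat"
proof -
  define fl :: "real poly \<Rightarrow> real \<Rightarrow> real" where
    "fl p y = (if y > 0 then poly p (1 / y) * exp (- (1 / y)) else 0)" for p y
  define d :: "real poly \<Rightarrow> real poly" where "d p = [:0, 0, 1:] * (p - pderiv p)" for p
  have "(fl p has_real_derivative fl (d p) x) (at x)" for p x
  proof -
    consider "x > 0" | "x < 0" | "x = 0" by linarith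
    then show ?thesis
    proof cases
      case 1
      have "((\<lambda>y. poly p (1 / y) * exp (- (1 / y))) has_real_derivative fl (d p) x) (at x)"
        using 1 by (auto intro!: derivative_eq_intros DERIV_chain2[OF poly_DERIV]
            simp: fl_def d_def field_simps power2_eq_square)
      then show ?thesis
        using 1 by (rule_tac has_field_derivative_transform_within_open[of _ _ _ "{0<..}"])
          (auto simp: fl_def)
    next
      case 2
      have "((\<lambda>y. 0) has_real_derivative 0) (at x)" by simp
      then show ?thesis
        using 2 by (rule_tac has_field_derivative_transform_within_open[of "\<lambda>y. 0" _ _ "{..<0}"])
          (auto simp: fl_def)
    next
      case 3
      have "((\<lambda>h. poly (pCons 0 p) (inverse h) * exp (- inverse h)) \<longlongrightarrow> 0) (at_right 0)"
        by (rule filterlim_compose[OF poly_times_exp_minus_at_top filterlim_inverse_at_top_right])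
      then have "((\<lambda>h. fl p h / h) \<longlongrightarrow> 0) (at_right 0)"
        by (rule Lim_transform_eventually)
          (auto simp: fl_def eventually_at_right_less divide_inverse mult_ac
            intro!: eventually_at_rightI[of 0 1])
      moreover have "((\<lambda>h. fl p h / h) \<longlongrightarrow> 0) (at_left 0)"
        by (rule Lim_transform_eventually[OF tendsto_const])
          (auto simp: fl_def intro!: eventually_at_leftI[of "-1"])
      ultimately have "((\<lambda>h. fl p h / h) \<longlongrightarrow> 0) (at 0)"
        by (simp add: filterlim_split_at)
      then show ?thesis using 3 by (simp add: DERIV_def fl_def)
    qed
  qed
  then have "smooth_on S (fl ((d ^^ 0) 1))"
    by (intro smooth_on_derivative_sequence[where D = "\<lambda>k. fl ((d ^^ k) 1)"]) simp
  moreover have "fl ((d ^^ 0) 1) = flat" by (auto simp: fl_def flat_def)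
  ultimately show ?thesis by simp
qed

lemma flat_pos: "y > 0 \<Longrightarrow> flat y > 0" and flat_nonpos: "y \<le> 0 \<Longrightarrow> flat y = 0"
  and flat_nonneg: "flat y \<ge> 0"
  by (auto simp: flat_def)

definition smooth_step :: "real \<Rightarrow> real" where
  "smooth_step y = flat y / (flat y + flat (1 - y))"

lemma smooth_step_denominator: "flat y + flat (1 - y) > 0"
proof (cases "y > 0")
  case True
  then show ?thesis using flat_pos[of y] flat_nonneg[of "1 - y"] by linarith
next
  case False
  then show ?thesis using flat_pos[of "1 - y"] flat_nonneg[of y] by linarith
qed

lemma smooth_on_smooth_step: "smooth_on UNIV smooth_step"
  unfolding smooth_step_def
  by (intro smooth_on_divide smooth_on_add smooth_on_flat smooth_on_compose_UNIV[OF open_UNIV smooth_on_flat]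
      smooth_intros open_UNIV) (use smooth_step_denominator less_irrefl in metis)

lemma smooth_step_le_0: "y \<le> 0 \<Longrightarrow> smooth_step y = 0"
  by (simp add: smooth_step_def flat_nonpos)

lemma smooth_step_ge_1: "y \<ge> 1 \<Longrightarrow> smooth_step y = 1"
  using smooth_step_denominator[of y] by (simp add: smooth_step_def flat_nonpos)

lemma smooth_step_bounds: "0 \<le> smooth_step y" "smooth_step y \<le> 1"
  using smooth_step_denominator[of y] flat_nonneg[of y] flat_nonneg[of "1 - y"]
  by (auto simp: smooth_step_def)

lemma smooth_on_suminf:
  assumes smooth: "\<And>n. smooth_on UNIV (f n)"
    and bound: "\<And>k. \<exists>M. summable M \<and> (\<forall>n x. \<bar>nth_deriv k (f n) x\<bar> \<le> M n)"
  shows "smooth_on UNIV (\<lambda>x. \<Sum>n. f n x)"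
    and "((\<lambda>x. \<Sum>n. f n x) has_real_derivative (\<Sum>n. nth_deriv 1 (f n) x)) (at x)"
proof -
  have D: "((\<lambda>x. \<Sum>n. nth_deriv k (f n) x) has_real_derivative (\<Sum>n. nth_deriv (Suc k) (f n) x)) (at x)"
    for k x
  proof (rule has_field_derivative_series'(2)[of UNIV _ _ 0])
    show "(nth_deriv k (f n) has_real_derivative nth_deriv (Suc k) (f n) y) (at y)" for n y
      by (rule nth_deriv_has_real_derivative[OF smooth])
    obtain M where M: "summable M \<and> (\<forall>n x. \<bar>nth_deriv (Suc k) (f n) x\<bar> \<le> M n)"
      using bound ..
    show "uniformly_convergent_on UNIV (\<lambda>n x. \<Sum>i<n. nth_deriv (Suc k) (f i) x)"
      by (rule Weierstrass_m_test'[of _ _ M]) (use M in simp_all)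
    obtain M' where M': "summable M' \<and> (\<forall>n x. \<bar>nth_deriv k (f n) x\<bar> \<le> M' n)"
      using bound ..
    show "summable (\<lambda>n. nth_deriv k (f n) 0)"
      by (rule summable_comparison_test[of _ M']) (use M' in auto)
  qed auto
  have "smooth_on UNIV (\<lambda>x. \<Sum>n. nth_deriv 0 (f n) x)"
    using D by (rule smooth_on_derivative_sequence)
  then show "smooth_on UNIV (\<lambda>x. \<Sum>n. f n x)" by simp
  show "((\<lambda>x. \<Sum>n. f n x) has_real_derivative (\<Sum>n. nth_deriv 1 (f n) x)) (at x)"
    using D[of 0 x] by simp
qed

lemma nth_deriv_zero: "nth_deriv k (\<lambda>x. 0) = (\<lambda>x. 0)"
  by (rule nth_deriv_unique[where D = "\<lambda>k x. 0"]) simp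

lemma nth_deriv_add:
  assumes "smooth_on UNIV f" "smooth_on UNIV g"
  shows "nth_deriv k (\<lambda>x. f x + g x) = (\<lambda>x. nth_deriv k f x + nth_deriv k g x)"
  using nth_deriv_unique[where D = "\<lambda>k x. nth_deriv k f x + nth_deriv k g x" and k = k]
    DERIV_add[OF nth_deriv_has_real_derivative[OF assms(1)] nth_deriv_has_real_derivative[OF assms(2)]]
  by simp

text \<open>The derivatives in \<open>y\<close> are continuous in both variables and vanish for the parameter \<open>0\<close>, so
  by uniform continuity on a compact set they are uniformly small for small parameters.\<close>

lemma eventually_nth_deriv_small:
  fixes F :: "real \<times> real \<Rightarrow> real"
  assumes F: "smooth_on ({-e<..<e} \<times> UNIV) F" and "e > 0"
    and zero: "\<And>y. F (0, y) = 0"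
    and supp: "\<And>t y. \<bar>y\<bar> \<ge> R \<Longrightarrow> F (t, y) = 0" and "c > 0"
  shows "\<forall>\<^sub>F t in at_right 0. smooth_on UNIV (\<lambda>y. F (t, y)) \<and>
           (\<forall>k\<le>N. \<forall>y. \<bar>nth_deriv k (\<lambda>y. F (t, y)) y\<bar> \<le> c)"
proof -
  let ?U = "{-e<..<e} \<times> (UNIV :: real set)"
  define G where "G k = iterated_derivative (replicate k (0, 1)) F" for k
  have op: "open ?U" by (simp add: open_Times)
  have G: "\<And>z. z \<in> ?U \<Longrightarrow> G k differentiable at z" for k
    using F by (auto simp: smooth_on_def G_def)
  have GS: "G (Suc k) z = frechet_derivative (G k) (at z) (0, 1)" for k z
    unfolding G_def by (simp only: replicate_Suc iterated_derivative_append iterated_derivative.simps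
        flip: replicate_append_same)
  have DG: "((\<lambda>y. G k (t, y)) has_real_derivative G (Suc k) (t, y)) (at y)" if "\<bar>t\<bar> < e" for k t y
  proof -
    have "((\<lambda>y. G k (t, y)) has_derivative (\<lambda>v. frechet_derivative (G k) (at (t, y)) (0, v))) (at y)"
    proof (rule has_derivative_compose[of "\<lambda>y. (t, y)" "\<lambda>v. (0, v)"])
      show "((\<lambda>y. (t, y)) has_derivative (\<lambda>v. (0, v))) (at y)"
        by (auto intro!: derivative_eq_intros)
      show "(G k has_derivative frechet_derivative (G k) (at (t, y))) (at (t, y))"
        using that by (intro iffD1[OF frechet_derivative_works] G) auto
    qed
    moreover have "linear (frechet_derivative (G k) (at (t, y)))"
      using that by (intro linear_frechet_derivative G) auto
    then have "frechet_derivative (G k) (at (t, y)) (0, v) = G (Suc k) (t, y) * v" for v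
      using linear_scale[of "frechet_derivative (G k) (at (t, y))" v "(0, 1)"] by (simp add: GS)
    ultimately show ?thesis by (simp add: has_field_derivative_def)
  qed
  have nth: "nth_deriv k (\<lambda>y. F (t, y)) = (\<lambda>y. G k (t, y))" if "\<bar>t\<bar> < e" for k t
    using nth_deriv_unique[where D = "\<lambda>k y. G k (t, y)" and k = k] DG[OF that] by (simp add: G_def)
  have sm: "smooth_on UNIV (\<lambda>y. F (t, y))" if "\<bar>t\<bar> < e" for t
    using smooth_on_derivative_sequence[where D = "\<lambda>k y. G k (t, y)" and k = 0 and S = UNIV] DG[OF that]
    by (simp add: G_def)
  have G0: "G k (0, y) = 0" for k y
  proof -
    have "(\<lambda>y. G k (0, y)) = nth_deriv k (\<lambda>y. F (0, y))"
      by (rule nth[symmetric]) (use \<open>e > 0\<close> in simp)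
    also have "\<dots> = (\<lambda>y. 0)" by (simp only: zero nth_deriv_zero)
    finally show ?thesis by (rule fun_cong)
  qed
  have Gsupp: "G k (t, y) = 0" if "\<bar>y\<bar> > R" for k t y
  proof -
    have "G k (t, y) = iterated_derivative (replicate k (0, 1)) (\<lambda>z. 0) (t, y)"
      unfolding G_def
    proof (rule iterated_derivative_cong[of "UNIV \<times> - {-R..R}"])
      show "open (UNIV \<times> - {-R..R})" by (intro open_Times) auto
    qed (use supp that in auto)
    also have "iterated_derivative (replicate k (0, 1)) (\<lambda>z::real \<times> real. 0::real) = (\<lambda>z. 0)"
      by (induction k) auto
    finally show ?thesis .
  qed
  have ev: "\<forall>\<^sub>F t in at_right 0. \<forall>y. \<bar>G k (t, y)\<bar> \<le> c" for k
  proof -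
    have "uniformly_continuous_on ({-(e/2)..e/2} \<times> {-R..R}) (G k)"
      using \<open>e > 0\<close> by (intro compact_uniformly_continuous compact_Times continuous_at_imp_continuous_on ballI
          differentiable_imp_continuous_within G) auto
    then have "\<exists>d>0. \<forall>z\<in>{-(e/2)..e/2} \<times> {-R..R}. \<forall>z'\<in>{-(e/2)..e/2} \<times> {-R..R}.
        dist z' z < d \<longrightarrow> dist (G k z') (G k z) < c"
      using \<open>c > 0\<close> unfolding uniformly_continuous_on_def by blast
    then obtain d where d: "d > 0" "\<forall>z\<in>{-(e/2)..e/2} \<times> {-R..R}. \<forall>z'\<in>{-(e/2)..e/2} \<times> {-R..R}.
        dist z' z < d \<longrightarrow> dist (G k z') (G k z) < c" by blast
    have "\<bar>G k (t, y)\<bar> \<le> c" if t: "0 < t" "t < min d (e/2)" for t y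
    proof (cases "\<bar>y\<bar> > R")
      case True
      then have "G k (t, y) = 0" by (rule Gsupp)
      then show ?thesis using \<open>c > 0\<close> by linarith
    next
      case False
      then have "dist (G k (t, y)) (G k (0, y)) < c"
        using t \<open>e > 0\<close> by (intro d(2)[rule_format]) (auto simp: dist_Pair_Pair)
      then show ?thesis by (simp add: G0 dist_real_def)
    qed
    then have "\<forall>y. \<bar>G k (t, y)\<bar> \<le> c" if "t \<in> {0<..<min d (e/2)}" for t
      using that unfolding greaterThanLessThan_iff by blast
    moreover have "0 < min d (e/2)" using d(1) \<open>e > 0\<close> by simp
    ultimately show ?thesis by (rule eventually_at_rightI)
  qed
  have "\<forall>\<^sub>F t in at_right 0. \<forall>k\<in>{..N}. \<forall>y. \<bar>G k (t, y)\<bar> \<le> c"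
    using ev by (intro eventually_ball_finite) auto
  moreover have "\<forall>\<^sub>F t in at_right 0. \<bar>t\<bar> < e"
    using \<open>e > 0\<close> by (intro eventually_at_rightI[of 0 e]) auto
  ultimately show ?thesis
  proof eventually_elim
    case (elim t)
    then show ?case using sm[of t] by (simp only: nth) simp
  qed
qed

section \<open>Diffeomorphisms of an interval without small symmetries\<close>

text \<open>The coordinate on the interval between \<open>p\<close> and \<open>q\<close> in which the hyperbolic Moebius
  transformations fixing \<open>p\<close> and \<open>q\<close> are the translations.\<close>

definition moebius_coord :: "real \<Rightarrow> real \<Rightarrow> real \<Rightarrow> real" where
  "moebius_coord p q y = ln ((y - p) / (q - y))"

text \<open>In the coordinate, \<open>h\<close> is the translation by \<open>T\<close> followed by a push to the right that
  is confined to points starting in \<open>{0<..<T/2}\<close>, half a fundamental domain, and is not trivial.\<close>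

definition twisted_translation :: "real \<Rightarrow> real \<Rightarrow> real \<Rightarrow> (real \<Rightarrow> real) \<Rightarrow> bool" where
  "twisted_translation p q T h \<longleftrightarrow> p < q \<and> T > 0 \<and> h p = p \<and> h q = q \<and>
     (\<forall>y\<in>{p<..<q}. h y \<in> {p<..<q} \<and> moebius_coord p q (h y) \<ge> moebius_coord p q y + T \<and>
        (moebius_coord p q y \<le> 0 \<or> moebius_coord p q y \<ge> T / 2 \<longrightarrow>
           moebius_coord p q (h y) = moebius_coord p q y + T)) \<and>
     (\<exists>y\<in>{p<..<q}. moebius_coord p q (h y) > moebius_coord p q y + T)"

lemma strict_mono_identity_plus_small:
  fixes f :: "real \<Rightarrow> real"
  assumes "\<And>x. (f has_real_derivative f' x) (at x)" "\<And>x. \<bar>f' x\<bar> < 1"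
  shows "strict_mono (\<lambda>x. x + f x)"
proof (rule strict_monoI)
  fix x y :: real assume "x < y"
  then show "x + f x < y + f y"
  proof (rule DERIV_pos_imp_increasing)
    fix z
    have "((\<lambda>x. x + f x) has_real_derivative 1 + f' z) (at z)"
      by (intro DERIV_add DERIV_ident assms(1))
    moreover have "1 + f' z > 0" using assms(2)[of z] by linarith
    ultimately show "\<exists>d. ((\<lambda>x. x + f x) has_real_derivative d) (at z) \<and> d > 0" by blast
  qed
qed

lemma moebius_coord_strict_mono:
  assumes "y \<in> {p<..<q}" "z \<in> {p<..<q}"
  shows "moebius_coord p q y < moebius_coord p q z \<longleftrightarrow> y < z"
proof -
  have "(y - p) / (q - y) < (z - p) / (q - z) \<longleftrightarrow> (y - p) * (q - z) < (z - p) * (q - y)"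
    using assms by (simp add: divide_less_eq less_divide_eq mult.commute field_simps)
  also have "\<dots> \<longleftrightarrow> y * (q - p) < z * (q - p)" by (simp add: algebra_simps)
  also have "\<dots> \<longleftrightarrow> y < z" using assms by simp
  finally show ?thesis using assms by (simp add: moebius_coord_def)
qed

lemma moebius_coord_le:
  assumes "y \<in> {p<..<q}" "z \<in> {p<..<q}"
  shows "moebius_coord p q y \<le> moebius_coord p q z \<longleftrightarrow> y \<le> z"
  using moebius_coord_strict_mono[OF assms(2,1)] by (simp add: linorder_not_less[symmetric])

text \<open>The perturbation is a Moebius transformation fixing \<open>m - r\<close> and \<open>m + r\<close>, cut off outside a
  larger interval, plus a bump.  The Moebius multiplier has to be chosen first: the bump has to fit
  into half a fundamental domain, which shrinks as the multiplier tends to \<open>1\<close>, and only then can its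
  height be chosen so small that its derivatives are small.\<close>

lemma exists_small_twisted_translation:
  assumes "r > 0" "c > 0" "c \<le> 1/4" "N \<ge> 1"
  shows "\<exists>T \<eta>. smooth_on UNIV \<eta> \<and> (\<forall>k\<le>N. \<forall>y. \<bar>nth_deriv k \<eta> y\<bar> \<le> c) \<and>
     (\<forall>y. \<bar>y - m\<bar> \<ge> 3 * r \<longrightarrow> \<eta> y = 0) \<and>
     (\<forall>y. \<bar>y - m\<bar> \<le> 2 * r \<and> y \<noteq> m - r \<and> y \<noteq> m + r \<longrightarrow> \<eta> y \<noteq> 0) \<and>
     twisted_translation (m - r) (m + r) T (\<lambda>y. y + \<eta> y)"
proof -
  define cut where "cut t = smooth_step (t + 3) * smooth_step (3 - t)" for t
  \<comment> \<open>Where \<open>cut t = 1\<close>, adding this to \<open>t\<close> gives \<open>(t + \<theta>) / (1 + \<theta> t)\<close>; the cut-off in the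
    denominator keeps it away from zero for all \<open>t\<close>.\<close>
  define F1 where "F1 = (\<lambda>(\<theta>, y). let t = (y - m) / r in
      r * cut t * (\<theta> * (1 - t * t)) / (1 + \<theta> * (cut t * t)))"
  have cut1: "cut t = 1" if "\<bar>t\<bar> \<le> 2" for t
    using that by (simp add: cut_def smooth_step_ge_1)
  have cut0: "cut t = 0" if "\<bar>t\<bar> \<ge> 3" for t
    using that by (auto simp: cut_def smooth_step_le_0 abs_if split: if_splits)
  have cutb: "0 \<le> cut t" "cut t \<le> 1" for t
    by (simp_all add: cut_def smooth_step_bounds mult_le_one)
  have cutt: "\<bar>cut t * t\<bar> \<le> 3" for t
  proof (cases "\<bar>t\<bar> \<ge> 3")
    case False
    then have "cut t * \<bar>t\<bar> \<le> 1 * 3" using cutb by (intro mult_mono) auto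
    then show ?thesis using cutb by (simp add: abs_mult)
  qed (simp add: cut0)
  have den: "1 + \<theta> * (cut t * t) > 0" if "\<bar>\<theta>\<bar> < 1/4" for \<theta> t
  proof -
    have "\<bar>\<theta> * (cut t * t)\<bar> \<le> 1/4 * 3"
      unfolding abs_mult[of \<theta>] using that cutt by (intro mult_mono) auto
    then show ?thesis by linarith
  qed
  have nz: "1 + \<theta> * (cut t * t) \<noteq> 0" if "- (1/4) < \<theta>" "\<theta> < 1/4" for \<theta> t
  proof -
    have "\<bar>\<theta>\<bar> < 1/4" using that by linarith
    then show ?thesis using den by (metis less_irrefl)
  qed
  have cut: "smooth_on UNIV cut"
    unfolding cut_def
    by (intro smooth_intros smooth_on_compose_UNIV[OF _ smooth_on_smooth_step] open_UNIV)
  have F1: "smooth_on ({-(1/4)<..<1/4} \<times> UNIV) F1"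
    unfolding F1_def Let_def case_prod_unfold
    using \<open>r > 0\<close>
    by (intro smooth_intros smooth_on_compose_UNIV[OF _ cut] open_Times nz) auto
  have far: "\<bar>(y - m) / r\<bar> \<ge> 3 \<longleftrightarrow> \<bar>y - m\<bar> \<ge> 3 * r" for y
    using \<open>r > 0\<close> by (simp add: pos_le_divide_eq)
  have "\<forall>\<^sub>F \<theta> in at_right 0. smooth_on UNIV (\<lambda>y. F1 (\<theta>, y)) \<and>
           (\<forall>k\<le>N. \<forall>y. \<bar>nth_deriv k (\<lambda>y. F1 (\<theta>, y)) y\<bar> \<le> c / 2)"
  proof (rule eventually_nth_deriv_small[OF F1])
    show "F1 (\<theta>, y) = 0" if "\<bar>m\<bar> + 3 * r \<le> \<bar>y\<bar>" for \<theta> y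
    proof -
      have "\<bar>y - m\<bar> \<ge> 3 * r" using that by linarith
      then show ?thesis using far cut0 by (simp add: F1_def)
    qed
  qed (use \<open>c > 0\<close> in \<open>auto simp: F1_def\<close>)
  moreover have "\<forall>\<^sub>F \<theta>::real in at_right 0. 0 < \<theta> \<and> \<theta> < 1/6"
    by (intro eventually_at_rightI[of 0 "1/6"]) auto
  ultimately have "\<forall>\<^sub>F \<theta> in at_right 0. (smooth_on UNIV (\<lambda>y. F1 (\<theta>, y)) \<and>
           (\<forall>k\<le>N. \<forall>y. \<bar>nth_deriv k (\<lambda>y. F1 (\<theta>, y)) y\<bar> \<le> c / 2)) \<and> 0 < \<theta> \<and> \<theta> < 1/6"
    by (rule eventually_conj)
  then obtain \<theta> where \<theta>: "smooth_on UNIV (\<lambda>y. F1 (\<theta>, y))" "0 < \<theta>" "\<theta> < 1/6"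
    "\<And>k y. k \<le> N \<Longrightarrow> \<bar>nth_deriv k (\<lambda>y. F1 (\<theta>, y)) y\<bar> \<le> c / 2"
    using eventually_happens' trivial_limit_at_right_real by (smt (verit, del_insts))
  \<comment> \<open>The support ends at \<open>\<theta> / 3\<close> because this point has coordinate less than \<open>T / 2\<close>.\<close>
  define \<beta> where "\<beta> y = flat ((y - m) / r) * flat (\<theta> / 3 - (y - m) / r)" for y
  define F2 where "F2 z = fst z * \<beta> (snd z)" for z
  have F2: "smooth_on ({-1<..<1} \<times> UNIV) F2"
    unfolding F2_def \<beta>_def using \<open>r > 0\<close>
    by (intro smooth_intros smooth_on_compose_UNIV[OF _ smooth_on_flat] open_Times) auto
  have \<beta>0: "\<beta> y = 0" if "(y - m) / r \<le> 0 \<or> (y - m) / r \<ge> \<theta> / 3" for y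
    using that by (auto simp: \<beta>_def flat_nonpos)
  have "\<forall>\<^sub>F \<delta> in at_right 0. smooth_on UNIV (\<lambda>y. F2 (\<delta>, y)) \<and>
           (\<forall>k\<le>N. \<forall>y. \<bar>nth_deriv k (\<lambda>y. F2 (\<delta>, y)) y\<bar> \<le> c / 2)"
  proof (rule eventually_nth_deriv_small[OF F2])
    show "F2 (\<delta>, y) = 0" if "\<bar>m\<bar> + 3 * r \<le> \<bar>y\<bar>" for \<delta> y
    proof -
      have "\<bar>(y - m) / r\<bar> \<ge> 3" using that far by (smt (verit))
      then have "(y - m) / r \<le> 0 \<or> (y - m) / r \<ge> \<theta> / 3" using \<theta>(3) by linarith
      then show ?thesis using \<beta>0 by (simp add: F2_def)
    qed
  qed (use \<open>c > 0\<close> in \<open>auto simp: F2_def\<close>)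
  moreover have "\<forall>\<^sub>F \<delta>::real in at_right 0. 0 < \<delta>"
    by (intro eventually_at_rightI[of 0 1]) auto
  ultimately have "\<forall>\<^sub>F \<delta> in at_right 0. (smooth_on UNIV (\<lambda>y. F2 (\<delta>, y)) \<and>
           (\<forall>k\<le>N. \<forall>y. \<bar>nth_deriv k (\<lambda>y. F2 (\<delta>, y)) y\<bar> \<le> c / 2)) \<and> 0 < \<delta>"
    by (rule eventually_conj)
  then obtain \<delta> where \<delta>: "smooth_on UNIV (\<lambda>y. F2 (\<delta>, y))" "0 < \<delta>"
    "\<And>k y. k \<le> N \<Longrightarrow> \<bar>nth_deriv k (\<lambda>y. F2 (\<delta>, y)) y\<bar> \<le> c / 2"
    using eventually_happens' trivial_limit_at_right_real by (smt (verit, del_insts))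
  define \<eta> where "\<eta> y = F1 (\<theta>, y) + F2 (\<delta>, y)" for y
  have \<eta>: "smooth_on UNIV \<eta>"
    unfolding \<eta>_def using \<theta>(1) \<delta>(1) by (intro smooth_on_add open_UNIV)
  have bound: "\<bar>nth_deriv k \<eta> y\<bar> \<le> c" if "k \<le> N" for k y
    using \<theta>(4)[OF that, of y] \<delta>(3)[OF that, of y] nth_deriv_add[OF \<theta>(1) \<delta>(1), of k]
    by (simp add: \<eta>_def[abs_def])
  have supp: "\<eta> y = 0" if "\<bar>y - m\<bar> \<ge> 3 * r" for y
  proof -
    have far': "\<bar>(y - m) / r\<bar> \<ge> 3" using that far by blast
    then have "(y - m) / r \<le> 0 \<or> (y - m) / r \<ge> \<theta> / 3" using \<theta>(3) by linarith
    then show ?thesis using far' cut0 \<beta>0 by (simp add: \<eta>_def F1_def F2_def)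
  qed
  have \<eta>_eq: "\<eta> y = r * (\<theta> * (1 - t * t) / (1 + \<theta> * t)) + \<delta> * \<beta> y"
    if "t = (y - m) / r" "\<bar>t\<bar> \<le> 2" for y t
    using that cut1[of t] by (simp add: \<eta>_def F1_def F2_def)
  have \<beta>_nonneg: "\<beta> y \<ge> 0" for y by (simp add: \<beta>_def flat_nonneg)
  have nonzero: "\<eta> y \<noteq> 0" if y: "\<bar>y - m\<bar> \<le> 2 * r" "y \<noteq> m - r" "y \<noteq> m + r" for y
  proof -
    define t where "t = (y - m) / r"
    have t: "\<bar>t\<bar> \<le> 2" "t \<noteq> 1" "t \<noteq> -1"
      using y \<open>r > 0\<close> by (auto simp: t_def pos_divide_le_eq divide_eq_eq)
    have den: "1 + \<theta> * t > 0" using den[of \<theta> t] cut1[OF t(1)] \<theta> by simp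
    show ?thesis
    proof (cases "\<bar>t\<bar> < 1")
      case True
      then have "t * t < 1" by (metis abs_square_less_1 power2_eq_square)
      then have "r * (\<theta> * (1 - t * t) / (1 + \<theta> * t)) > 0" using den \<theta> \<open>r > 0\<close> by simp
      moreover have "\<delta> * \<beta> y \<ge> 0" using \<delta>(2) \<beta>_nonneg by simp
      ultimately show ?thesis using \<eta>_eq[OF t_def t(1)] by linarith
    next
      case False
      with t have "\<bar>t\<bar> > 1" by linarith
      then have "t * t > 1" by (metis abs_square_less_1 abs_square_eq_1 linorder_neqE_linordered_idom
            abs_1 less_irrefl power2_eq_square order_less_trans)
      moreover have "t \<le> 0 \<or> t \<ge> \<theta> / 3" using \<open>\<bar>t\<bar> > 1\<close> \<theta>(3) by linarith
      then have "\<beta> y = 0" using \<beta>0 t_def by blast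
      ultimately show ?thesis using \<eta>_eq[OF t_def t(1)] den \<theta> \<open>r > 0\<close> by simp
    qed
  qed
  have mono: "strict_mono (\<lambda>y. y + \<eta> y)"
  proof (rule strict_mono_identity_plus_small)
    show "(\<eta> has_real_derivative nth_deriv 1 \<eta> x) (at x)" for x
      using nth_deriv_has_real_derivative[OF \<eta>, of 0 x] by simp
    show "\<bar>nth_deriv 1 \<eta> x\<bar> < 1" for x
      using bound[OF \<open>N \<ge> 1\<close>, of x] \<open>c \<le> 1/4\<close> by linarith
  qed
  define T where "T = ln ((1 + \<theta>) / (1 - \<theta>))"
  let ?p = "m - r" and ?q = "m + r"
  let ?\<omega> = "moebius_coord ?p ?q"
  have fixed: "?p + \<eta> ?p = ?p" "?q + \<eta> ?q = ?q"
    using \<eta>_eq[of "-1" ?p] \<eta>_eq[of 1 ?q] \<beta>0[of ?p] \<beta>0[of ?q] \<open>r > 0\<close> \<theta>(3) by simp_all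
  have inside: "y + \<eta> y \<in> {?p<..<?q}" if "y \<in> {?p<..<?q}" for y
    using that strict_monoD[OF mono, of ?p y] strict_monoD[OF mono, of y ?q] fixed by auto
  have coord: "?\<omega> y = ln ((1 + t) / (1 - t))" if "t = (y - m) / r" for t y
  proof -
    have "y = m + r * t" using that \<open>r > 0\<close> by simp
    then have "(y - ?p) / (?q - y) = (r * (1 + t)) / (r * (1 - t))" by (simp add: algebra_simps)
    also have "\<dots> = (1 + t) / (1 - t)" using \<open>r > 0\<close> by (subst mult_divide_mult_cancel_left) auto
    finally show ?thesis by (simp add: moebius_coord_def)
  qed
  have main: "\<exists>z\<in>{?p<..<?q}. y + \<eta> y = z + \<delta> * \<beta> y \<and> ?\<omega> z = ?\<omega> y + T" if y: "y \<in> {?p<..<?q}" for y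
  proof -
    define t where "t = (y - m) / r"
    define z where "z = m + r * ((t + \<theta>) / (1 + \<theta> * t))"
    have t: "-1 < t" "t < 1" using y \<open>r > 0\<close> by (auto simp: t_def pos_less_divide_eq pos_divide_less_eq)
    have den: "1 + \<theta> * t > 0" using den[of \<theta> t] cut1[of t] t \<theta> by simp
    have pos: "(1 + t) * (1 + \<theta>) > 0" "(1 - t) * (1 - \<theta>) > 0" using t \<theta> by simp_all
    have z: "\<bar>(t + \<theta>) / (1 + \<theta> * t)\<bar> < 1"
      using pos den unfolding abs_less_iff by (simp add: divide_less_eq less_divide_eq) (simp add: algebra_simps)
    then have "r * ((t + \<theta>) / (1 + \<theta> * t)) < r * 1" "r * (-1) < r * ((t + \<theta>) / (1 + \<theta> * t))"
      using \<open>r > 0\<close> by (intro mult_strict_left_mono; linarith)+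
    then have zin: "z \<in> {?p<..<?q}" by (auto simp: z_def)
    have "y = m + r * t" using \<open>r > 0\<close> by (simp add: t_def)
    moreover have "\<bar>t\<bar> \<le> 2" using t by linarith
    ultimately have "y + \<eta> y = m + r * t + (r * (\<theta> * (1 - t * t) / (1 + \<theta> * t)) + \<delta> * \<beta> y)"
      using \<eta>_eq[OF t_def] by linarith
    also have "\<dots> = m + r * (t + \<theta> * (1 - t * t) / (1 + \<theta> * t)) + \<delta> * \<beta> y" by (simp add: algebra_simps)
    also have "t + \<theta> * (1 - t * t) / (1 + \<theta> * t) = (t + \<theta>) / (1 + \<theta> * t)"
      using den by (simp add: field_simps)
    finally have "y + \<eta> y = z + \<delta> * \<beta> y" by (simp add: z_def)
    moreover have "?\<omega> z = ?\<omega> y + T"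
    proof -
      have "(1 + (t + \<theta>) / (1 + \<theta> * t)) / (1 - (t + \<theta>) / (1 + \<theta> * t))
          = ((1 + t) * (1 + \<theta>) / (1 + \<theta> * t)) / ((1 - t) * (1 - \<theta>) / (1 + \<theta> * t))"
        using den by (intro arg_cong2[of _ _ _ _ "(/)"]) (simp_all add: field_simps)
      also have "\<dots> = ((1 + t) / (1 - t)) * ((1 + \<theta>) / (1 - \<theta>))"
        using den by simp
      finally have "?\<omega> z = ln (((1 + t) / (1 - t)) * ((1 + \<theta>) / (1 - \<theta>)))"
        using coord[of "(t + \<theta>) / (1 + \<theta> * t)" z] \<open>r > 0\<close> by (simp add: z_def)
      also have "\<dots> = ln ((1 + t) / (1 - t)) + T"
        unfolding T_def using t \<theta> by (intro ln_mult_pos) simp_all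
      finally show ?thesis using coord[OF t_def] by simp
    qed
    ultimately show ?thesis using zin by blast
  qed
  have "T > 0" using \<theta> by (simp add: T_def)
  have outside: "\<beta> y = 0" if y: "y \<in> {?p<..<?q}" "?\<omega> y \<le> 0 \<or> ?\<omega> y \<ge> T / 2" for y
  proof (rule ccontr)
    assume "\<beta> y \<noteq> 0"
    define t where "t = (y - m) / r"
    have t: "0 < t" "t < \<theta> / 3" using \<beta>0[of y, folded t_def] \<open>\<beta> y \<noteq> 0\<close> by (meson linorder_not_le)+
    have "ln ((1 + t) / (1 - t)) > 0" using t \<theta>(3) by simp
    then have "2 * ln ((1 + t) / (1 - t)) \<ge> T" using y(2) coord[OF t_def] by simp
    also have "2 * ln ((1 + t) / (1 - t)) = ln (((1 + t) / (1 - t))\<^sup>2)"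
      using t \<theta> by (simp add: ln_realpow)
    finally have "(1 + \<theta>) / (1 - \<theta>) \<le> ((1 + t) / (1 - t))\<^sup>2"
      unfolding T_def using t \<theta> by (subst (asm) ln_le_cancel_iff) auto
    then have "(1 + \<theta>) * (1 - t)\<^sup>2 \<le> (1 + t)\<^sup>2 * (1 - \<theta>)"
      using t \<theta> by (simp add: power_divide divide_le_eq le_divide_eq mult.commute split: if_splits)
    then have "\<theta> * (1 + t\<^sup>2) \<le> 2 * t" by (simp add: power2_eq_square algebra_simps)
    moreover have "\<theta> * (1 + t\<^sup>2) \<ge> \<theta>" using \<theta>(2) by simp
    ultimately show False using t by linarith
  qed
  have "twisted_translation ?p ?q T (\<lambda>y. y + \<eta> y)"
    unfolding twisted_translation_def
  proof (intro conjI ballI impI)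
    show "?p < ?q" "T > 0" using \<open>r > 0\<close> \<open>T > 0\<close> by auto
    show "?p + \<eta> ?p = ?p" "?q + \<eta> ?q = ?q" by (fact fixed)+
    fix y assume y: "y \<in> {?p<..<?q}"
    show "y + \<eta> y \<in> {?p<..<?q}" using inside y by blast
    from main[OF y] obtain z where z: "z \<in> {?p<..<?q}" "y + \<eta> y = z + \<delta> * \<beta> y" "?\<omega> z = ?\<omega> y + T" by blast
    have "y + \<eta> y \<ge> z" using z(2) \<delta>(2) \<beta>_nonneg[of y] by simp
    then show "?\<omega> y + T \<le> ?\<omega> (y + \<eta> y)"
      using moebius_coord_le[OF z(1) inside[OF y]] z(3) by simp
    assume "?\<omega> y \<le> 0 \<or> ?\<omega> y \<ge> T / 2"
    from outside[OF y this] z show "?\<omega> (y + \<eta> y) = ?\<omega> y + T" by simp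
  next
    define y where "y = m + r * (\<theta> / 6)"
    have "r * (\<theta> / 6) < r * 1" using \<theta> \<open>r > 0\<close> by (intro mult_strict_left_mono) auto
    moreover have "r * (\<theta> / 6) > 0" using \<theta> \<open>r > 0\<close> by simp
    ultimately have y: "y \<in> {?p<..<?q}" using \<open>r > 0\<close> by (auto simp: y_def)
    have "(y - m) / r = \<theta> / 6" using \<open>r > 0\<close> by (simp add: y_def)
    then have "\<beta> y = flat (\<theta> / 6) * flat (\<theta> / 3 - \<theta> / 6)" by (simp only: \<beta>_def)
    then have "\<beta> y > 0" using \<theta>(2) by (simp add: flat_pos)
    from main[OF y] obtain z where z: "z \<in> {?p<..<?q}" "y + \<eta> y = z + \<delta> * \<beta> y" "?\<omega> z = ?\<omega> y + T" by blast
    have "y + \<eta> y > z" using z(2) \<delta>(2) \<open>\<beta> y > 0\<close> by simp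
    then have "?\<omega> (y + \<eta> y) > ?\<omega> y + T"
      using moebius_coord_strict_mono[OF z(1) inside[OF y]] z(3) by simp
    with y show "\<exists>y\<in>{?p<..<?q}. ?\<omega> y + T < ?\<omega> (y + \<eta> y)" by blast
  qed
  with \<eta> bound supp nonzero show ?thesis by blast
qed

definition moebius_point :: "real \<Rightarrow> real \<Rightarrow> real \<Rightarrow> real" where
  "moebius_point p q w = (p + q * exp w) / (1 + exp w)"

lemma one_plus_exp_pos: "1 + exp w > (0::real)"
  by (simp add: add_pos_pos)

lemma moebius_point_diff:
  "moebius_point p q w - p = (q - p) * exp w / (1 + exp w)"
  "q - moebius_point p q w = (q - p) / (1 + exp w)"
  using one_plus_exp_pos[of w] by (simp_all add: moebius_point_def field_simps)

lemma moebius_point_in: "p < q \<Longrightarrow> moebius_point p q w \<in> {p<..<q}"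
proof -
  assume "p < q"
  then have "moebius_point p q w - p > 0" "q - moebius_point p q w > 0"
    unfolding moebius_point_diff using one_plus_exp_pos[of w] by simp_all
  then show ?thesis by simp
qed

lemma moebius_coord_point: "p < q \<Longrightarrow> moebius_coord p q (moebius_point p q w) = w"
  using one_plus_exp_pos[of w] unfolding moebius_coord_def moebius_point_diff by simp

lemma moebius_coord_inj:
  "y \<in> {p<..<q} \<Longrightarrow> z \<in> {p<..<q} \<Longrightarrow> moebius_coord p q y = moebius_coord p q z \<Longrightarrow> y = z"
  using moebius_coord_strict_mono[of y p q z] moebius_coord_strict_mono[of z p q y] by simp

lemma moebius_point_coord: "y \<in> {p<..<q} \<Longrightarrow> moebius_point p q (moebius_coord p q y) = y"
  by (rule moebius_coord_inj[of _ p q]) (auto intro!: moebius_point_in[simplified] simp: moebius_coord_point)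

lemma moebius_coord_reflect:
  "y \<in> {p<..<q} \<Longrightarrow> moebius_coord (- q) (- p) (- y) = - moebius_coord p q y"
  by (auto simp: moebius_coord_def ln_div)

text \<open>Koenigs linearisation: near the fixed point \<open>p\<close> the map \<open>g\<close> is a translation in the
  coordinate, and a commuting map \<open>k\<close> that is differentiable at \<open>p\<close> must be a translation
  there as well, because its difference quotients along backward \<open>g\<close>-orbits converge to
  \<open>exp s\<close>, where \<open>s\<close> is the displacement of any point of the orbit.\<close>

lemma commuting_is_translation_near_lower_end:
  fixes p q a \<tau> :: real and g k :: "real \<Rightarrow> real"
  defines "\<omega> \<equiv> moebius_coord p q"
  assumes "p < q" "inj g" "\<tau> > 0"
    and g: "\<And>y. y \<in> {p<..<q} \<Longrightarrow> g y \<in> {p<..<q}"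
    and g_eq: "\<And>y. y \<in> {p<..<q} \<Longrightarrow> \<omega> y \<le> a \<Longrightarrow> \<omega> (g y) = \<omega> y + \<tau>"
    and comm: "\<And>y. k (g y) = g (k y)"
    and kp: "k p = p" "(k has_real_derivative D) (at p)"
    and y1: "y1 \<in> {p<..<q}" "k y1 \<in> {p<..<q}" "\<omega> y1 \<le> a + \<tau>" "\<omega> (k y1) \<le> a + \<tau>"
    and y: "y \<in> {p<..<q}" "\<omega> y \<le> a + \<tau>" "\<omega> y + (\<omega> (k y1) - \<omega> y1) \<le> a + \<tau>"
  shows "k y \<in> {p<..<q} \<and> \<omega> (k y) = \<omega> y + (\<omega> (k y1) - \<omega> y1)"
proof -
  define \<iota> where "\<iota> = moebius_point p q"
  have \<iota>: "\<iota> w \<in> {p<..<q}" "\<omega> (\<iota> w) = w" for w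
    using \<open>p < q\<close> by (simp_all only: \<iota>_def \<omega>_def moebius_point_in moebius_coord_point)
  have \<iota>\<omega>: "\<iota> (\<omega> y) = y" if "y \<in> {p<..<q}" for y
    using that by (simp only: \<iota>_def \<omega>_def moebius_point_coord)
  have g\<iota>: "g (\<iota> w) = \<iota> (w + \<tau>)" if "w \<le> a" for w
    using g_eq[of "\<iota> w"] g[of "\<iota> w"] \<iota>[of w] \<iota>\<omega>[of "g (\<iota> w)"] that by metis
  have iter: "(g ^^ j) (\<iota> (w - \<tau> * j)) = \<iota> w" if "w \<le> a + \<tau>" for j :: nat and w
  proof (induction j)
    case (Suc j)
    have "0 \<le> \<tau> * j" using \<open>\<tau> > 0\<close> by simp
    then have "w - \<tau> * Suc j \<le> a" using that by (simp add: algebra_simps)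
    moreover have "w - \<tau> * Suc j + \<tau> = w - \<tau> * j" by (simp add: algebra_simps)
    ultimately have "g (\<iota> (w - \<tau> * Suc j)) = \<iota> (w - \<tau> * j)" using g\<iota> by metis
    then show ?case using Suc by (simp only: funpow_Suc_right o_apply)
  qed simp
  have comm_iter: "k ((g ^^ j) y) = (g ^^ j) (k y)" for j y
    by (induction j) (simp_all add: comm)
  have inj_iter: "inj (g ^^ j)" for j
    using \<open>inj g\<close> by (induction j) (simp_all add: inj_compose)
  have lim_exp: "(\<lambda>j::nat. exp (w - \<tau> * j)) \<longlonglongrightarrow> 0" for w
  proof -
    have "filterlim (\<lambda>j::nat. - w + \<tau> * real j) at_top sequentially"
      by (intro filterlim_tendsto_add_at_top[OF tendsto_const]
          filterlim_tendsto_pos_mult_at_top[OF tendsto_const \<open>\<tau> > 0\<close>] filterlim_real_sequentially)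
    then have "filterlim (\<lambda>j::nat. - (- w + \<tau> * real j)) at_bot sequentially"
      by (simp only: filterlim_uminus_at_top)
    then have "(\<lambda>j::nat. exp (- (- w + \<tau> * real j))) \<longlonglongrightarrow> 0"
      by (rule filterlim_compose[OF exp_at_bot])
    then show ?thesis by simp
  qed
  have lim_\<iota>: "(\<lambda>j::nat. \<iota> (w - \<tau> * j)) \<longlonglongrightarrow> p" for w
  proof -
    have "(\<lambda>j::nat. p + (q - p) * exp (w - \<tau> * j) / (1 + exp (w - \<tau> * j))) \<longlonglongrightarrow> p + (q - p) * 0 / (1 + 0)"
      by (intro tendsto_intros lim_exp) simp
    then show ?thesis using moebius_point_diff(1)[of p q] by (simp add: \<iota>_def algebra_simps)
  qed
  have quot: "(\<lambda>j::nat. (k (\<iota> (w - \<tau> * j)) - p) / (\<iota> (w - \<tau> * j) - p)) \<longlonglongrightarrow> D" for w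
  proof -
    have "filterlim (\<lambda>j::nat. \<iota> (w - \<tau> * j)) (at p) sequentially"
      unfolding filterlim_at using lim_\<iota>[of w] \<iota>(1)
      by (auto intro!: always_eventually simp del: of_nat_mult)
    moreover have "((\<lambda>y. (k y - p) / (y - p)) \<longlongrightarrow> D) (at p)"
      using kp(2) unfolding has_field_derivative_iff kp(1) .
    ultimately show ?thesis by (rule filterlim_compose[rotated])
  qed
  have D: "D = exp (\<omega> (k z) - \<omega> z)"
    if z: "z \<in> {p<..<q}" "k z \<in> {p<..<q}" "\<omega> z \<le> a + \<tau>" "\<omega> (k z) \<le> a + \<tau>" for z
  proof -
    have k: "k (\<iota> (\<omega> z - \<tau> * j)) = \<iota> (\<omega> (k z) - \<tau> * j)" for j :: nat
    proof (rule injD[OF inj_iter[of j]])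
      show "(g ^^ j) (k (\<iota> (\<omega> z - \<tau> * j))) = (g ^^ j) (\<iota> (\<omega> (k z) - \<tau> * j))"
        using iter[OF z(3), of j] iter[OF z(4), of j] \<iota>\<omega> z(1,2) comm_iter by metis
    qed
    have "(k (\<iota> (\<omega> z - \<tau> * j)) - p) / (\<iota> (\<omega> z - \<tau> * j) - p) =
        exp (\<omega> (k z) - \<omega> z) * ((1 + exp (\<omega> z - \<tau> * j)) / (1 + exp (\<omega> (k z) - \<tau> * j)))" for j :: nat
    proof -
      have "exp (\<omega> (k z) - \<tau> * j) = exp (\<omega> (k z) - \<omega> z) * exp (\<omega> z - \<tau> * j)"
        by (simp flip: exp_add)
      then show ?thesis
        unfolding k unfolding \<iota>_def moebius_point_diff
        using \<open>p < q\<close> one_plus_exp_pos[of "\<omega> z - \<tau> * j"] one_plus_exp_pos[of "\<omega> (k z) - \<tau> * j"]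
        by simp
    qed
    moreover have "(\<lambda>j::nat. exp (\<omega> (k z) - \<omega> z) * ((1 + exp (\<omega> z - \<tau> * j)) / (1 + exp (\<omega> (k z) - \<tau> * j))))
        \<longlonglongrightarrow> exp (\<omega> (k z) - \<omega> z) * ((1 + 0) / (1 + 0))"
      by (intro tendsto_intros lim_exp) simp
    ultimately show ?thesis using quot[of "\<omega> z"] LIMSEQ_unique by fastforce
  qed
  define s where "s = \<omega> (k y1) - \<omega> y1"
  have Ds: "D = exp s" using D[OF y1] by (simp add: s_def)
  then have "\<forall>\<^sub>F j::nat in sequentially. (k (\<iota> (\<omega> y - \<tau> * j)) - p) / (\<iota> (\<omega> y - \<tau> * j) - p) > 0"
    using order_tendstoD(1)[OF quot[of "\<omega> y"], of 0] by simp
  moreover have "\<forall>\<^sub>F j::nat in sequentially. k (\<iota> (\<omega> y - \<tau> * j)) < \<iota> (a + \<tau>)"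
  proof -
    have "isCont k p" using kp(2) by (rule DERIV_isCont)
    from isCont_tendsto_compose[OF this lim_\<iota>[of "\<omega> y"]] show ?thesis
      using order_tendstoD(2) \<iota>(1)[of "a + \<tau>"] by (fastforce simp: kp(1))
  qed
  ultimately have "\<forall>\<^sub>F j::nat in sequentially.
     (k (\<iota> (\<omega> y - \<tau> * j)) - p) / (\<iota> (\<omega> y - \<tau> * j) - p) > 0 \<and> k (\<iota> (\<omega> y - \<tau> * j)) < \<iota> (a + \<tau>)"
    by (rule eventually_conj)
  then obtain j :: nat where j:
    "(k (\<iota> (\<omega> y - \<tau> * j)) - p) / (\<iota> (\<omega> y - \<tau> * j) - p) > 0" "k (\<iota> (\<omega> y - \<tau> * j)) < \<iota> (a + \<tau>)"
    by (auto simp: eventually_sequentially)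
  define z where "z = \<iota> (\<omega> y - \<tau> * j)"
  have z: "z \<in> {p<..<q}" "\<omega> z = \<omega> y - \<tau> * j" by (simp_all only: z_def \<iota>)
  have "k z > p" using j(1) z(1) by (simp add: z_def zero_less_divide_iff)
  then have kz: "k z \<in> {p<..<q}" using j(2) \<iota>(1)[of "a + \<tau>"] by (simp add: z_def)
  have "\<omega> (k z) < \<omega> (\<iota> (a + \<tau>))"
    using j(2) moebius_coord_strict_mono[OF kz \<iota>(1)] by (simp add: z_def \<omega>_def)
  moreover have "0 \<le> \<tau> * j" using \<open>\<tau> > 0\<close> by simp
  then have "\<omega> z \<le> a + \<tau>" using y(2) z(2) by linarith
  ultimately have "D = exp (\<omega> (k z) - \<omega> z)" by (intro D z kz) (simp_all add: \<iota>)
  then have "\<omega> (k z) = (\<omega> y + s) - \<tau> * j" using Ds z(2) by simp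
  then have "k z = \<iota> ((\<omega> y + s) - \<tau> * j)" using \<iota>\<omega>[OF kz] by simp
  then have "(g ^^ j) (k z) = \<iota> (\<omega> y + s)" using iter[of "\<omega> y + s" j] y(3) by (simp add: s_def)
  moreover have "(g ^^ j) z = y" unfolding z_def using iter[OF y(2)] \<iota>\<omega>[OF y(1)] by simp
  ultimately have "k y = \<iota> (\<omega> y + s)" using comm_iter by metis
  then show ?thesis using \<iota> by (simp add: s_def)
qed

text \<open>The reflection \<open>y \<mapsto> - y\<close> exchanges the two ends; conjugation by it turns \<open>g\<close> into a map
  that moves points down, so the conjugate of the inverse of \<open>g\<close> takes the role of \<open>g\<close>.\<close>

lemma commuting_is_translation_near_upper_end:
  fixes p q a \<tau> :: real and g k :: "real \<Rightarrow> real"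
  defines "\<omega> \<equiv> moebius_coord p q"
  assumes "p < q" "\<tau> > 0" and mono: "strict_mono g" and g': "\<And>y. g (g' y) = y" "\<And>y. g' (g y) = y"
    and fixed: "g p = p" "g q = q"
    and g_eq: "\<And>y. y \<in> {p<..<q} \<Longrightarrow> \<omega> y \<ge> a \<Longrightarrow> \<omega> (g y) = \<omega> y + \<tau>"
    and comm: "\<And>y. k (g y) = g (k y)"
    and kq: "k q = q" "(k has_real_derivative D) (at q)"
    and y1: "y1 \<in> {p<..<q}" "k y1 \<in> {p<..<q}" "\<omega> y1 \<ge> a" "\<omega> (k y1) \<ge> a"
    and y: "y \<in> {p<..<q}" "\<omega> y \<ge> a" "\<omega> y + (\<omega> (k y1) - \<omega> y1) \<ge> a"
  shows "k y \<in> {p<..<q} \<and> \<omega> (k y) = \<omega> y + (\<omega> (k y1) - \<omega> y1)"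
proof -
  have refl: "moebius_coord (- q) (- p) (- y) = - \<omega> y" if "y \<in> {p<..<q}" for y
    using moebius_coord_reflect[OF that] by (simp add: \<omega>_def)
  have neg: "- y \<in> {- q<..<- p} \<longleftrightarrow> y \<in> {p<..<q}" for y by auto
  have g'_in: "g' y \<in> {p<..<q}" if "y \<in> {p<..<q}" for y
  proof -
    have "g p < g (g' y)" "g (g' y) < g q" using that by (simp_all add: g' fixed)
    then show ?thesis using mono by (simp add: strict_mono_less)
  qed
  have g'_eq: "\<omega> (g' y) = \<omega> y - \<tau>" if y: "y \<in> {p<..<q}" "\<omega> y \<ge> a + \<tau>" for y
  proof -
    define c where "c = moebius_point p q a"
    have c: "c \<in> {p<..<q}" "\<omega> c = a"
      using \<open>p < q\<close> by (simp_all only: c_def \<omega>_def moebius_point_in moebius_coord_point)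
    have gc: "g c \<in> {p<..<q}" using c(1) mono fixed strict_monoD[OF mono, of p c] strict_monoD[OF mono, of c q] by simp
    have "\<omega> (g c) \<le> \<omega> y" using g_eq[OF c(1)] c(2) y(2) by simp
    then have "g c \<le> g (g' y)" using moebius_coord_le[OF gc y(1)] by (simp add: \<omega>_def g')
    then have "c \<le> g' y" using mono by (simp add: strict_mono_less_eq)
    then have "a \<le> \<omega> (g' y)" using moebius_coord_le[OF c(1) g'_in[OF y(1)]] c(2) by (simp add: \<omega>_def)
    from g_eq[OF g'_in[OF y(1)] this] show ?thesis by (simp add: g')
  qed
  let ?k = "\<lambda>y. - k (- y)" and ?g = "\<lambda>y. - g' (- y)"
  have "?k (- y) \<in> {- q<..<- p} \<and> moebius_coord (- q) (- p) (?k (- y)) = moebius_coord (- q) (- p) (- y) +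
      (moebius_coord (- q) (- p) (?k (- y1)) - moebius_coord (- q) (- p) (- y1))"
  proof (rule commuting_is_translation_near_lower_end[where g = ?g and a = "- a - \<tau>" and \<tau> = \<tau> and D = D])
    show "inj ?g"
    proof (rule injI)
      fix x y assume "?g x = ?g y"
      then have "g (g' (- x)) = g (g' (- y))" by simp
      then show "x = y" by (simp add: g')
    qed
    show "?g x \<in> {- q<..<- p}" if "x \<in> {- q<..<- p}" for x
      using g'_in[of "- x"] that by auto
    show "moebius_coord (- q) (- p) (?g x) = moebius_coord (- q) (- p) x + \<tau>"
      if "x \<in> {- q<..<- p}" "moebius_coord (- q) (- p) x \<le> - a - \<tau>" for x
    proof -
      have x: "- x \<in> {p<..<q}" using that(1) by auto
      then have "\<omega> (- x) \<ge> a + \<tau>" using refl[OF x] that(2) by simp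
      then show ?thesis using refl[OF x] refl[OF g'_in[OF x]] g'_eq[OF x] by simp
    qed
    show "?k (?g x) = ?g (?k x)" for x
    proof -
      have "g (k (g' (- x))) = k (- x)" by (simp add: g' flip: comm)
      then have "k (g' (- x)) = g' (k (- x))" by (metis g'(2))
      then show ?thesis by simp
    qed
    show "?k (- q) = - q" using kq by simp
    have "((\<lambda>y. k (- y)) has_real_derivative D * (-1)) (at (- q))"
      by (rule DERIV_chain2[of k]) (use kq in \<open>auto intro!: derivative_eq_intros\<close>)
    from DERIV_minus[OF this] show "(?k has_real_derivative D) (at (- q))" by simp
  qed (use assms(2,3) y1 y in \<open>simp_all add: refl[simplified] del: greaterThanLessThan_iff\<close>, auto simp: refl)
  then show ?thesis using refl[of "k y"] refl[OF y(1)] refl[OF y1(1)] refl[OF y1(2)] by (auto simp: neg)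
qed

text \<open>The bump breaks all small symmetries.  A map commuting with \<open>g = h \<circ> h\<close> is a translation near
  either end.  In the coordinate, \<open>g\<close> agrees with the translation by \<open>2 T\<close> outside
  \<open>{- T<..<T/2}\<close>, which is shorter than a fundamental domain of \<open>g\<close>; hence for small displacements
  the regions at the two ends overlap, and the commuting map is the translation by one number \<open>s\<close>
  throughout.  If \<open>s\<close> were not zero, then the displacement of \<open>g\<close> would be periodic with period \<open>s\<close>;
  being constant near the ends, it would be constant everywhere, contradicting the bump.\<close>

lemma small_commuting_is_identity:
  fixes p q T :: real and h k :: "real \<Rightarrow> real"
  defines "\<omega> \<equiv> moebius_coord p q"
  assumes h: "twisted_translation p q T h" "strict_mono h" and h': "\<And>y. h (h' y) = y" "\<And>y. h' (h y) = y"
    and comm: "\<And>y. k (h (h y)) = h (h (k y))"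
    and kp: "k p = p" "(k has_real_derivative D) (at p)"
    and kq: "k q = q" "(k has_real_derivative D') (at q)"
    and y1: "y1 \<in> {p<..<q}" "k y1 \<in> {p<..<q}" "\<omega> y1 = - (2 * T)" "\<bar>\<omega> (k y1) - \<omega> y1\<bar> \<le> T / 4"
    and y2: "y2 \<in> {p<..<q}" "k y2 \<in> {p<..<q}" "\<omega> y2 = 2 * T" "\<bar>\<omega> (k y2) - \<omega> y2\<bar> \<le> T / 4"
    and y: "y \<in> {p..q}"
  shows "k y = y"
proof -
  have pq: "p < q" "T > 0" "h p = p" "h q = q"
    and h_in: "\<And>y. y \<in> {p<..<q} \<Longrightarrow> h y \<in> {p<..<q}"
    and h_ge: "\<And>y. y \<in> {p<..<q} \<Longrightarrow> \<omega> (h y) \<ge> \<omega> y + T"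
    and h_eq: "\<And>y. y \<in> {p<..<q} \<Longrightarrow> \<omega> y \<le> 0 \<or> \<omega> y \<ge> T / 2 \<Longrightarrow> \<omega> (h y) = \<omega> y + T"
    and h_bump: "\<exists>y\<in>{p<..<q}. \<omega> (h y) > \<omega> y + T"
    using h(1) by (auto simp: twisted_translation_def \<omega>_def)
  define s s' where "s = \<omega> (k y1) - \<omega> y1" and "s' = \<omega> (k y2) - \<omega> y2"
  have ss: "\<bar>s\<bar> \<le> T / 4" "\<bar>s'\<bar> \<le> T / 4" using y1 y2 by (simp_all add: s_def s'_def)
  have g_lin: "\<omega> (h (h y)) = \<omega> y + 2 * T" if "y \<in> {p<..<q}" "\<omega> y \<le> - T \<or> \<omega> y \<ge> T / 2" for y
    using h_eq[OF that(1)] h_eq[OF h_in[OF that(1)]] that(2) \<open>T > 0\<close> by linarith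
  have inj: "inj (\<lambda>y. h (h y))"
    by (rule inj_on_inverseI[where g = "\<lambda>y. h' (h' y)"]) (simp add: h')
  have tests: "\<omega> y1 \<le> - T + 2 * T" "\<omega> (k y1) \<le> - T + 2 * T" "\<omega> y2 \<ge> T / 2" "\<omega> (k y2) \<ge> T / 2"
    using y1 y2 \<open>T > 0\<close> by linarith+
  have lower: "k y \<in> {p<..<q} \<and> \<omega> (k y) = \<omega> y + s" if y: "y \<in> {p<..<q}" "\<omega> y \<le> 3 * T / 4" for y
  proof -
    have "\<omega> y \<le> - T + 2 * T" "\<omega> y + s \<le> - T + 2 * T" using y(2) ss \<open>T > 0\<close> by linarith+
    then show ?thesis
      unfolding s_def \<omega>_def
      by (intro commuting_is_translation_near_lower_end[where g = "\<lambda>y. h (h y)" and a = "- T" and \<tau> = "2 * T", OF \<open>p < q\<close> inj _ _ _ comm kp])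
        (use h_in g_lin y1(1,2) y(1) tests \<open>T > 0\<close> in \<open>simp_all add: \<omega>_def del: greaterThanLessThan_iff\<close>)
  qed
  have upper: "k y \<in> {p<..<q} \<and> \<omega> (k y) = \<omega> y + s'" if y: "y \<in> {p<..<q}" "\<omega> y \<ge> 3 * T / 4" for y
  proof -
    have bounds: "\<omega> y \<ge> T / 2" "\<omega> y + s' \<ge> T / 2" using y(2) ss \<open>T > 0\<close> by linarith+
    have mono: "strict_mono (\<lambda>y. h (h y))" using h(2) by (simp add: strict_mono_def)
    show ?thesis
      unfolding s'_def \<omega>_def
      by (rule commuting_is_translation_near_upper_end[where g = "\<lambda>y. h (h y)" and a = "T / 2" and \<tau> = "2 * T"
          and g' = "\<lambda>y. h' (h' y)", OF \<open>p < q\<close> _ mono _ _ _ _ _ comm kq])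
        (use bounds pq h' g_lin y2(1,2) y(1) tests in \<open>simp_all add: \<omega>_def s'_def\<close>)
  qed
  have "s' = s"
  proof -
    define w where "w = moebius_point p q (3 * T / 4)"
    have "w \<in> {p<..<q}" "\<omega> w = 3 * T / 4"
      using \<open>p < q\<close> by (simp_all only: w_def \<omega>_def moebius_point_in moebius_coord_point)
    then show ?thesis using lower[of w] upper[of w] by simp
  qed
  then have all: "k y \<in> {p<..<q} \<and> \<omega> (k y) = \<omega> y + s" if "y \<in> {p<..<q}" for y
    using lower[OF that] upper[OF that] by (cases "\<omega> y \<le> 3 * T / 4") auto
  define \<iota> where "\<iota> = moebius_point p q"
  have \<iota>: "\<iota> w \<in> {p<..<q}" "\<omega> (\<iota> w) = w" for w
    using \<open>p < q\<close> by (simp_all only: \<iota>_def \<omega>_def moebius_point_in moebius_coord_point)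
  have \<iota>\<omega>: "\<iota> (\<omega> y) = y" if "y \<in> {p<..<q}" for y
    using that by (simp only: \<iota>_def \<omega>_def moebius_point_coord)
  have k\<iota>: "k (\<iota> w) = \<iota> (w + s)" for w using all[of "\<iota> w"] \<iota> \<iota>\<omega> by metis
  define d where "d w = \<omega> (h (h (\<iota> w))) - w" for w
  have d: "d (w + s) = d w" for w
  proof -
    have "\<omega> (h (h (\<iota> (w + s)))) = \<omega> (k (h (h (\<iota> w))))" by (simp only: k\<iota> comm)
    also have "\<dots> = \<omega> (h (h (\<iota> w))) + s" using all h_in \<iota>(1) by blast
    finally show ?thesis by (simp add: d_def)
  qed
  have "s = 0"
  proof (rule ccontr)
    assume "s \<noteq> 0"
    have dn: "d (w + real n * s) = d w" for w n
    proof (induction n)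
      case (Suc n)
      have "w + real (Suc n) * s = (w + real n * s) + s" by (simp add: algebra_simps)
      then show ?case using d Suc by metis
    qed simp
    have d2: "d w = 2 * T" for w
    proof -
      obtain n :: nat where n: "real n * \<bar>s\<bar> > \<bar>w\<bar> + T"
        using \<open>s \<noteq> 0\<close> reals_Archimedean3[of "\<bar>s\<bar>"] by auto
      obtain v where v: "v \<le> - T" "d v = d w"
      proof (cases "s > 0")
        case True
        have "w - real n * s \<le> - T" using n True by simp
        moreover have "d (w - real n * s) = d w" using dn[of "w - real n * s" n] by simp
        ultimately show ?thesis using that by blast
      next
        case False
        then have "\<bar>s\<bar> = - s" by simp
        then have "w + real n * s \<le> - T" using n by simp
        then show ?thesis using that dn by blast
      qed
      then show ?thesis using g_lin[of "\<iota> v"] \<iota>[of v] by (simp add: d_def del: greaterThanLessThan_iff)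
    qed
    obtain z where z: "z \<in> {p<..<q}" "\<omega> (h z) > \<omega> z + T" using h_bump by blast
    have "d (\<omega> z) > 2 * T" using h_ge[OF h_in[OF z(1)]] z(2) \<iota>\<omega>[OF z(1)] by (simp add: d_def)
    then show False using d2 by simp
  qed
  then show ?thesis
    using y kp(1) kq(1) k\<iota>[of "\<omega> y"] \<iota>\<omega>[of y] by (cases "y = p \<or> y = q") auto
qed

section \<open>A commuting family of circle diffeomorphisms\<close>

text \<open>Infinitely many perturbations with disjoint supports, so small that the sum over any set of indices
  is smooth and has derivative at most \<open>1/3\<close>, whence adding it to the identity gives an increasing map.  Not vanishing next to \<open>m n - r n\<close> and
  \<open>m n + r n\<close> makes these points isolated fixed points.  The supports keep away from the integers so
  that everything extends periodically.\<close>

locale twisted_strips =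
  fixes \<eta> :: "nat \<Rightarrow> real \<Rightarrow> real" and m r T :: "nat \<Rightarrow> real"
  assumes smooth: "smooth_on UNIV (\<eta> n)"
    and bound: "\<exists>M. summable M \<and> (\<forall>n x. \<bar>nth_deriv k (\<eta> n) x\<bar> \<le> M n)"
    and small: "\<bar>nth_deriv 1 (\<eta> n) x\<bar> \<le> (1/4) ^ Suc n"
    and support: "\<bar>x - m n\<bar> \<ge> 3 * r n \<Longrightarrow> \<eta> n x = 0"
    and nonzero: "\<bar>x - m n\<bar> \<le> 2 * r n \<Longrightarrow> x \<noteq> m n - r n \<Longrightarrow> x \<noteq> m n + r n \<Longrightarrow> \<eta> n x \<noteq> 0"
    and r_pos: "r n > 0"
    and twisted: "twisted_translation (m n - r n) (m n + r n) (T n) (\<lambda>x. x + \<eta> n x)"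
    and disjoint: "\<bar>x - m n\<bar> < 3 * r n \<Longrightarrow> \<bar>x - m k\<bar> < 3 * r k \<Longrightarrow> n = k"
    and range: "\<bar>x - m n\<bar> < 3 * r n \<Longrightarrow> 1/4 < x \<and> x < 3/4"

lemma twisted_translation_cong:
  assumes h: "twisted_translation p q T h" and eq: "\<And>y. y \<in> {p..q} \<Longrightarrow> h y = h' y"
  shows "twisted_translation p q T h'"
proof -
  have "p \<in> {p..q}" "q \<in> {p..q}" "\<And>y. y \<in> {p<..<q} \<Longrightarrow> y \<in> {p..q}"
    using h by (auto simp: twisted_translation_def)
  note eqs = this[THEN eq]
  have "(\<exists>y\<in>{p<..<q}. moebius_coord p q (h' y) > moebius_coord p q y + T) \<longleftrightarrow>
      (\<exists>y\<in>{p<..<q}. moebius_coord p q (h y) > moebius_coord p q y + T)"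
    by (intro bex_cong refl) (simp only: eqs(3))
  then show ?thesis using h unfolding twisted_translation_def
    by (simp only: eqs(1,2)[symmetric] eqs(3)[symmetric] cong: ball_cong) simp
qed

lemma strict_mono_fixing_integers_bij:
  fixes f :: "real \<Rightarrow> real"
  assumes "strict_mono f" "continuous_on UNIV f" and fixed: "\<And>j. f (of_int j) = of_int j"
  shows "bij f"
proof (rule bijI)
  show "inj f" using assms(1) by (rule strict_mono_imp_inj_on)
  have "\<exists>y. f y = z" for z
  proof -
    have "\<exists>y\<ge>of_int \<lfloor>z\<rfloor>. y \<le> of_int (\<lfloor>z\<rfloor> + 1) \<and> f y = z"
    proof (rule IVT')
      show "z \<le> f (of_int (\<lfloor>z\<rfloor> + 1))" unfolding fixed using real_of_int_floor_add_one_ge[of z] by simp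
    qed (use assms(2) in \<open>auto simp: fixed elim: continuous_on_subset\<close>)
    then show ?thesis by blast
  qed
  then show "surj f" by (metis surj_def)
qed

lemma nth_deriv_bounded:
  assumes "smooth_on UNIV f" "\<And>x. \<bar>x\<bar> \<ge> R \<Longrightarrow> f x = 0"
  shows "\<exists>B. \<forall>x. \<bar>nth_deriv k f x\<bar> \<le> B"
proof -
  have "continuous_on {-R..R} (nth_deriv k f)"
    using nth_deriv_has_real_derivative[OF assms(1)]
    by (intro DERIV_continuous_on) (auto intro: has_field_derivative_at_within)
  then have "bounded (nth_deriv k f ` {-R..R})"
    by (intro compact_imp_bounded compact_continuous_image) auto
  then have "\<exists>B. \<forall>x\<in>{-R..R}. \<bar>nth_deriv k f x\<bar> \<le> B"
    by (simp add: bounded_iff)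
  then obtain B where B: "\<forall>x\<in>{-R..R}. \<bar>nth_deriv k f x\<bar> \<le> B" ..
  have "\<bar>nth_deriv k f x\<bar> \<le> max B 0" for x
  proof (cases "x \<in> {-R..R}")
    case False
    have "nth_deriv k f x = nth_deriv k (\<lambda>x. 0) x"
      by (rule iterated_derivative_cong[of "- {-R..R}"]) (use assms(2) False in auto)
    then show ?thesis by (simp add: nth_deriv_zero)
  qed (use B in force)
  then show ?thesis by blast
qed

text \<open>The strips accumulate at \<open>1/4\<close>.  Smoothness there is obtained by making the derivatives of the
  \<open>n\<close>-th perturbation up to order \<open>n + 1\<close> less than \<open>4\<close> to the power \<open>- (n + 1)\<close>: every fixed
  order is then controlled from some index on.\<close>

lemma twisted_strips_exist: "\<exists>\<eta> m r T. twisted_strips \<eta> m r T"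
proof -
  define m r :: "nat \<Rightarrow> real" where "m n = 1/4 + (1/4) * (1/2) ^ n" and "r n = (1/64) * (1/2) ^ n" for n
  have r: "r n > 0" for n by (simp add: r_def)
  define good where "good n T \<eta> \<longleftrightarrow> smooth_on UNIV \<eta> \<and> (\<forall>k\<le>Suc n. \<forall>y. \<bar>nth_deriv k \<eta> y\<bar> \<le> (1/4) ^ Suc n) \<and>
     (\<forall>y. \<bar>y - m n\<bar> \<ge> 3 * r n \<longrightarrow> \<eta> y = 0) \<and>
     (\<forall>y. \<bar>y - m n\<bar> \<le> 2 * r n \<and> y \<noteq> m n - r n \<and> y \<noteq> m n + r n \<longrightarrow> \<eta> y \<noteq> 0) \<and>
     twisted_translation (m n - r n) (m n + r n) T (\<lambda>y. y + \<eta> y)" for n T \<eta>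
  have "\<exists>T \<eta>. good n T \<eta>" for n
    unfolding good_def using r by (intro exists_small_twisted_translation) (simp_all add: power_le_one)
  then have "\<exists>T \<eta>. \<forall>n. good n (T n) (\<eta> n)" by metis
  then obtain T \<eta> where "\<forall>n. good n (T n) (\<eta> n)" by blast
  then have \<eta>: "\<And>n. smooth_on UNIV (\<eta> n)"
     "\<And>n k y. k \<le> Suc n \<Longrightarrow> \<bar>nth_deriv k (\<eta> n) y\<bar> \<le> (1/4) ^ Suc n"
     "\<And>n y. \<bar>y - m n\<bar> \<ge> 3 * r n \<Longrightarrow> \<eta> n y = 0"
     "\<And>n y. \<bar>y - m n\<bar> \<le> 2 * r n \<Longrightarrow> y \<noteq> m n - r n \<Longrightarrow> y \<noteq> m n + r n \<Longrightarrow> \<eta> n y \<noteq> 0"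
     "\<And>n. twisted_translation (m n - r n) (m n + r n) (T n) (\<lambda>y. y + \<eta> n y)"
    unfolding good_def by auto
  have m_r: "m k + 3 * r k < m n - 3 * r n" if "n < k" for n k
  proof -
    have "(1/2::real) ^ k \<le> (1/2) ^ Suc n" using that by (intro power_decreasing) auto
    moreover have "(1/2::real) ^ k > 0" by simp
    ultimately have "19 * (1/2::real) ^ k < 13 * (1/2) ^ n" unfolding power_Suc by linarith
    then show ?thesis by (simp add: m_def r_def)
  qed
  have "twisted_strips \<eta> m r T"
  proof
    show "\<exists>M. summable M \<and> (\<forall>n x. \<bar>nth_deriv k (\<eta> n) x\<bar> \<le> M n)" for k
    proof -
      have "\<exists>B. \<forall>x. \<bar>nth_deriv k (\<eta> n) x\<bar> \<le> B" for n
        by (rule nth_deriv_bounded[OF \<eta>(1), of "\<bar>m n\<bar> + 3 * r n"]) (rule \<eta>(3), linarith)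
      then have "\<forall>n. \<exists>B. \<forall>x. \<bar>nth_deriv k (\<eta> n) x\<bar> \<le> B" ..
      from choice[OF this] obtain B where B: "\<forall>n x. \<bar>nth_deriv k (\<eta> n) x\<bar> \<le> B n" ..
      define M where "M n = (if k \<le> n then (1/4) ^ Suc n else B n)" for n
      have "\<forall>\<^sub>F n in sequentially. M n = (1/4) ^ Suc n"
        using eventually_ge_at_top[of k] by eventually_elim (simp add: M_def)
      moreover have "summable (\<lambda>n. (1/4::real) ^ Suc n)"
        by (simp add: summable_mult summable_geometric)
      ultimately have "summable M" by (rule iffD2[OF summable_cong])
      moreover have "\<bar>nth_deriv k (\<eta> n) x\<bar> \<le> M n" for n x
        using B \<eta>(2)[of k n x] unfolding M_def by simp
      ultimately show ?thesis by (intro exI[of _ M] conjI allI)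
    qed
    show "n = k" if "\<bar>x - m n\<bar> < 3 * r n" "\<bar>x - m k\<bar> < 3 * r k" for n k x
    proof (rule ccontr)
      assume "n \<noteq> k"
      then consider "n < k" | "k < n" by linarith
      then show False using m_r[of n k] m_r[of k n] that by cases linarith+
    qed
    show "1/4 < x \<and> x < 3/4" if "\<bar>x - m n\<bar> < 3 * r n" for x n
    proof -
      have "(1/2::real) ^ n > 0" "(1/2::real) ^ n \<le> 1" by (simp_all add: power_le_one)
      then show ?thesis using that by (simp add: m_def r_def abs_if split: if_splits)
    qed
    show "\<bar>nth_deriv 1 (\<eta> n) x\<bar> \<le> (1/4) ^ Suc n" for n x
      using \<eta>(2)[of 1 n x] by simp
  qed (fact \<eta>(1) | fact \<eta>(3) | fact \<eta>(4) | fact \<eta>(5) | fact r)+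
  then show ?thesis by blast
qed

context twisted_strips
begin

definition displacement :: "nat set \<Rightarrow> real \<Rightarrow> real" where
  "displacement S x = (\<Sum>n. if n \<in> S then \<eta> n x else 0)"

text \<open>The map for the index set \<open>S\<close>, as a map of the real line commuting with the unit
  translation: it moves exactly the strips with index in \<open>S\<close>.\<close>

definition hol :: "nat set \<Rightarrow> real \<Rightarrow> real" where
  "hol S y = y + displacement S (frac y)"

lemma displacement_in_strip:
  assumes "\<bar>x - m n\<bar> < 3 * r n"
  shows "displacement S x = (if n \<in> S then \<eta> n x else 0)"
proof -
  have "\<eta> k x = 0" if "k \<noteq> n" for k
    using disjoint[OF assms, of k] support[of k x] that by (cases "\<bar>x - m k\<bar> < 3 * r k") auto
  then have "(\<lambda>k. if k \<in> S then \<eta> k x else 0) = (\<lambda>k. if k = n then (if n \<in> S then \<eta> n x else 0) else 0)"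
    by (intro ext) auto
  then have "displacement S x = (\<Sum>k. if k = n then (if n \<in> S then \<eta> n x else 0) else 0)"
    by (simp only: displacement_def)
  also have "\<dots> = (if n \<in> S then \<eta> n x else 0)"
    using sums_single[of n "\<lambda>_. if n \<in> S then \<eta> n x else 0"] by (simp add: sums_iff)
  finally show ?thesis .
qed

lemma displacement_outside:
  assumes "\<And>n. \<not> \<bar>x - m n\<bar> < 3 * r n"
  shows "displacement S x = 0"
proof -
  have "\<eta> k x = 0" for k using support[of k x] assms[of k] by simp
  then have "(\<lambda>n. if n \<in> S then \<eta> n x else 0) = (\<lambda>n. 0)" by auto
  then show ?thesis by (simp only: displacement_def suminf_zero)
qed

lemma displacement_eq_0: "x \<le> 1/4 \<or> x \<ge> 3/4 \<Longrightarrow> displacement S x = 0"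
  using range by (intro displacement_outside) force

lemma smooth_displacement: "smooth_on UNIV (displacement S)"
  and displacement_deriv: "\<exists>d. (displacement S has_real_derivative d) (at x) \<and> \<bar>d\<bar> \<le> 1/3"
proof -
  define f where "f n = (if n \<in> S then \<eta> n else (\<lambda>x. 0))" for n
  have nth: "nth_deriv k (f n) = (if n \<in> S then nth_deriv k (\<eta> n) else (\<lambda>x. 0))" for k n
    by (simp add: f_def nth_deriv_zero)
  have f: "smooth_on UNIV (f n)" for n by (simp add: f_def smooth smooth_on_const)
  have fb: "\<exists>M. summable M \<and> (\<forall>n x. \<bar>nth_deriv k (f n) x\<bar> \<le> M n)" for k
  proof -
    obtain M where M: "summable M" "\<forall>n x. \<bar>nth_deriv k (\<eta> n) x\<bar> \<le> M n" using bound[of k] by metis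
    have "\<bar>nth_deriv k (f n) x\<bar> \<le> M n" for n x
      using M(2)[rule_format, of n x] order_trans[OF abs_ge_zero M(2)[rule_format, of n x]] by (simp add: nth)
    with M(1) show ?thesis by blast
  qed
  have eq: "displacement S = (\<lambda>x. \<Sum>n. f n x)"
    unfolding displacement_def f_def by (intro ext arg_cong[where f = suminf]) simp
  show "smooth_on UNIV (displacement S)" unfolding eq by (rule smooth_on_suminf(1)[OF f fb])
  have le: "\<bar>nth_deriv 1 (f n) x\<bar> \<le> (1/4) ^ Suc n" for n x
    unfolding nth using small[of n x] by (cases "n \<in> S") (simp_all del: power_Suc)
  have g: "(\<lambda>n. (1/4::real) ^ Suc n) sums (1/3)"
    using sums_mult[OF geometric_sums[of "1/4::real"], of "1/4"] by simp
  have sa: "summable (\<lambda>n. \<bar>nth_deriv 1 (f n) x\<bar>)"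
    by (rule summable_comparison_test[OF _ sums_summable[OF g]]) (use le in auto)
  have "\<bar>\<Sum>n. nth_deriv 1 (f n) x\<bar> \<le> (\<Sum>n. \<bar>nth_deriv 1 (f n) x\<bar>)" by (rule summable_rabs[OF sa])
  also have "\<dots> \<le> (\<Sum>n. (1/4) ^ Suc n)" by (rule suminf_le[OF le sa sums_summable[OF g]])
  also have "\<dots> = 1/3" using g by (simp only: sums_iff)
  finally show "\<exists>d. (displacement S has_real_derivative d) (at x) \<and> \<bar>d\<bar> \<le> 1/3"
    unfolding eq using smooth_on_suminf(2)[OF f fb, of x] by blast
qed

text \<open>The interval may extend to the left of the integer because the displacement vanishes on the last
  quarter of a period; thus such open intervals cover the line.\<close>

lemma displacement_frac:
  assumes "y \<in> {of_int j - 1/4 <..< of_int j + 1}"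
  shows "displacement S (frac y) = displacement S (y - of_int j)"
proof (cases "y \<ge> of_int j")
  case True
  then have "\<lfloor>y\<rfloor> = j" using assms by (auto simp: floor_eq_iff)
  then show ?thesis by (simp add: frac_def)
next
  case False
  then have "\<lfloor>y\<rfloor> = j - 1" using assms by (auto simp: floor_eq_iff)
  then have "frac y = y - of_int j + 1" by (simp add: frac_def)
  then show ?thesis using assms False displacement_eq_0 by (simp add: displacement_eq_0)
qed

lemma in_floor_interval: "y \<in> {of_int \<lfloor>y\<rfloor> - 1/4 <..< of_int \<lfloor>y\<rfloor> + (1::real)}"
  by (simp, linarith)

lemma smooth_hol: "smooth_on UNIV (hol S)"
proof (rule smooth_on_local)
  fix y :: real
  let ?W = "{of_int \<lfloor>y\<rfloor> - 1/4 <..< of_int \<lfloor>y\<rfloor> + (1::real)}"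
  have "smooth_on ?W (\<lambda>z. z + displacement S (z - of_int \<lfloor>y\<rfloor>))"
    by (intro smooth_intros smooth_on_compose_UNIV[OF _ smooth_displacement]) auto
  then show "\<exists>W g. open W \<and> y \<in> W \<and> smooth_on W g \<and> (\<forall>z\<in>W. hol S z = g z)"
    using in_floor_interval[of y]
    by (intro exI[of _ ?W] exI[of _ "\<lambda>z. z + displacement S (z - of_int \<lfloor>y\<rfloor>)"] conjI ballI)
      (auto simp: hol_def displacement_frac simp del: greaterThanLessThan_iff)
qed

lemma hol_deriv: "\<exists>d>0. (hol S has_real_derivative d) (at y)"
  and strict_mono_hol: "strict_mono (hol S)"
proof -
  have d: "\<exists>d. ((\<lambda>y. displacement S (frac y)) has_real_derivative d) (at y) \<and> \<bar>d\<bar> \<le> 1/3" for y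
  proof -
    obtain d where d: "(displacement S has_real_derivative d) (at (y - of_int \<lfloor>y\<rfloor>))" "\<bar>d\<bar> \<le> 1/3"
      using displacement_deriv by blast
    have "((\<lambda>z. displacement S (z - of_int \<lfloor>y\<rfloor>)) has_real_derivative d) (at y)"
    proof -
      have "((\<lambda>z. z - of_int \<lfloor>y\<rfloor>) has_real_derivative 1) (at y)"
        by (auto intro!: derivative_eq_intros)
      from DERIV_chain2[where g = "\<lambda>z. z - of_int \<lfloor>y\<rfloor>", OF d(1) this] show ?thesis by simp
    qed
    then have "((\<lambda>y. displacement S (frac y)) has_real_derivative d) (at y)"
      by (rule has_field_derivative_transform_within_open[OF _ _ in_floor_interval]) (auto simp: displacement_frac)
    then show ?thesis using d(2) by blast
  qed
  then obtain d where d: "\<And>y. ((\<lambda>y. displacement S (frac y)) has_real_derivative d y) (at y)"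
    "\<And>y. \<bar>d y\<bar> \<le> 1/3" by metis
  have lt: "\<bar>d y\<bar> < 1" for y using d(2)[of y] by linarith
  show "\<exists>d>0. (hol S has_real_derivative d) (at y)"
    unfolding hol_def[abs_def] using DERIV_add[OF DERIV_ident d(1)[of y]] lt[of y] by (intro exI[of _ "1 + d y"]) auto
  show "strict_mono (hol S)"
    unfolding hol_def[abs_def] by (rule strict_mono_identity_plus_small[OF d(1) lt])
qed

lemma hol_periodic: "hol S (y + of_int j) = hol S y + of_int j"
  by (simp add: hol_def frac_def)

lemma hol_in_strip:
  assumes "\<bar>x - m n\<bar> < 3 * r n"
  shows "hol S (x + of_int j) = (if n \<in> S then x + \<eta> n x else x) + of_int j"
proof -
  have "frac x = x" using range[OF assms] by (simp add: frac_eq)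
  then show ?thesis unfolding hol_periodic by (simp add: hol_def displacement_in_strip[OF assms])
qed

lemma strip_cases:
  obtains (strip) n x j where "\<bar>x - m n\<bar> < 3 * r n" "y = x + of_int j"
  | (outside) "\<And>S. hol S y = y"
proof (cases "\<exists>n. \<bar>frac y - m n\<bar> < 3 * r n")
  case True
  then show ?thesis using strip[of "frac y" _ "\<lfloor>y\<rfloor>"] by (auto simp: frac_def)
next
  case False
  then show ?thesis using outside displacement_outside by (simp add: hol_def)
qed

lemma strip_invariant:
  assumes "\<bar>x - m n\<bar> < 3 * r n"
  shows "\<bar>x + \<eta> n x - m n\<bar> < 3 * r n"
proof -
  have "strict_mono (\<lambda>x. x + \<eta> n x)"
  proof (rule strict_mono_identity_plus_small)
    show "(\<eta> n has_real_derivative nth_deriv 1 (\<eta> n) x) (at x)" for x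
      using nth_deriv_has_real_derivative[OF smooth, of 0 n x] by simp
    have "(1/4::real) ^ Suc n \<le> 1/4" using power_le_one[of "1/4::real" n] by simp
    then show "\<bar>nth_deriv 1 (\<eta> n) x\<bar> < 1" for x using small[of n x] by linarith
  qed
  from strict_monoD[OF this, of "m n - 3 * r n" x] strict_monoD[OF this, of x "m n + 3 * r n"]
  show ?thesis using assms support[of n "m n - 3 * r n"] support[of n "m n + 3 * r n"] r_pos[of n]
    by (simp add: abs_less_iff)
qed

text \<open>On each strip either map is the identity or one and the same map.\<close>

lemma hol_commute: "hol S (hol U y) = hol U (hol S y)"
proof (cases y rule: strip_cases)
  case (strip n x j)
  note s = strip(1) strip_invariant[OF strip(1)]
  show ?thesis
    unfolding strip(2) hol_in_strip[OF s(1)]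
    by (cases "n \<in> S"; cases "n \<in> U") (simp_all only: if_True if_False hol_in_strip[OF s(1)] hol_in_strip[OF s(2)])
qed simp

lemma continuous_on_hol: "continuous_on A (hol S)"
  using smooth_on_imp_continuous_on[OF smooth_hol] continuous_on_subset by blast

lemma bij_hol: "bij (hol S)"
proof (rule strict_mono_fixing_integers_bij[OF strict_mono_hol continuous_on_hol])
  show "hol S (of_int j) = of_int j" for j
    using hol_periodic[of S 0 j] by (simp add: hol_def displacement_eq_0)
qed

definition hol_inv :: "nat set \<Rightarrow> real \<Rightarrow> real" where
  "hol_inv S = inv_into UNIV (hol S)"

lemma hol_inv: "hol S (hol_inv S y) = y" "hol_inv S (hol S y) = y"
  using bij_hol[of S] by (simp_all add: hol_inv_def bij_is_inj bij_is_surj surj_f_inv_f)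

lemma smooth_hol_inv: "smooth_on UNIV (hol_inv S)"
proof -
  have "smooth_on UNIV (\<lambda>z::real \<times> real. hol_inv S (snd z))"
  proof (rule smooth_on_fibrewise_inverse)
    show "smooth_on UNIV (\<lambda>z::real \<times> real. hol S (snd z))"
      by (intro smooth_on_compose_UNIV[OF _ smooth_hol] smooth_intros open_UNIV)
    fix z :: "real \<times> real"
    obtain d where d: "d > 0" "(hol S has_real_derivative d) (at (snd z))" using hol_deriv by blast
    have "((\<lambda>z. hol S (snd z)) has_derivative (\<lambda>v. snd v * d)) (at z)"
      using d(2) by (intro DERIV_compose_FDERIV has_derivative_snd has_derivative_ident)
    then have "frechet_derivative (\<lambda>z. hol S (snd z)) (at z) (0, 1) = snd (0::real, 1) * d"
      by (rule frechet_derivative_eqI)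
    then show "frechet_derivative (\<lambda>z. hol S (snd z)) (at z) (0, 1) \<noteq> 0" using d(1) by simp
  qed (simp_all add: hol_inv)
  then have "smooth_on UNIV (\<lambda>y. hol_inv S (snd (0::real, y)))"
    by (rule smooth_on_compose_UNIV[OF open_UNIV]) (intro smooth_intros open_UNIV)
  then show ?thesis by simp
qed

lemma hol_inv_periodic: "hol_inv S (y + of_int j) = hol_inv S y + of_int j"
  by (metis hol_inv hol_periodic)

text \<open>The fixed points bounding the part of a strip on which the map is a twisted translation.\<close>

definition lo :: "nat \<Rightarrow> real" where "lo n = m n - r n"
definition hi :: "nat \<Rightarrow> real" where "hi n = m n + r n"

lemma hol_on_strip:
  assumes "y \<in> {lo n..hi n}"
  shows "hol S y = (if n \<in> S then y + \<eta> n y else y)"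
proof -
  have "\<bar>y - m n\<bar> < 3 * r n" using assms r_pos[of n] by (auto simp: lo_def hi_def abs_if)
  from hol_in_strip[OF this, of S 0] show ?thesis by simp
qed

lemma twisted_hol:
  assumes "n \<in> S"
  shows "twisted_translation (lo n) (hi n) (T n) (hol S)"
proof (rule twisted_translation_cong)
  show "twisted_translation (lo n) (hi n) (T n) (\<lambda>y. y + \<eta> n y)"
    unfolding lo_def hi_def by (rule twisted)
  show "y + \<eta> n y = hol S y" if "y \<in> {lo n..hi n}" for y
    using hol_on_strip[OF that, of S] assms by simp
qed

lemma hol_fixed_isolated:
  assumes "p = lo n \<or> p = hi n" "\<bar>y - p\<bar> < r n" "hol UNIV y = y"
  shows "y = p"
proof (rule ccontr)
  assume "y \<noteq> p"
  have s: "\<bar>y - m n\<bar> < 3 * r n" and *: "\<bar>y - m n\<bar> \<le> 2 * r n" "y \<noteq> m n - r n" "y \<noteq> m n + r n"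
    using assms(1,2) \<open>y \<noteq> p\<close> r_pos[of n] by (auto simp: lo_def hi_def)
  have "hol UNIV y = y + \<eta> n y" using hol_in_strip[OF s, of UNIV 0] by simp
  then show False using nonzero[OF *] assms(3) by linarith
qed

end

section \<open>Charts, maps and paths of maps on the torus\<close>

abbreviation lattice_vec :: "int \<Rightarrow> int \<Rightarrow> real \<times> real" where
  "lattice_vec m n \<equiv> (of_int m, of_int n)"

abbreviation square :: "real \<Rightarrow> real \<Rightarrow> (real \<times> real) set" where
  "square a b \<equiv> {a<..<a+1} \<times> {b<..<b+1}"

lemma open_square: "open (square a b)"
  by (intro open_Times) auto

lemma torus_cover_lattice: "torus_cover (z + lattice_vec m n) = torus_cover z"
  using torus_cover_periodic by blast

lemma inv_cover_square: "z \<in> square a b \<Longrightarrow> inv_into (square a b) torus_cover (torus_cover z) = z"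
  by (rule inv_into_f_f[OF torus_cover_inj])

lemma torus_cover_in_torus: "torus_cover z \<in> topspace torus"
  by (cases z) (simp add: torus_cover_def torus_def)

lemma continuous_map_into_torus:
  assumes "continuous_on S f" "\<And>z. z \<in> S \<Longrightarrow> f z \<in> topspace torus"
  shows "continuous_map (top_of_set S) torus f"
  unfolding torus_def
  by (rule continuous_map_into_subtopology) (use assms in \<open>simp_all add: torus_def Pi_iff\<close>)

lemma continuous_on_from_torus_map: "continuous_map (top_of_set S) torus f \<Longrightarrow> continuous_on S f"
  by (simp add: torus_def continuous_map_in_subtopology)

lemma diffeo_in_torus:
  "f \<in> diffeos torus torus_atlas \<Longrightarrow> p \<in> topspace torus \<Longrightarrow> f p \<in> topspace torus"
  by (auto simp: diffeos_def Bij_def dest: bij_betw_apply)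

lemma torus_cover_surj:
  assumes "p \<in> topspace torus"
  obtains z where "p = torus_cover z"
proof -
  obtain U \<phi> where "(U, \<phi>) \<in> torus_atlas" "p \<in> U"
    using assms closed_smooth_manifold_torus
    unfolding closed_smooth_manifold_def smooth_manifold_def by blast
  then show ?thesis using that by (auto simp: torus_atlas_def)
qed

lemma square_chart_in_atlas:
  "(torus_cover ` square a b, inv_into (square a b) torus_cover) \<in> torus_atlas"
  unfolding torus_atlas_def
  by (intro CollectI exI[of _ "square a b"] exI[of _ a] exI[of _ b] conjI refl)

lemma torus_atlasE:
  assumes "c \<in> torus_atlas"
  obtains a b where "c = (torus_cover ` square a b, inv_into (square a b) torus_cover)"
  using assms unfolding torus_atlas_def by (elim CollectE exE conjE) (rule that, simp only:)

lemma inv_into_square_chart: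
  assumes "z \<in> square a b"
  shows "inv_into (torus_cover ` square a b) (inv_into (square a b) torus_cover) z = torus_cover z"
proof -
  have "inv_into (torus_cover ` square a b) (inv_into (square a b) torus_cover)
      (inv_into (square a b) torus_cover (torus_cover z)) = torus_cover z"
    by (rule inv_into_f_f) (use assms in \<open>auto intro!: inj_on_inv_into\<close>)
  then show ?thesis by (simp only: inv_cover_square[OF assms])
qed

lemma square_chart_image:
  "inv_into (square a b) torus_cover ` {p \<in> torus_cover ` square a b. P p}
     = {z \<in> square a b. P (torus_cover z)}"
proof (intro equalityI subsetI)
  fix w assume "w \<in> inv_into (square a b) torus_cover ` {p \<in> torus_cover ` square a b. P p}"
  then obtain p where "w = inv_into (square a b) torus_cover p" "p \<in> {p \<in> torus_cover ` square a b. P p}"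
    by (rule imageE)
  then obtain z where "w = inv_into (square a b) torus_cover p" "p = torus_cover z" "z \<in> square a b" "P p"
    by (elim CollectE conjE imageE)
  then show "w \<in> {z \<in> square a b. P (torus_cover z)}" using inv_cover_square[of z a b] by simp
next
  fix z assume "z \<in> {z \<in> square a b. P (torus_cover z)}"
  then show "z \<in> inv_into (square a b) torus_cover ` {p \<in> torus_cover ` square a b. P p}"
    using inv_cover_square[of z a b] by (intro image_eqI[of _ _ "torus_cover z"]) auto
qed

text \<open>On small sets, passing from the plane to a chart is a translation by a lattice vector.\<close>

lemma local_chart_lift:
  assumes "torus_cover z0 \<in> torus_cover ` square a b"
  obtains m n W where "open W" "z0 \<in> W"
    "\<And>z. z \<in> W \<Longrightarrow> z + lattice_vec m n \<in> square a b"
    "\<And>z. z \<in> W \<Longrightarrow> inv_into (square a b) torus_cover (torus_cover z) = z + lattice_vec m n"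
proof -
  obtain z1 where z1: "z1 \<in> square a b" "torus_cover z1 = torus_cover z0" using assms by auto
  then obtain m n where mn: "z1 = z0 + lattice_vec m n" using torus_cover_periodic by blast
  define W where "W = (\<lambda>z. z + lattice_vec m n) -` square a b"
  have "open W" unfolding W_def by (intro open_vimage open_square continuous_intros)
  moreover have "z0 \<in> W" using z1 mn by (simp add: W_def)
  moreover have sq: "z + lattice_vec m n \<in> square a b" if "z \<in> W" for z using that by (simp only: W_def vimage_eq)
  moreover have "inv_into (square a b) torus_cover (torus_cover z) = z + lattice_vec m n" if "z \<in> W" for z
    using inv_cover_square[OF sq[OF that]] by (simp only: torus_cover_lattice)
  ultimately show ?thesis using that by blast
qed

text \<open>The foliated charts arise in this way, with \<open>\<Psi>\<close> straightening the leaves.\<close>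

lemma straightened_chart:
  assumes \<Psi>: "smooth_on UNIV \<Psi>" "smooth_on UNIV \<Psi>'" "\<And>z. \<Psi> (\<Psi>' z) = z" "\<And>z. \<Psi>' (\<Psi> z) = z"
  shows "(torus_cover ` square a b, \<Psi> \<circ> inv_into (square a b) torus_cover) \<in> smooth_charts torus torus_atlas"
proof -
  let ?Q = "square a b"
  let ?U = "torus_cover ` ?Q"
  let ?\<phi> = "\<Psi> \<circ> inv_into ?Q torus_cover"
  have cont: "continuous_on S \<Psi>" "continuous_on S \<Psi>'" for S
    using \<Psi>(1,2)[THEN smooth_on_imp_continuous_on] by (auto elim: continuous_on_subset)
  have \<phi>: "?\<phi> (torus_cover z) = \<Psi> z" if "z \<in> ?Q" for z
    using inv_cover_square[OF that] by simp
  have im: "?\<phi> ` ?U = \<Psi> ` ?Q"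
    unfolding image_image by (intro image_cong refl) (rule \<phi>)
  have "\<Psi> ` ?Q = \<Psi>' -` ?Q"
  proof (intro equalityI subsetI)
    fix w assume "w \<in> \<Psi>' -` ?Q"
    then show "w \<in> \<Psi> ` ?Q" by (intro image_eqI[of _ _ "\<Psi>' w"]) (simp_all only: \<Psi>(3) vimage_eq)
  next
    fix w assume "w \<in> \<Psi> ` ?Q"
    then obtain z where "z \<in> ?Q" "w = \<Psi> z" by blast
    then show "w \<in> \<Psi>' -` ?Q" by (simp only: \<Psi>(4) vimage_eq)
  qed
  then have op: "open (\<Psi> ` ?Q)" using open_vimage[OF open_square cont(2)[of UNIV]] by simp
  have inv: "inv_into ?U ?\<phi> w = torus_cover (\<Psi>' w)" if "w \<in> \<Psi> ` ?Q" for w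
  proof -
    obtain z where z: "z \<in> ?Q" "w = \<Psi> z" using \<open>w \<in> \<Psi> ` ?Q\<close> by blast
    have "inj_on ?\<phi> ?U"
    proof (rule inj_onI)
      fix p p' assume "p \<in> ?U" "p' \<in> ?U" and eq: "?\<phi> p = ?\<phi> p'"
      then obtain u u' where u: "u \<in> ?Q" "p = torus_cover u" "u' \<in> ?Q" "p' = torus_cover u'" by blast
      then have "\<Psi> u = \<Psi> u'" using eq \<phi>[OF u(1)] \<phi>[OF u(3)] by simp
      then show "p = p'" using \<Psi>(4) u by metis
    qed
    then have "inv_into ?U ?\<phi> (?\<phi> (torus_cover z)) = torus_cover z"
      by (rule inv_into_f_f) (use z(1) in blast)
    then show ?thesis using \<phi>[OF z(1)] z(2) \<Psi>(4) by simp
  qed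
  have "homeomorphic_map (top_of_set ?Q) (top_of_set (\<Psi> ` ?Q)) \<Psi>"
    by (rule homeomorphic_maps_imp_map[of _ _ _ \<Psi>'])
      (use cont \<Psi>(3,4) in \<open>auto simp: homeomorphic_maps_def\<close>)
  from homeomorphic_map_compose[OF torus_chart_homeomorphic this]
  have hom: "homeomorphic_map (subtopology torus ?U) (top_of_set (?\<phi> ` ?U)) ?\<phi>"
    by (simp only: im)
  have tr: "smooth_on (?\<phi> ` (?U \<inter> V)) (\<psi> \<circ> inv_into ?U ?\<phi>) \<and> smooth_on (\<psi> ` (?U \<inter> V)) (?\<phi> \<circ> inv_into V \<psi>)"
    if "(V, \<psi>) \<in> torus_atlas" for V \<psi>
  proof -
    obtain a' b' where V: "V = torus_cover ` square a' b'" "\<psi> = inv_into (square a' b') torus_cover"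
      using \<open>(V, \<psi>) \<in> torus_atlas\<close> by (blast elim: torus_atlasE)
    have "smooth_on (?\<phi> ` (?U \<inter> V)) (\<psi> \<circ> inv_into ?U ?\<phi>)"
    proof (rule smooth_on_local)
      fix w assume "w \<in> ?\<phi> ` (?U \<inter> V)"
      then obtain z where z: "z \<in> ?Q" "torus_cover z \<in> V" "w = \<Psi> z" using \<phi> by force
      obtain m n W where W: "open W" "z \<in> W" "\<And>z. z \<in> W \<Longrightarrow> \<psi> (torus_cover z) = z + lattice_vec m n"
        using local_chart_lift[of z a' b'] z(2) unfolding V by metis
      show "\<exists>W g. open W \<and> w \<in> W \<and> smooth_on W g \<and> (\<forall>y\<in>W. (\<psi> \<circ> inv_into ?U ?\<phi>) y = g y)"
      proof (intro exI conjI ballI)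
        show "open (\<Psi>' -` (W \<inter> ?Q))"
          using W(1) cont(2) by (intro open_vimage open_Int open_square)
        show "w \<in> \<Psi>' -` (W \<inter> ?Q)" using z W(2) \<Psi>(4) by simp
        show "smooth_on (\<Psi>' -` (W \<inter> ?Q)) (\<lambda>y. \<Psi>' y + lattice_vec m n)"
          using smooth_on_add[OF open_UNIV \<Psi>(2) smooth_on_const] smooth_on_subset by blast
        fix y assume y: "y \<in> \<Psi>' -` (W \<inter> ?Q)"
        then have "y \<in> \<Psi> ` ?Q" using \<Psi>(3)[of y] by (intro image_eqI[of _ _ "\<Psi>' y"]) auto
        then show "(\<psi> \<circ> inv_into ?U ?\<phi>) y = \<Psi>' y + lattice_vec m n"
          using inv W(3)[of "\<Psi>' y"] y by simp
      qed
    qed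
    moreover have "smooth_on (\<psi> ` (?U \<inter> V)) (?\<phi> \<circ> inv_into V \<psi>)"
    proof (rule smooth_on_local)
      fix z assume "z \<in> \<psi> ` (?U \<inter> V)"
      then have "z \<in> \<psi> ` {p \<in> V. p \<in> ?U}" by blast
      then have z: "z \<in> square a' b'" "torus_cover z \<in> ?U"
        unfolding V square_chart_image by auto
      obtain m n W where W: "open W" "z \<in> W" "\<And>z. z \<in> W \<Longrightarrow> inv_into ?Q torus_cover (torus_cover z) = z + lattice_vec m n"
        using local_chart_lift[OF z(2)] by metis
      show "\<exists>W g. open W \<and> z \<in> W \<and> smooth_on W g \<and> (\<forall>y\<in>W. (?\<phi> \<circ> inv_into V \<psi>) y = g y)"
      proof (intro exI conjI ballI)
        show "open (W \<inter> square a' b')" using W(1) open_square by (rule open_Int)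
        show "z \<in> W \<inter> square a' b'" using z W(2) by blast
        show "smooth_on (W \<inter> square a' b') (\<lambda>y. \<Psi> (y + lattice_vec m n))"
          by (intro smooth_on_compose_UNIV[OF _ \<Psi>(1)] smooth_intros open_Int W(1) open_square)
        fix y assume "y \<in> W \<inter> square a' b'"
        then show "(?\<phi> \<circ> inv_into V \<psi>) y = \<Psi> (y + lattice_vec m n)"
          unfolding V using W(3)[of y] inv_into_square_chart[of y a' b'] by simp
      qed
    qed
    ultimately show ?thesis ..
  qed
  show ?thesis
    unfolding smooth_charts_def using torus_chart_open[of a b] op hom tr by (auto simp only: im mem_Collect_eq case_prod_conv)
qed

lemma square_chart_smooth: "(torus_cover ` square a b, inv_into (square a b) torus_cover) \<in> smooth_charts torus torus_atlas"
  using straightened_chart[of "\<lambda>z. z" "\<lambda>z. z" a b] by (simp add: smooth_on_ident o_def)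

lemma point_in_square: "z \<in> square (fst z - 1/2) (snd z - 1/2)"
  by (cases z) auto

section \<open>Maps of the torus given by equivariant maps of the plane\<close>

lemma continuous_map_of_lift:
  assumes F: "continuous_on UNIV F" and f: "\<And>z. f (torus_cover z) = torus_cover (F z)"
  shows "continuous_map torus torus f"
proof (rule pasting_lemma[where I = UNIV and T = "\<lambda>i. torus_cover ` square (fst i) (snd i)" and f = "\<lambda>_. f"])
  show "openin torus (torus_cover ` square (fst i) (snd i))" for i by (rule torus_chart_open)
  fix i :: "real \<times> real"
  let ?Q = "square (fst i) (snd i)"
  have "continuous_map (top_of_set ?Q) torus (\<lambda>z. torus_cover (F z))"
  proof -
    have "continuous_on ?Q (\<lambda>z. torus_cover (F z))"
      by (rule continuous_on_compose2[OF continuous_on_torus_cover[of UNIV] continuous_on_subset[OF F]]) auto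
    then show ?thesis by (rule continuous_map_into_torus) (rule torus_cover_in_torus)
  qed
  from continuous_map_compose[OF homeomorphic_imp_continuous_map[OF torus_chart_homeomorphic] this]
  show "continuous_map (subtopology torus (torus_cover ` ?Q)) torus f"
  proof (rule continuous_map_eq)
    fix p assume "p \<in> topspace (subtopology torus (torus_cover ` ?Q))"
    then obtain z where z: "z \<in> ?Q" "p = torus_cover z" by auto
    then show "((\<lambda>z. torus_cover (F z)) \<circ> inv_into ?Q torus_cover) p = f p"
      using inv_cover_square[OF z(1)] f by simp
  qed
next
  fix p assume "p \<in> topspace torus"
  then obtain z where "p = torus_cover z" by (rule torus_cover_surj)
  then have "p \<in> torus_cover ` square (fst (fst z - 1/2, snd z - 1/2)) (snd (fst z - 1/2, snd z - 1/2))"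
    using point_in_square[of z] by simp
  then show "\<exists>i. i \<in> UNIV \<and> p \<in> torus_cover ` square (fst i) (snd i) \<and> f p = f p" by blast
qed simp

lemma smooth_map_of_lift:
  assumes F: "smooth_on UNIV F" and f: "\<And>z. f (torus_cover z) = torus_cover (F z)"
  shows "smooth_map torus torus_atlas torus torus_atlas f"
  unfolding smooth_map_def
proof (intro conjI)
  note cont = smooth_on_imp_continuous_on[OF F]
  show "continuous_map torus torus f" by (rule continuous_map_of_lift[OF cont f])
  have "smooth_on (\<phi> ` {x \<in> U. f x \<in> V}) (\<psi> \<circ> f \<circ> inv_into U \<phi>)"
    if "(U, \<phi>) \<in> torus_atlas" "(V, \<psi>) \<in> torus_atlas" for U \<phi> V \<psi>
  proof (rule smooth_on_local)
    obtain a b where U: "U = torus_cover ` square a b" "\<phi> = inv_into (square a b) torus_cover"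
      using \<open>(U, \<phi>) \<in> torus_atlas\<close> by (blast elim: torus_atlasE)
    obtain a' b' where V: "V = torus_cover ` square a' b'" "\<psi> = inv_into (square a' b') torus_cover"
      using \<open>(V, \<psi>) \<in> torus_atlas\<close> by (blast elim: torus_atlasE)
    fix z assume "z \<in> \<phi> ` {x \<in> U. f x \<in> V}"
    then have z: "z \<in> square a b" "torus_cover (F z) \<in> torus_cover ` square a' b'"
      unfolding U V square_chart_image by (auto simp: f)
    obtain m n W where W: "open W" "F z \<in> W" "\<And>z. z \<in> W \<Longrightarrow> \<psi> (torus_cover z) = z + lattice_vec m n"
      using local_chart_lift[OF z(2)] unfolding V by metis
    show "\<exists>W g. open W \<and> z \<in> W \<and> smooth_on W g \<and> (\<forall>y\<in>W. (\<psi> \<circ> f \<circ> inv_into U \<phi>) y = g y)"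
    proof (intro exI conjI ballI)
      show "open (square a b \<inter> F -` W)" by (intro open_Int open_square open_vimage W(1) cont)
      show "z \<in> square a b \<inter> F -` W" using z(1) W(2) by blast
      show "smooth_on (square a b \<inter> F -` W) (\<lambda>y. F y + lattice_vec m n)"
        using smooth_on_add[OF open_UNIV F smooth_on_const] smooth_on_subset by blast
      fix y assume y: "y \<in> square a b \<inter> F -` W"
      then show "(\<psi> \<circ> f \<circ> inv_into U \<phi>) y = F y + lattice_vec m n"
        using W(3)[of "F y"] inv_into_square_chart[of y a b] by (simp add: U f)
    qed
  qed
  then show "\<forall>(U, \<phi>)\<in>torus_atlas. \<forall>(V, \<psi>)\<in>torus_atlas. smooth_on (\<phi> ` {x \<in> U. f x \<in> V}) (\<psi> \<circ> f \<circ> inv_into U \<phi>)"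
    by blast
qed

definition torus_map :: "(real \<times> real \<Rightarrow> real \<times> real) \<Rightarrow> complex \<times> complex \<Rightarrow> complex \<times> complex" where
  "torus_map F = restrict (\<lambda>p. torus_cover (F (SOME z. torus_cover z = p))) (topspace torus)"

lemma torus_map_cover:
  assumes "\<And>z m n. F (z + lattice_vec m n) = F z + lattice_vec m n"
  shows "torus_map F (torus_cover z) = torus_cover (F z)"
proof -
  have "torus_cover (SOME w. torus_cover w = torus_cover z) = torus_cover z" by (rule someI) simp
  then obtain m n where "(SOME w. torus_cover w = torus_cover z) = z + lattice_vec m n"
    using torus_cover_periodic by metis
  then show ?thesis
    using torus_cover_in_torus by (simp add: torus_map_def assms torus_cover_lattice)
qed

lemma torus_map_diffeo:
  assumes F: "smooth_on UNIV F" "\<And>z m n. F (z + lattice_vec m n) = F z + lattice_vec m n"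
    and F': "smooth_on UNIV F'" "\<And>z. F (F' z) = z" "\<And>z. F' (F z) = z"
  shows "torus_map F \<in> diffeos torus torus_atlas"
proof -
  let ?f = "torus_map F"
  note f = torus_map_cover[of F, OF F(2)]
  have bij: "bij_betw ?f (topspace torus) (topspace torus)"
    unfolding bij_betw_def
  proof
    show inj: "inj_on ?f (topspace torus)"
    proof (rule inj_onI)
      fix p q assume "p \<in> topspace torus" "q \<in> topspace torus" and eq: "?f p = ?f q"
      then obtain z w where zw: "p = torus_cover z" "q = torus_cover w" by (blast elim: torus_cover_surj)
      then obtain m n where "F z = F w + lattice_vec m n" using eq torus_cover_periodic f by metis
      then have "z = w + lattice_vec m n" using F(2) F'(3) by metis
      then show "p = q" using zw torus_cover_lattice by simp
    qed
    show "?f ` topspace torus = topspace torus"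
    proof (intro equalityI subsetI)
      fix p assume "p \<in> ?f ` topspace torus"
      then obtain q where q: "q \<in> topspace torus" "p = ?f q" by blast
      from q(1) obtain z where "q = torus_cover z" by (rule torus_cover_surj)
      then show "p \<in> topspace torus" using f torus_cover_in_torus q(2) by metis
    next
      fix p assume "p \<in> topspace torus"
      then obtain z where "p = torus_cover z" by (rule torus_cover_surj)
      then have "p = ?f (torus_cover (F' z))" by (simp add: f F')
      then show "p \<in> ?f ` topspace torus" using torus_cover_in_torus by blast
    qed
  qed
  have "inv_into (topspace torus) ?f (torus_cover z) = torus_cover (F' z)" for z
  proof -
    have "inv_into (topspace torus) ?f (?f (torus_cover (F' z))) = torus_cover (F' z)"
      by (rule inv_into_f_f) (use bij torus_cover_in_torus in \<open>auto simp: bij_betw_def\<close>)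
    then show ?thesis by (simp add: f F')
  qed
  then have "smooth_map torus torus_atlas torus torus_atlas (inv_into (topspace torus) ?f)"
    by (rule smooth_map_of_lift[OF F'(1)])
  moreover have "?f \<in> extensional (topspace torus)" by (simp add: torus_map_def)
  ultimately show ?thesis
    unfolding diffeos_def Bij_def using bij smooth_map_of_lift[OF F(1) f] by blast
qed

section \<open>Lifting to the plane\<close>

lemma lift_differentiable:
  assumes f: "smooth_map torus torus_atlas torus torus_atlas f"
    and F: "continuous_on UNIV F" "\<And>z. torus_cover (F z) = f (torus_cover z)"
  shows "F differentiable at z"
proof -
  let ?Q = "square (fst z - 1/2) (snd z - 1/2)" and ?R = "square (fst (F z) - 1/2) (snd (F z) - 1/2)"
  let ?\<phi> = "inv_into ?Q torus_cover" and ?\<psi> = "inv_into ?R torus_cover"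
  let ?U = "torus_cover ` ?Q" and ?V = "torus_cover ` ?R"
  have "smooth_on (?\<phi> ` {x \<in> ?U. f x \<in> ?V}) (?\<psi> \<circ> f \<circ> inv_into ?U ?\<phi>)"
    using f square_chart_in_atlas unfolding smooth_map_def by blast
  moreover have "z \<in> ?\<phi> ` {x \<in> ?U. f x \<in> ?V}"
    unfolding square_chart_image mem_Collect_eq F(2)[symmetric]
    by (intro conjI point_in_square imageI)
  ultimately have "(?\<psi> \<circ> f \<circ> inv_into ?U ?\<phi>) differentiable at z" by (rule smooth_on_imp_differentiable)
  then show ?thesis
  proof (rule differentiable_at_cong_open[rotated 3])
    show "open (?Q \<inter> F -` ?R)" by (intro open_Int open_vimage open_square F(1))
    show "z \<in> ?Q \<inter> F -` ?R" using point_in_square by blast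
    fix y assume y: "y \<in> ?Q \<inter> F -` ?R"
    then have "y \<in> ?Q" "F y \<in> ?R" by blast+
    from inv_into_square_chart[OF this(1)] inv_cover_square[OF this(2)]
    show "(?\<psi> \<circ> f \<circ> inv_into ?U ?\<phi>) y = F y" by (simp only: o_apply F(2)[symmetric])
  qed
qed

lemma integer_valued_constant:
  fixes d :: "'a::real_normed_vector \<Rightarrow> real"
  assumes "connected S" "continuous_on S d" and int: "\<And>x. x \<in> S \<Longrightarrow> d x \<in> \<int>"
  shows "d constant_on S"
proof (rule continuous_discrete_range_constant[OF assms(1,2)])
  fix x assume "x \<in> S"
  show "\<exists>e>0. \<forall>y. y \<in> S \<and> d y \<noteq> d x \<longrightarrow> e \<le> norm (d y - d x)"
  proof (intro exI[of _ 1] conjI allI impI)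
    fix y assume y: "y \<in> S \<and> d y \<noteq> d x"
    then have "d y - d x \<in> \<int>" "d y - d x \<noteq> 0" using int \<open>x \<in> S\<close> by auto
    then show "1 \<le> norm (d y - d x)" by (simp add: Ints_nonzero_abs_ge1)
  qed simp
qed

lemma lattice_valued_constant:
  fixes d :: "'a::real_normed_vector \<Rightarrow> real \<times> real"
  assumes "connected S" "continuous_on S d" "\<And>x. x \<in> S \<Longrightarrow> \<exists>m n. d x = lattice_vec m n"
    and "x \<in> S" "y \<in> S"
  shows "d x = d y"
proof -
  have "fst (d z) \<in> \<int>" "snd (d z) \<in> \<int>" if "z \<in> S" for z using assms(3)[OF that] by auto
  then have "(\<lambda>z. fst (d z)) constant_on S" "(\<lambda>z. snd (d z)) constant_on S"
    using assms(1,2) by (auto intro!: integer_valued_constant continuous_on_fst continuous_on_snd)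
  then show ?thesis using assms(4,5) unfolding constant_on_def by (metis prod_eq_iff)
qed

lemma lifts_differ_by_lattice:
  assumes "continuous_on UNIV F" "continuous_on UNIV G"
    and "\<And>z::real \<times> real. torus_cover (F z) = torus_cover (G z)"
  obtains m n where "\<And>z. F z = G z + lattice_vec m n"
proof -
  have diff: "\<exists>m n. F z - G z = lattice_vec m n" for z
    using assms(3)[of z] torus_cover_periodic[of "F z" "G z"] by (auto simp: algebra_simps)
  then obtain m n where mn: "F 0 - G 0 = lattice_vec m n" by blast
  have "F z - G z = F 0 - G 0" for z
    by (rule lattice_valued_constant[of UNIV "\<lambda>z. F z - G z"])
      (use diff assms in \<open>auto intro: continuous_on_diff\<close>)
  then show ?thesis using that[of m n] mn by (metis add.commute diff_add_cancel)
qed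

text \<open>The \<open>C\<^sup>\<infinity>\<close> topology is finer than the compact-open topology, so a path of diffeomorphisms is
  jointly continuous as a map of two variables.\<close>

lemma diffeo_path_evaluation_continuous:
  assumes \<gamma>: "continuous_map (top_of_set {0..1::real}) (diffeo_topology torus torus_atlas) \<gamma>"
  shows "continuous_on ({0..1} \<times> UNIV) (\<lambda>x. \<gamma> (fst x) (torus_cover (snd x)))"
proof (rule continuous_on_eq_continuous_within[THEN iffD2], rule ballI)
  fix x0 :: "real \<times> real \<times> real" assume x0: "x0 \<in> {0..1} \<times> UNIV"
  obtain t0 z0 where tz: "x0 = (t0, z0)" "t0 \<in> {0..1}" using x0 by (cases x0) auto
  define f where "f = \<gamma> t0"
  have diffeo: "\<gamma> t \<in> diffeos torus torus_atlas" if "t \<in> {0..1}" for t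
    using \<gamma> that by (auto simp: continuous_map_def diffeo_topology_def)
  then have f: "f \<in> smooth_maps torus torus_atlas torus torus_atlas"
    using tz(2) by (auto simp: f_def diffeos_def smooth_maps_def Bij_def)
  then have fc: "continuous_map torus torus f" by (simp add: smooth_maps_def smooth_map_def)
  have fcov: "continuous_on UNIV (\<lambda>z. f (torus_cover z))"
  proof -
    have "continuous_map (top_of_set UNIV) torus torus_cover"
      using continuous_on_torus_cover torus_cover_in_torus by (rule continuous_map_into_torus)
    from continuous_map_compose[OF this fc] show ?thesis
      unfolding o_def by (rule continuous_on_from_torus_map)
  qed
  have "f (torus_cover z0) \<in> topspace torus"
    using diffeo_in_torus[OF diffeo[OF tz(2)] torus_cover_in_torus] by (simp only: f_def)
  then obtain z1 where z1: "f (torus_cover z0) = torus_cover z1" by (rule torus_cover_surj)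
  let ?Q = "square (fst z0 - 1/2) (snd z0 - 1/2)" and ?R = "square (fst z1 - 1/2) (snd z1 - 1/2)"
  let ?U = "torus_cover ` ?Q" and ?V = "torus_cover ` ?R"
  define \<phi> where "\<phi> = inv_into ?Q torus_cover"
  define \<psi> where "\<psi> = inv_into ?R torus_cover"
  have \<psi>: "\<psi> (torus_cover z) = z" "torus_cover z \<in> ?V" if "z \<in> ?R" for z
    unfolding \<psi>_def by (rule inv_cover_square[OF that], rule imageI[OF that])
  have c\<psi>: "torus_cover (\<psi> p) = p" if "p \<in> ?V" for p
    using that by (auto simp: \<psi>_def f_inv_into_f)
  have inv\<phi>: "inv_into ?U \<phi> z = torus_cover z" if "z \<in> ?Q" for z
    unfolding \<phi>_def using inv_into_square_chart[OF that] .
  have V: "openin torus ?V" by (rule torus_chart_open)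
  have "openin (top_of_set UNIV) (UNIV \<inter> (\<lambda>z. f (torus_cover z)) -` ?V)"
  proof (rule continuous_openin_preimage[OF fcov])
    show "(\<lambda>z. f (torus_cover z)) \<in> UNIV \<rightarrow> topspace torus"
      using fc torus_cover_in_torus by (auto simp: continuous_map_def)
    show "openin (top_of_set (topspace torus)) ?V" using V by (simp add: torus_def)
  qed
  then have "open (?Q \<inter> (\<lambda>z. f (torus_cover z)) -` ?V)"
    by (intro open_Int open_square) simp
  moreover have "z0 \<in> ?Q \<inter> (\<lambda>z. f (torus_cover z)) -` ?V"
    using point_in_square z1 by auto
  ultimately obtain \<delta> where \<delta>: "\<delta> > 0" "cball z0 \<delta> \<subseteq> ?Q \<inter> (\<lambda>z. f (torus_cover z)) -` ?V"
    using open_contains_cball by blast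
  define K where "K = torus_cover ` cball z0 \<delta>"
  have K: "compactin torus K" "K \<subseteq> ?U" "f ` K \<subseteq> ?V"
  proof -
    have "compact K" unfolding K_def by (intro compact_continuous_image continuous_on_torus_cover) auto
    moreover have "K \<subseteq> topspace torus" unfolding K_def by (intro image_subsetI torus_cover_in_torus)
    ultimately show "compactin torus K"
      by (simp add: torus_def compactin_subtopology)
    show "K \<subseteq> ?U" "f ` K \<subseteq> ?V" using \<delta>(2) by (auto simp: K_def)
  qed
  define g where "g x = \<psi> (\<gamma> (fst x) (torus_cover (snd x)))" for x
  have near: "\<forall>\<^sub>F x in at x0 within {0..1} \<times> UNIV. \<gamma> (fst x) (torus_cover (snd x)) \<in> ?V \<and>
       norm (g x - \<psi> (f (torus_cover (snd x)))) < \<epsilon>" if "\<epsilon> > 0" for \<epsilon>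
  proof -
    define N where "N = C_infinity_nbhd torus torus_atlas torus torus_atlas f (?U, \<phi>) (?V, \<psi>) K 0 \<epsilon>"
    have "openin (C_infinity_topology torus torus_atlas torus torus_atlas) N"
      unfolding C_infinity_topology_def
    proof (rule topology_generated_by_Basis)
      have "(?U, \<phi>) \<in> smooth_charts torus torus_atlas" "(?V, \<psi>) \<in> smooth_charts torus torus_atlas"
        unfolding \<phi>_def \<psi>_def by (rule square_chart_smooth)+
      then show "N \<in> {C_infinity_nbhd torus torus_atlas torus torus_atlas f (U, \<phi>) (V, \<psi>) K r \<epsilon> |f U \<phi> V \<psi> K r \<epsilon>.
          f \<in> smooth_maps torus torus_atlas torus torus_atlas \<and>
          (U, \<phi>) \<in> smooth_charts torus torus_atlas \<and> (V, \<psi>) \<in> smooth_charts torus torus_atlas \<and>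
          compactin torus K \<and> K \<subseteq> U \<and> f ` K \<subseteq> V \<and> \<epsilon> > 0}"
        using f K \<open>\<epsilon> > 0\<close> N_def by blast
    qed
    then have "openin (diffeo_topology torus torus_atlas) (diffeos torus torus_atlas \<inter> N)"
      unfolding diffeo_topology_def by (rule openin_subtopology_Int2)
    then have "openin (top_of_set {0..1}) {t \<in> {0..1}. \<gamma> t \<in> diffeos torus torus_atlas \<inter> N}"
      using openin_continuous_map_preimage[OF \<gamma>] by fastforce
    then obtain A where A: "open A" "{t \<in> {0..1}. \<gamma> t \<in> diffeos torus torus_atlas \<inter> N} = {0..1} \<inter> A"
      unfolding openin_open by blast
    have "f \<in> N"
      unfolding N_def C_infinity_nbhd_def using f K(3) \<open>\<epsilon> > 0\<close> by auto
    then have "t0 \<in> A" using A(2) tz(2) diffeo[OF tz(2)] by (auto simp: f_def)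
    have *: "\<gamma> t (torus_cover z) \<in> ?V \<and> norm (\<psi> (\<gamma> t (torus_cover z)) - \<psi> (f (torus_cover z))) < \<epsilon>"
      if "t \<in> {0..1}" "t \<in> A" "z \<in> ball z0 \<delta>" for t z
    proof -
      have "\<gamma> t \<in> N" using A(2) that by blast
      moreover have z: "z \<in> ?Q" "torus_cover z \<in> K" using \<delta>(2) that(3) by (auto simp: K_def)
      ultimately have V: "\<gamma> t (torus_cover z) \<in> ?V" and
        "norm (iterated_derivative [] (\<psi> \<circ> \<gamma> t \<circ> inv_into ?U \<phi>) (\<phi> (torus_cover z))
             - iterated_derivative [] (\<psi> \<circ> f \<circ> inv_into ?U \<phi>) (\<phi> (torus_cover z))) < \<epsilon>"
        unfolding N_def C_infinity_nbhd_def by (auto simp del: iterated_derivative.simps)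
      moreover have "\<phi> (torus_cover z) = z" unfolding \<phi>_def by (rule inv_cover_square[OF z(1)])
      ultimately show ?thesis using inv\<phi>[OF z(1)] by simp
    qed
    show ?thesis
    proof (rule eventually_at_topological[THEN iffD2], intro exI conjI ballI impI)
      show "open (A \<times> ball z0 \<delta>)" using A(1) by (intro open_Times) auto
      show "x0 \<in> A \<times> ball z0 \<delta>" using \<open>t0 \<in> A\<close> \<delta>(1) tz(1) by simp
    qed (use * in \<open>auto simp: g_def\<close>)
  qed
  have g0: "g x0 = \<psi> (f (torus_cover z0))" by (simp add: g_def tz f_def)
  have "(g \<longlongrightarrow> g x0) (at x0 within {0..1} \<times> UNIV)"
  proof (rule tendstoI)
    fix \<epsilon> :: real assume "\<epsilon> > 0"
    have "continuous_on (cball z0 \<delta>) (\<lambda>z. \<psi> (f (torus_cover z)))"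
    proof (rule continuous_on_compose2[of ?V \<psi>])
      have "continuous_map (subtopology torus ?V) (top_of_set ?R) \<psi>"
        unfolding \<psi>_def by (rule homeomorphic_imp_continuous_map[OF torus_chart_homeomorphic])
      moreover have "subtopology torus ?V = top_of_set ?V"
        using openin_subset[OF V] by (simp add: torus_def subtopology_subtopology inf_absorb2)
      ultimately show "continuous_on ?V \<psi>" by simp
    qed (use fcov \<delta>(2) continuous_on_subset in blast)+
    then have "isCont (\<lambda>z. \<psi> (f (torus_cover z))) z0"
      by (rule continuous_on_interior) (use \<delta>(1) in simp)
    then have "((\<lambda>x. \<psi> (f (torus_cover (snd x)))) \<longlongrightarrow> \<psi> (f (torus_cover z0))) (at x0 within {0..1} \<times> UNIV)"
      by (rule isCont_tendsto_compose) (use tendsto_snd[OF tendsto_ident_at, of x0] tz in simp)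
    from tendstoD[OF this, of "\<epsilon> / 2"] \<open>\<epsilon> > 0\<close>
    have "\<forall>\<^sub>F x in at x0 within {0..1} \<times> UNIV. dist (\<psi> (f (torus_cover (snd x)))) (\<psi> (f (torus_cover z0))) < \<epsilon> / 2"
      by simp
    moreover have "\<forall>\<^sub>F x in at x0 within {0..1} \<times> UNIV. \<gamma> (fst x) (torus_cover (snd x)) \<in> ?V \<and>
       norm (g x - \<psi> (f (torus_cover (snd x)))) < \<epsilon> / 2"
      using \<open>\<epsilon> > 0\<close> by (intro near) simp
    ultimately show "\<forall>\<^sub>F x in at x0 within {0..1} \<times> UNIV. dist (g x) (g x0) < \<epsilon>"
      unfolding g0
    proof (eventually_elim)
      case (elim x)
      then show ?case
        using dist_triangle[of "g x" "\<psi> (f (torus_cover z0))" "\<psi> (f (torus_cover (snd x)))"]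
        by (simp add: dist_norm)
    qed
  qed
  then have "((\<lambda>x. torus_cover (g x)) \<longlongrightarrow> torus_cover (g x0)) (at x0 within {0..1} \<times> UNIV)"
    by (rule isCont_tendsto_compose[rotated])
      (rule continuous_on_interior[OF continuous_on_torus_cover[of UNIV]], simp)
  moreover have "\<forall>\<^sub>F x in at x0 within {0..1} \<times> UNIV. torus_cover (g x) = \<gamma> (fst x) (torus_cover (snd x))"
    by (rule eventually_mono[OF near[OF zero_less_one]]) (unfold g_def, rule c\<psi>, erule conjunct1)
  moreover have "torus_cover (g x0) = \<gamma> (fst x0) (torus_cover (snd x0))"
  proof -
    have "f (torus_cover z0) \<in> ?V" unfolding z1 by (rule \<psi>(2)[OF point_in_square])
    from c\<psi>[OF this] show ?thesis by (simp add: g0) (simp add: tz f_def)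
  qed
  ultimately have "((\<lambda>x. \<gamma> (fst x) (torus_cover (snd x))) \<longlongrightarrow> \<gamma> (fst x0) (torus_cover (snd x0)))
      (at x0 within {0..1} \<times> UNIV)"
    by (auto intro: Lim_transform_eventually)
  then show "continuous (at x0 within {0..1} \<times> UNIV) (\<lambda>x. \<gamma> (fst x) (torus_cover (snd x)))"
    unfolding continuous_within .
qed

text \<open>The two components of the evaluation map are nowhere zero functions on a contractible set, so they
  have continuous logarithms.\<close>

lemma diffeo_path_lift:
  assumes \<gamma>: "continuous_map (top_of_set {0..1::real}) (diffeo_topology torus torus_atlas) \<gamma>"
  obtains \<Gamma> where "continuous_on ({0..1} \<times> UNIV) \<Gamma>"
    "\<And>t z. t \<in> {0..1} \<Longrightarrow> torus_cover (\<Gamma> (t, z)) = \<gamma> t (torus_cover z)"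
proof -
  let ?S = "{0..1::real} \<times> (UNIV :: (real \<times> real) set)"
  let ?f = "\<lambda>x. \<gamma> (fst x) (torus_cover (snd x))"
  have cont: "continuous_on ?S ?f" by (rule diffeo_path_evaluation_continuous[OF \<gamma>])
  have contr: "contractible ?S" by (intro convex_imp_contractible convex_Times) auto
  have in_torus: "?f x \<in> topspace torus" if "x \<in> ?S" for x
  proof -
    have "\<gamma> (fst x) \<in> diffeos torus torus_atlas"
      using \<gamma> that by (auto simp: continuous_map_def diffeo_topology_def)
    then show ?thesis using torus_cover_in_torus by (rule diffeo_in_torus)
  qed
  have norm1: "norm (fst (?f x)) = 1" "norm (snd (?f x)) = 1" if "x \<in> ?S" for x
    using in_torus[OF that] by (auto simp: torus_def)
  have log: "\<exists>l. continuous_on ?S l \<and> (\<forall>x\<in>?S. u x = cis (2 * pi * l x))"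
    if u: "continuous_on ?S u" "\<And>x. x \<in> ?S \<Longrightarrow> norm (u x) = 1" for u :: "real \<times> real \<times> real \<Rightarrow> complex"
  proof -
    have "u x \<noteq> 0" if "x \<in> ?S" for x using u(2)[OF that] by auto
    then obtain g where g: "continuous_on ?S g" "\<And>x. x \<in> ?S \<Longrightarrow> u x = exp (g x)"
      using continuous_logarithm_on_contractible[OF u(1) contr] by blast
    have "u x = cis (2 * pi * (Im (g x) / (2 * pi)))" if "x \<in> ?S" for x
    proof -
      have "exp (Re (g x)) = 1" using u(2)[OF that] g(2)[OF that] by (simp add: norm_exp_eq_Re)
      then have "g x = \<i> * of_real (Im (g x))" by (simp add: complex_eq_iff)
      then have "u x = cis (Im (g x))" using g(2)[OF that] by (metis cis_conv_exp)
      then show ?thesis by simp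
    qed
    moreover have "continuous_on ?S (\<lambda>x. Im (g x) / (2 * pi))"
      by (intro continuous_intros g(1)) simp
    ultimately show ?thesis by blast
  qed
  obtain l1 where l1: "continuous_on ?S l1" "\<forall>x\<in>?S. fst (?f x) = cis (2 * pi * l1 x)"
    using log[OF continuous_on_fst[OF cont] norm1(1)] by blast
  obtain l2 where l2: "continuous_on ?S l2" "\<forall>x\<in>?S. snd (?f x) = cis (2 * pi * l2 x)"
    using log[OF continuous_on_snd[OF cont] norm1(2)] by blast
  show ?thesis
  proof (rule that)
    show "continuous_on ?S (\<lambda>x. (l1 x, l2 x))" by (intro continuous_on_Pair l1 l2)
    fix t :: real and z :: "real \<times> real" assume "t \<in> {0..1}"
    then have "(t, z) \<in> ?S" by simp
    then show "torus_cover (l1 (t, z), l2 (t, z)) = \<gamma> t (torus_cover z)"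
      using l1(2)[rule_format, of "(t, z)"] l2(2)[rule_format, of "(t, z)"] by (simp add: torus_cover_def prod_eq_iff)
  qed
qed

section \<open>Integer iterates\<close>

definition int_iterate :: "('a \<Rightarrow> 'a) \<Rightarrow> ('a \<Rightarrow> 'a) \<Rightarrow> int \<Rightarrow> 'a \<Rightarrow> 'a" where
  "int_iterate f f' j = (if j \<ge> 0 then f ^^ nat j else f' ^^ nat (- j))"

lemma int_iterate_0 [simp]: "int_iterate f f' 0 y = y"
  by (simp add: int_iterate_def)

lemma int_iterate_invariant:
  assumes "\<And>y. P y \<Longrightarrow> P (f y)" "\<And>y. P y \<Longrightarrow> P (f' y)" "P y"
  shows "P (int_iterate f f' j y)"
proof -
  have "P ((u ^^ n) y)" if "\<And>y. P y \<Longrightarrow> P (u y)" for u n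
    using that assms(3) by (induction n) auto
  then show ?thesis using assms by (simp add: int_iterate_def)
qed

lemma int_iterate_commute:
  assumes "\<And>y. u (f y) = f (u y)" "\<And>y. u (f' y) = f' (u y)"
  shows "u (int_iterate f f' j y) = int_iterate f f' j (u y)"
proof -
  have "u ((v ^^ n) y) = (v ^^ n) (u y)" if "\<And>y. u (v y) = v (u y)" for v n
    using that by (induction n) auto
  then show ?thesis using assms by (simp add: int_iterate_def)
qed

lemma int_iterate_1:
  assumes "\<And>y. f (f' y) = y"
  shows "int_iterate f f' (j + 1) y = f (int_iterate f f' j y)"
proof (cases "j \<ge> 0")
  case True
  then have "nat (j + 1) = Suc (nat j)" by simp
  then show ?thesis using True by (simp add: int_iterate_def)
next
  case False
  then have "nat (- j) = Suc (nat (- (j + 1)))" by simp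
  then show ?thesis using False assms by (cases "j = -1") (simp_all add: int_iterate_def)
qed

lemma int_iterate_add:
  assumes "\<And>y. f (f' y) = y" "\<And>y. f' (f y) = y"
  shows "int_iterate f f' (i + j) y = int_iterate f f' i (int_iterate f f' j y)"
proof (induction i rule: int_induct[where k = 0])
  case (step1 i)
  have "i + 1 + j = (i + j) + 1" by simp
  then show ?case using step1 int_iterate_1[of f f'] assms(1) by metis
next
  case (step2 i)
  have "f (int_iterate f f' (i - 1 + j) y) = int_iterate f f' (i + j) y"
    using int_iterate_1[of f f' "i - 1 + j" y] assms(1) by (simp add: algebra_simps)
  moreover have "f (int_iterate f f' (i - 1) w) = int_iterate f f' i w" for w
    using int_iterate_1[of f f' "i - 1" w] assms(1) by simp
  ultimately show ?case using step2(2) assms(2) by metis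
qed simp

lemma int_iterate_inverse:
  assumes "\<And>y. f (f' y) = y" "\<And>y. f' (f y) = y"
  shows "int_iterate f f' (- j) (int_iterate f f' j y) = y" "int_iterate f f' j (int_iterate f f' (- j) y) = y"
  using int_iterate_add[of f f' "- j" j y] int_iterate_add[of f f' j "- j" y] assms by simp_all

lemma smooth_on_funpow:
  fixes f :: "'a::euclidean_space \<Rightarrow> 'a"
  assumes "smooth_on UNIV f"
  shows "smooth_on UNIV (f ^^ n)"
proof (induction n)
  case 0
  show ?case using smooth_on_ident by (simp add: id_def)
next
  case (Suc n)
  then show ?case using smooth_on_compose_UNIV[OF open_UNIV assms Suc] by (simp add: o_def)
qed

lemma smooth_on_int_iterate:
  fixes f :: "'a::euclidean_space \<Rightarrow> 'a"
  assumes "smooth_on UNIV f" "smooth_on UNIV f'"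
  shows "smooth_on UNIV (int_iterate f f' j)"
proof -
  have "int_iterate f f' j = (if j \<ge> 0 then f ^^ nat j else f' ^^ nat (- j))"
    by (rule ext) (simp only: int_iterate_def)
  then show ?thesis using smooth_on_funpow[OF assms(1)] smooth_on_funpow[OF assms(2)] by (cases "j \<ge> 0") simp_all
qed

lemma openin_cover_image:
  assumes "open A" "A \<subseteq> square a b"
  shows "openin torus (torus_cover ` A)"
proof -
  let ?Q = "square a b" and ?U = "torus_cover ` square a b"
  let ?\<phi> = "inv_into ?Q torus_cover"
  have "(\<lambda>z. ?\<phi> (torus_cover z)) ` A = (\<lambda>z. z) ` A"
    by (rule image_cong[OF refl]) (rule inv_cover_square, erule subsetD[OF assms(2)])
  then have im: "?\<phi> ` torus_cover ` A = A" by (simp only: image_image image_ident)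
  have "?U \<subseteq> topspace torus" by (rule openin_subset[OF torus_chart_open])
  then have "topspace (subtopology torus ?U) = ?U" by (simp only: topspace_subtopology inf_absorb2)
  then have "torus_cover ` A \<subseteq> topspace (subtopology torus ?U)" using image_mono[OF assms(2)] by (simp only:)
  from homeomorphic_map_openness[OF torus_chart_homeomorphic this]
  have "openin (subtopology torus ?U) (torus_cover ` A) \<longleftrightarrow> openin (top_of_set ?Q) A"
    by (simp only: im)
  moreover have "openin (top_of_set ?Q) A" by (rule open_subset[OF assms(2,1)])
  ultimately have "openin (subtopology torus ?U) (torus_cover ` A)" by (simp only:)
  then show ?thesis using torus_chart_open by (rule openin_trans_full)
qed

section \<open>The suspension foliation\<close>

text \<open>Constant near \<open>0\<close> and near \<open>1\<close>, so that the pieces of the foliation over consecutive unit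
  intervals fit together smoothly.\<close>

definition ramp :: "real \<Rightarrow> real" where
  "ramp x = smooth_step (3 * x - 1)"

lemma smooth_ramp: "smooth_on UNIV ramp"
proof -
  have "smooth_on UNIV (\<lambda>x::real. 3 * x - 1)"
    by (rule smooth_on_diff[OF open_UNIV smooth_on_mult[OF open_UNIV smooth_on_const smooth_on_ident] smooth_on_const])
  from smooth_on_compose_UNIV[OF open_UNIV smooth_on_smooth_step this] show ?thesis
    by (simp only: ramp_def[abs_def])
qed

lemma ramp_0: "x \<le> 1/3 \<Longrightarrow> ramp x = 0" and ramp_1: "x \<ge> 2/3 \<Longrightarrow> ramp x = 1"
  by (simp_all add: ramp_def smooth_step_le_0 smooth_step_ge_1)

lemma ramp_bounds: "0 \<le> ramp x" "ramp x \<le> 1"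
  by (simp_all add: ramp_def smooth_step_bounds)

context twisted_strips
begin

text \<open>The return map of the foliation is the square of \<open>hol UNIV\<close>: the maps \<open>hol S\<close> commute with it,
  but on a strip with index in \<open>S\<close> they are not among its iterates.\<close>

definition ret :: "real \<Rightarrow> real" where "ret y = hol UNIV (hol UNIV y)"
definition ret_inv :: "real \<Rightarrow> real" where "ret_inv y = hol_inv UNIV (hol_inv UNIV y)"
definition ret_pow :: "int \<Rightarrow> real \<Rightarrow> real" where "ret_pow = int_iterate ret ret_inv"

lemma ret_inv: "ret (ret_inv y) = y" "ret_inv (ret y) = y"
  by (simp_all add: ret_def ret_inv_def hol_inv)

lemma ret_periodic: "ret (y + of_int j) = ret y + of_int j" "ret_inv (y + of_int j) = ret_inv y + of_int j"
  by (simp_all add: ret_def ret_inv_def hol_periodic hol_inv_periodic)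

lemma smooth_ret: "smooth_on UNIV ret" "smooth_on UNIV ret_inv"
  unfolding ret_def[abs_def] ret_inv_def[abs_def]
  by (rule smooth_on_compose_UNIV[OF open_UNIV smooth_hol smooth_hol]
      smooth_on_compose_UNIV[OF open_UNIV smooth_hol_inv smooth_hol_inv])+

lemma strict_mono_ret: "strict_mono ret"
  using strict_mono_hol[of UNIV] by (simp add: ret_def strict_mono_def)

lemma ret_fixed: "x \<le> 1/4 \<or> x \<ge> 3/4 \<Longrightarrow> 0 \<le> x \<Longrightarrow> x < 1 \<Longrightarrow> ret (x + of_int j) = x + of_int j"
proof -
  assume x: "x \<le> 1/4 \<or> x \<ge> 3/4" "0 \<le> x" "x < 1"
  have "hol UNIV (x + of_int j) = x + of_int j"
    using x by (simp add: hol_periodic) (simp add: hol_def frac_eq displacement_eq_0)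
  then show ?thesis by (simp add: ret_def)
qed

lemma ret_pow_add: "ret_pow (i + j) y = ret_pow i (ret_pow j y)"
  unfolding ret_pow_def by (intro int_iterate_add ret_inv)

lemma ret_pow_inverse: "ret_pow (- j) (ret_pow j y) = y" "ret_pow j (ret_pow (- j) y) = y"
  unfolding ret_pow_def by (intro int_iterate_inverse ret_inv)+

lemma ret_pow_0 [simp]: "ret_pow 0 y = y" by (simp add: ret_pow_def)

lemma ret_pow_1: "ret_pow 1 y = ret y"
  using int_iterate_1[of ret ret_inv 0 y] ret_inv by (simp add: ret_pow_def)

lemma ret_pow_periodic: "ret_pow i (y + of_int j) = ret_pow i y + of_int j"
  unfolding ret_pow_def by (rule int_iterate_commute[symmetric]) (simp_all add: ret_periodic)

lemma smooth_ret_pow: "smooth_on UNIV (ret_pow j)"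
  unfolding ret_pow_def by (intro smooth_on_int_iterate smooth_ret)

lemma hol_ret: "hol S (ret y) = ret (hol S y)" "hol S (ret_inv y) = ret_inv (hol S y)"
  "hol_inv S (ret y) = ret (hol_inv S y)" "hol_inv S (ret_inv y) = ret_inv (hol_inv S y)"
  unfolding ret_def ret_inv_def by (metis hol_inv hol_commute)+

text \<open>The leaves are obtained by suspending the return map \<^const>\<open>ret\<close>: over \<open>0 \<le> x \<le> 1\<close> the
  leaf through \<open>(0, c)\<close> is the curve \<open>bend (ramp x) y = c\<close>.\<close>

definition bend :: "real \<Rightarrow> real \<Rightarrow> real" where
  "bend a y = y + a * (ret y - y)"

lemma bend_0 [simp]: "bend 0 y = y" and bend_1 [simp]: "bend 1 y = ret y"
  by (simp_all add: bend_def)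

lemma bend_periodic: "bend a (y + of_int j) = bend a y + of_int j"
  by (simp add: bend_def ret_periodic)

lemma strict_mono_bend:
  assumes "0 \<le> a" "a \<le> 1"
  shows "strict_mono (bend a)"
proof (rule strict_monoI)
  fix x y :: real assume "x < y"
  then have "ret x < ret y" using strict_mono_ret by (simp add: strict_mono_def)
  have "bend a y - bend a x = (1 - a) * (y - x) + a * (ret y - ret x)"
    by (simp add: bend_def algebra_simps)
  also have "\<dots> > 0"
  proof (cases "a = 0")
    case False
    then have "a * (ret y - ret x) > 0" "(1 - a) * (y - x) \<ge> 0"
      using assms \<open>x < y\<close> \<open>ret x < ret y\<close> by simp_all
    then show ?thesis by linarith
  qed (use \<open>x < y\<close> in simp)
  finally show "bend a x < bend a y" by simp
qed

lemma bend_fixed: "x \<le> 1/4 \<or> x \<ge> 3/4 \<Longrightarrow> 0 \<le> x \<Longrightarrow> x < 1 \<Longrightarrow> bend a (x + of_int j) = x + of_int j"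
  by (simp add: bend_def ret_fixed)

lemma continuous_on_bend: "continuous_on A (bend a)"
proof -
  have "continuous_on A ret"
    using smooth_on_imp_continuous_on[OF smooth_ret(1)] continuous_on_subset by blast
  then show ?thesis unfolding bend_def[abs_def] by (intro continuous_intros)
qed

definition unbend :: "real \<Rightarrow> real \<Rightarrow> real" where
  "unbend a = inv_into UNIV (bend a)"

lemma unbend:
  assumes "0 \<le> a" "a \<le> 1"
  shows "bend a (unbend a y) = y" "unbend a (bend a y) = y"
proof -
  have inj: "inj (bend a)" using strict_mono_bend[OF assms] by (rule strict_mono_imp_inj_on)
  have "bij (bend a)"
  proof (rule strict_mono_fixing_integers_bij)
    show "bend a (of_int j) = of_int j" for j using bend_fixed[of 0 a j] by simp
  qed (rule strict_mono_bend[OF assms] continuous_on_bend)+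
  then show "bend a (unbend a y) = y" "unbend a (bend a y) = y"
    by (simp_all add: unbend_def inj bij_is_surj surj_f_inv_f)
qed

lemma unbend_ramp: "bend (ramp x) (unbend (ramp x) y) = y" "unbend (ramp x) (bend (ramp x) y) = y"
  using ramp_bounds by (simp_all add: unbend)

lemma smooth_bend: "smooth_on UNIV (\<lambda>z. bend (ramp (fst z)) (snd z))"
  unfolding bend_def
  by (intro smooth_intros smooth_on_compose_UNIV[OF open_UNIV smooth_ramp]
      smooth_on_compose_UNIV[OF open_UNIV smooth_ret(1)] open_UNIV)

lemma smooth_unbend: "smooth_on UNIV (\<lambda>z. unbend (ramp (fst z)) (snd z))"
proof (rule smooth_on_fibrewise_inverse[OF smooth_bend])
  fix z :: "real \<times> real"
  let ?a = "ramp (fst z)" and ?G = "\<lambda>z. bend (ramp (fst z)) (snd z)"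
  obtain d1 where d1: "d1 > 0" "(hol UNIV has_real_derivative d1) (at (snd z))" using hol_deriv by blast
  obtain d2 where d2: "d2 > 0" "(hol UNIV has_real_derivative d2) (at (hol UNIV (snd z)))"
    using hol_deriv by blast
  have ret: "(ret has_real_derivative d2 * d1) (at (snd z))"
    unfolding ret_def[abs_def] by (rule DERIV_chain2[OF d2(2) d1(2)])
  define d where "d = 1 + ?a * (d2 * d1 - 1)"
  have A: "((\<lambda>y. bend ?a y) has_real_derivative d) (at (snd z))"
    unfolding bend_def d_def by (intro DERIV_add DERIV_ident DERIV_cmult DERIV_diff ret)
  have B: "((\<lambda>y. bend ?a y) has_derivative (\<lambda>v. frechet_derivative ?G (at z) (0, v))) (at (snd z))"
  proof -
    have "(?G has_derivative frechet_derivative ?G (at (fst z, snd z))) (at (fst z, snd z))"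
      using smooth_on_imp_differentiable[OF smooth_bend UNIV_I] by (rule iffD1[OF frechet_derivative_works])
    moreover have "((\<lambda>y. (fst z, y)) has_derivative (\<lambda>v. (0, v))) (at (snd z))"
      by (auto intro!: derivative_eq_intros)
    ultimately have "((\<lambda>y. ?G (fst z, y)) has_derivative
        (\<lambda>v. frechet_derivative ?G (at (fst z, snd z)) (0, v))) (at (snd z))"
      by (rule has_derivative_compose[rotated])
    then show ?thesis by simp
  qed
  have "frechet_derivative ?G (at z) (0, 1) = d * 1"
    by (rule fun_cong[OF has_derivative_unique[OF B A[unfolded has_field_derivative_def]]])
  moreover have "d > 0"
  proof -
    have d_eq: "d = (1 - ?a) + ?a * (d2 * d1)" by (simp add: d_def algebra_simps)
    show ?thesis
    proof (cases "?a = 0")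
      case False
      then have "?a * (d2 * d1) > 0" using ramp_bounds[of "fst z"] d1(1) d2(1) by simp
      then show ?thesis using ramp_bounds[of "fst z"] unfolding d_eq by linarith
    qed (simp add: d_eq)
  qed
  ultimately show "frechet_derivative ?G (at z) (0, 1) \<noteq> 0" by simp
qed (simp_all add: unbend_ramp)

text \<open>A first integral of the lifted foliation on the plane.\<close>

definition leaf_coord :: "real \<times> real \<Rightarrow> real" where
  "leaf_coord z = ret_pow \<lfloor>fst z\<rfloor> (bend (ramp (frac (fst z))) (snd z))"

lemma leaf_coord_lattice: "leaf_coord (z + lattice_vec i n) = ret_pow i (leaf_coord z) + of_int n"
proof -
  have "\<lfloor>fst z + of_int i\<rfloor> = i + \<lfloor>fst z\<rfloor>" by simp
  moreover have "frac (fst z + of_int i) = frac (fst z)" by (simp add: frac_def)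
  ultimately show ?thesis
    by (simp only: leaf_coord_def fst_add snd_add fst_conv snd_conv bend_periodic ret_pow_periodic ret_pow_add)
qed

text \<open>To the left of \<open>0\<close> the iterate \<open>ret_pow (- 1)\<close> cancels the full turn \<open>bend 1 = ret\<close>, in agreement
  with \<open>ramp\<close> being \<open>0\<close> there.\<close>

lemma leaf_coord_basic:
  assumes "-1/3 < x" "x < 1"
  shows "leaf_coord (x, y) = bend (ramp x) y"
proof (cases "x \<ge> 0")
  case True
  then have "\<lfloor>x\<rfloor> = 0" "frac x = x" using assms by (auto simp: floor_eq_iff frac_eq)
  then show ?thesis by (simp add: leaf_coord_def)
next
  case False
  then have fl: "\<lfloor>x\<rfloor> = -1" using assms by (auto simp: floor_eq_iff)
  then have "frac x \<ge> 2/3" using assms by (simp add: frac_def)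
  then have "leaf_coord (x, y) = ret_pow (- 1) (ret_pow 1 y)"
    by (simp add: leaf_coord_def fl ramp_1 ret_pow_1)
  also have "\<dots> = y" by (rule ret_pow_inverse)
  finally show ?thesis using False by (simp add: ramp_0)
qed

lemma leaf_coord_local:
  assumes "of_int j - 1/3 < x" "x < of_int j + 1"
  shows "leaf_coord (x, y) = ret_pow j (bend (ramp (x - of_int j)) y)"
  using leaf_coord_lattice[of "(x - of_int j, y)" j 0] leaf_coord_basic[of "x - of_int j" y] assms by simp

lemma leaf_coord_0: "leaf_coord (0, c) = c"
  by (simp add: leaf_coord_basic ramp_0)

lemma floor_window: "of_int \<lfloor>x\<rfloor> - 1/3 < x" "x < of_int \<lfloor>x\<rfloor> + (1::real)"
  by linarith+

lemma open_window: "open ({of_int j - 1/3 <..< of_int j + (1::real)} \<times> (UNIV :: real set))" for j :: int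
  by (intro open_Times) auto

lemma smooth_leaf_coord: "smooth_on UNIV leaf_coord"
proof (rule smooth_on_local)
  fix z :: "real \<times> real"
  define j where "j = \<lfloor>fst z\<rfloor>"
  let ?W = "{of_int j - 1/3 <..< of_int j + 1} \<times> (UNIV :: real set)"
  let ?g = "\<lambda>w. ret_pow j (bend (ramp (fst (w - lattice_vec j 0))) (snd (w - lattice_vec j 0)))"
  have "smooth_on ?W ?g"
    by (intro smooth_on_compose_UNIV[OF open_window smooth_ret_pow] smooth_on_compose_UNIV[OF open_window smooth_bend]
        smooth_intros open_window)
  moreover have "z \<in> ?W" using floor_window[of "fst z"] by (cases z) (simp add: j_def)
  moreover have "\<forall>w\<in>?W. leaf_coord w = ?g w" by (auto simp: leaf_coord_local)
  ultimately show "\<exists>W g. open W \<and> z \<in> W \<and> smooth_on W g \<and> (\<forall>w\<in>W. leaf_coord w = g w)"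
    using open_window by (intro exI[of _ ?W] exI[of _ ?g]) blast
qed

lemma continuous_on_leaf_coord: "continuous_on A leaf_coord"
  using smooth_on_imp_continuous_on[OF smooth_leaf_coord] continuous_on_subset by blast

definition leaf_point :: "real \<Rightarrow> real \<Rightarrow> real \<times> real" where
  "leaf_point c x = (x, unbend (ramp (frac x)) (ret_pow (- \<lfloor>x\<rfloor>) c))"

lemma leaf_coord_leaf_point: "leaf_coord (leaf_point c x) = c"
  by (simp add: leaf_point_def leaf_coord_def unbend_ramp ret_pow_inverse)

lemma leaf_point_unique: "leaf_coord z = c \<Longrightarrow> leaf_point c (fst z) = z"
  by (cases z) (auto simp: leaf_point_def leaf_coord_def unbend_ramp ret_pow_inverse)

lemma continuous_on_leaf_point: "continuous_on UNIV (leaf_point c)"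
proof -
  have "isCont (leaf_point c) x" for x
  proof -
    define j where "j = \<lfloor>x\<rfloor>"
    let ?W = "{of_int j - 1/3 <..< of_int j + (1::real)}"
    have eq: "leaf_point c y = (y, unbend (ramp (fst (y - of_int j, ret_pow (- j) c))) (snd (y - of_int j, ret_pow (- j) c)))"
      if "y \<in> ?W" for y
    proof -
      have "leaf_coord (y, unbend (ramp (y - of_int j)) (ret_pow (- j) c)) = c"
      proof -
        have "of_int j - 1/3 < y" "y < of_int j + 1" using that by simp_all
        from leaf_coord_local[OF this] show ?thesis by (simp only: unbend_ramp ret_pow_inverse)
      qed
      from leaf_point_unique[OF this] show ?thesis by simp
    qed
    have "continuous_on ?W (\<lambda>y. (y, unbend (ramp (fst (y - of_int j, ret_pow (- j) c))) (snd (y - of_int j, ret_pow (- j) c))))"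
      by (intro continuous_on_Pair continuous_on_id
          continuous_on_compose2[OF smooth_on_imp_continuous_on[OF smooth_unbend], of _ "\<lambda>y. (y - of_int j, ret_pow (- j) c)"]
          continuous_intros) auto
    then have "continuous_on ?W (leaf_point c)"
      by (rule continuous_on_eq) (simp only: eq)
    then show ?thesis
      using floor_window[of x] by (intro continuous_on_interior) (auto simp: j_def interior_open)
  qed
  then show ?thesis by (simp add: continuous_on_eq_continuous_at)
qed

definition orbit_related :: "real \<Rightarrow> real \<Rightarrow> bool" where
  "orbit_related c d \<longleftrightarrow> (\<exists>j n. d = ret_pow j c + of_int n)"

lemma orbit_related_refl: "orbit_related c c"
  unfolding orbit_related_def by (intro exI[of _ 0]) simp

lemma orbit_related_trans: "orbit_related b c \<Longrightarrow> orbit_related c d \<Longrightarrow> orbit_related b d"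
proof -
  assume "orbit_related b c" "orbit_related c d"
  then obtain i l j n where "c = ret_pow i b + of_int l" "d = ret_pow j c + of_int n"
    unfolding orbit_related_def by (elim exE)
  then have "d = ret_pow (j + i) b + of_int (l + n)" by (simp add: ret_pow_periodic ret_pow_add)
  then show ?thesis unfolding orbit_related_def by blast
qed

lemma orbit_related_sym: "orbit_related c d \<Longrightarrow> orbit_related d c"
proof -
  assume "orbit_related c d"
  then obtain j n where "d = ret_pow j c + of_int n" unfolding orbit_related_def by (elim exE)
  then have "ret_pow (- j) d = c + of_int n"
    by (simp only: ret_pow_periodic ret_pow_inverse)
  then have "c = ret_pow (- j) d + of_int (- n)" unfolding of_int_minus by linarith
  then show ?thesis unfolding orbit_related_def by (intro exI)
qed

lemma orbit_related_same_point:
  "torus_cover z = torus_cover w \<Longrightarrow> orbit_related (leaf_coord z) (leaf_coord w)"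
proof -
  assume "torus_cover z = torus_cover w"
  then obtain i n where "w = z + lattice_vec i n" using torus_cover_periodic[of w z] by auto
  then have "leaf_coord w = ret_pow i (leaf_coord z) + of_int n" by (simp only: leaf_coord_lattice)
  then show ?thesis unfolding orbit_related_def by (intro exI)
qed

end

context twisted_strips
begin

definition straighten :: "real \<times> real \<Rightarrow> real \<times> real" where
  "straighten z = (fst z, bend (ramp (fst z)) (snd z))"

definition unstraighten :: "real \<times> real \<Rightarrow> real \<times> real" where
  "unstraighten z = (fst z, unbend (ramp (fst z)) (snd z))"

lemma straighten:
  "smooth_on UNIV straighten" "smooth_on UNIV unstraighten"
  "straighten (unstraighten z) = z" "unstraighten (straighten z) = z"
  unfolding straighten_def[abs_def] unstraighten_def[abs_def]
  by (intro smooth_on_Pair open_UNIV smooth_on_fst smooth_on_ident smooth_bend smooth_unbend)+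
    (simp_all add: unbend_ramp)

text \<open>Two overlapping intervals cover the circle in either direction; the vertical ones end at fixed
  points of the return map, so that the charts still have squares as images.\<close>

definition foliated_charts :: "(complex \<times> complex, real \<times> real) chart set" where
  "foliated_charts = {(torus_cover ` square a b, straighten \<circ> inv_into (square a b) torus_cover) | a b.
     (a = 0 \<or> a = -1/3) \<and> (b = 0 \<or> b = 3/4)}"

definition horizontal :: "(real \<times> real) set" where
  "horizontal = {v. snd v = 0}"

lemma foliated_charts_cases:
  assumes "(U, \<phi>) \<in> foliated_charts"
  obtains a b where "a = 0 \<or> a = -1/3" "b = 0 \<or> b = 3/4" "U = torus_cover ` square a b"
    "\<phi> = straighten \<circ> inv_into (square a b) torus_cover"
  using assms unfolding foliated_charts_def by (elim CollectE exE conjE) (rule that, simp_all only: prod.inject)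

lemma foliated_chartsI:
  "a = 0 \<or> a = -1/3 \<Longrightarrow> b = 0 \<or> b = 3/4 \<Longrightarrow>
     (torus_cover ` square a b, straighten \<circ> inv_into (square a b) torus_cover) \<in> foliated_charts"
  unfolding foliated_charts_def by (intro CollectI exI[of _ a] exI[of _ b] conjI refl)

lemma straightened_chart_apply:
  "z \<in> square a b \<Longrightarrow> (straighten \<circ> inv_into (square a b) torus_cover) (torus_cover z) = straighten z"
  by (simp only: o_apply inv_cover_square)

lemma leaf_coord_square:
  assumes "a = 0 \<or> a = -1/3" "z \<in> square a b"
  shows "snd (straighten z) = leaf_coord z"
proof -
  have "-1/3 < fst z" "fst z < 1" using assms by auto
  from leaf_coord_basic[OF this, of "snd z"] show ?thesis by (simp add: straighten_def)
qed

lemma squares_cover: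
  obtains a b i n where "a = 0 \<or> a = -1/3" "b = 0 \<or> b = 3/4" "z + lattice_vec i n \<in> square a b"
proof -
  have 1: "\<exists>a i. (a = 0 \<or> a = -1/3) \<and> x + of_int i \<in> {a<..<a+1}" for x :: real
  proof (cases "frac x = 0")
    case True
    then show ?thesis by (intro exI[of _ "-1/3"] exI[of _ "- \<lfloor>x\<rfloor>"]) (simp add: frac_def)
  next
    case False
    then have "frac x > 0" "frac x < 1" using frac_ge_0[of x] frac_lt_1[of x] by linarith+
    then show ?thesis by (intro exI[of _ 0] exI[of _ "- \<lfloor>x\<rfloor>"]) (simp add: frac_def)
  qed
  have 2: "\<exists>b i. (b = 0 \<or> b = 3/4) \<and> x + of_int i \<in> {b<..<b+1}" for x :: real
  proof (cases "frac x = 0")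
    case True
    then show ?thesis by (intro exI[of _ "3/4"] exI[of _ "1 - \<lfloor>x\<rfloor>"]) (simp add: frac_def)
  next
    case False
    then have "frac x > 0" "frac x < 1" using frac_ge_0[of x] frac_lt_1[of x] by linarith+
    then show ?thesis by (intro exI[of _ 0] exI[of _ "- \<lfloor>x\<rfloor>"]) (simp add: frac_def)
  qed
  obtain a i where a: "a = 0 \<or> a = -1/3" "fst z + of_int i \<in> {a<..<a+1}" using 1 by blast
  obtain b n where b: "b = 0 \<or> b = 3/4" "snd z + of_int n \<in> {b<..<b+1}" using 2 by blast
  have "z + lattice_vec i n \<in> square a b" using a(2) b(2) by (cases z) simp
  with a(1) b(1) show ?thesis by (rule that)
qed

lemma straighten_square:
  assumes b: "b = 0 \<or> b = 3/4"
  shows "straighten ` square a b = square a b"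
proof -
  have fixed: "bend t b = b" "bend t (b + 1) = b + 1" for t
    using b bend_fixed[of b t 0] bend_fixed[of b t 1] by auto
  have iff: "bend (ramp x) y \<in> {b<..<b+1} \<longleftrightarrow> y \<in> {b<..<b+1}" for x y
  proof -
    note mono = strict_mono_less[OF strict_mono_bend[OF ramp_bounds(1)[of x] ramp_bounds(2)[of x]]]
    show ?thesis using mono[of b y] mono[of y "b + 1"] by (simp add: fixed)
  qed
  show ?thesis
  proof (intro equalityI subsetI)
    fix w assume "w \<in> straighten ` square a b"
    then obtain z where "z \<in> square a b" "w = straighten z" by (rule imageE)
    then show "w \<in> square a b" using iff by (cases z) (simp add: straighten_def)
  next
    fix w assume "w \<in> square a b"
    then have "unstraighten w \<in> square a b"
      using iff[of "fst w" "unbend (ramp (fst w)) (snd w)"]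
      by (cases w) (simp add: unstraighten_def unbend_ramp)
    then show "w \<in> straighten ` square a b"
      by (rule rev_image_eqI) (simp only: straighten)
  qed
qed

lemma foliated_chart_image:
  "(straighten \<circ> inv_into (square a b) torus_cover) ` torus_cover ` square a b = straighten ` square a b"
  unfolding image_image by (intro image_cong refl straightened_chart_apply)

lemma foliated_atlas_suspension: "foliated_atlas torus torus_atlas horizontal foliated_charts"
  unfolding foliated_atlas_def
proof (intro conjI)
  show "subspace horizontal" by (auto simp: horizontal_def subspace_def)
  show "foliated_charts \<subseteq> smooth_charts torus torus_atlas"
  proof
    fix c assume "c \<in> foliated_charts"
    then have "(fst c, snd c) \<in> foliated_charts" by simp
    then obtain a b where "fst c = torus_cover ` square a b" "snd c = straighten \<circ> inv_into (square a b) torus_cover"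
      by (rule foliated_charts_cases)
    then have "c = (torus_cover ` square a b, straighten \<circ> inv_into (square a b) torus_cover)"
      by (intro prod_eqI) (simp_all only: fst_conv snd_conv)
    then show "c \<in> smooth_charts torus torus_atlas"
      using straightened_chart[OF straighten] by (simp only:)
  qed
  show "(\<Union>(U, \<phi>)\<in>foliated_charts. U) = topspace torus"
  proof (intro equalityI subsetI)
    fix p assume "p \<in> (\<Union>(U, \<phi>)\<in>foliated_charts. U)"
    then obtain U \<phi> where "(U, \<phi>) \<in> foliated_charts" "p \<in> U" by blast
    then obtain a b where "p \<in> torus_cover ` square a b" by (elim foliated_charts_cases) (simp only:)
    then obtain z where "p = torus_cover z" by (rule imageE)
    then show "p \<in> topspace torus" using torus_cover_in_torus by (simp only:)
  next
    fix p assume "p \<in> topspace torus"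
    then obtain z where z: "p = torus_cover z" by (rule torus_cover_surj)
    obtain a b i n where ab: "a = 0 \<or> a = -1/3" "b = 0 \<or> b = 3/4" "z + lattice_vec i n \<in> square a b"
      by (rule squares_cover)
    have "(torus_cover ` square a b, straighten \<circ> inv_into (square a b) torus_cover) \<in> foliated_charts"
      by (rule foliated_chartsI[OF ab(1,2)])
    moreover have "p \<in> torus_cover ` square a b"
      using imageI[OF ab(3), of torus_cover] by (simp only: z torus_cover_lattice)
    ultimately show "p \<in> (\<Union>(U, \<phi>)\<in>foliated_charts. U)" by blast
  qed
  have "convex (\<phi> ` U)" if "(U, \<phi>) \<in> foliated_charts" for U \<phi>
    using that
  proof (rule foliated_charts_cases)
    fix a b assume "b = 0 \<or> b = 3/4" "U = torus_cover ` square a b"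
      "\<phi> = straighten \<circ> inv_into (square a b) torus_cover"
    then have "\<phi> ` U = square a b" by (simp only: foliated_chart_image straighten_square)
    then show ?thesis by (simp add: convex_Times)
  qed
  then show "\<forall>(U, \<phi>)\<in>foliated_charts. convex (\<phi> ` U)" by blast
  have "\<exists>W. openin torus W \<and> p \<in> W \<and> W \<subseteq> U \<inter> V \<and>
      (\<forall>y\<in>W. \<forall>z\<in>W. \<phi> y - \<phi> z \<in> horizontal \<longrightarrow> \<psi> y - \<psi> z \<in> horizontal)"
    if U: "(U, \<phi>) \<in> foliated_charts" and V: "(V, \<psi>) \<in> foliated_charts" and p: "p \<in> U \<inter> V" for U \<phi> V \<psi> p
  proof -
    obtain a b where ab: "a = 0 \<or> a = -1/3" "U = torus_cover ` square a b"
      "\<phi> = straighten \<circ> inv_into (square a b) torus_cover" using U by (rule foliated_charts_cases)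
    obtain a' b' where ab': "a' = 0 \<or> a' = -1/3" "V = torus_cover ` square a' b'"
      "\<psi> = straighten \<circ> inv_into (square a' b') torus_cover" using V by (rule foliated_charts_cases)
    have "p \<in> torus_cover ` square a b" using p by (simp only: ab(2) Int_iff)
    then obtain z where z: "p = torus_cover z" "z \<in> square a b" by (rule imageE)
    note z = z(2,1)
    have "torus_cover z \<in> torus_cover ` square a' b'" using p by (simp only: z(2) ab'(2) Int_iff)
    from local_chart_lift[OF this] obtain i n W where W: "open W" "z \<in> W" "\<And>w. w \<in> W \<Longrightarrow> w + lattice_vec i n \<in> square a' b'"
      "\<And>w. w \<in> W \<Longrightarrow> inv_into (square a' b') torus_cover (torus_cover w) = w + lattice_vec i n"
      by metis
    let ?W = "torus_cover ` (W \<inter> square a b)"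
    have sub: "?W \<subseteq> U \<inter> V"
    proof
      fix q assume "q \<in> ?W"
      then obtain w where w: "w \<in> W" "w \<in> square a b" "q = torus_cover w" by blast
      have "q = torus_cover (w + lattice_vec i n)" by (simp only: w(3) torus_cover_lattice)
      then have "q \<in> V" using W(3)[OF w(1)] by (simp only: ab'(2) image_eqI)
      moreover have "q \<in> U" using w(2,3) by (simp only: ab(2) image_eqI)
      ultimately show "q \<in> U \<inter> V" by (rule IntI[rotated])
    qed
    have op: "openin torus ?W"
      by (rule openin_cover_image[of _ a b]) (intro open_Int W(1) open_square, rule Int_lower2)
    have "\<psi> (torus_cover v) - \<psi> (torus_cover w) \<in> horizontal"
      if vw: "v \<in> W \<inter> square a b" "w \<in> W \<inter> square a b" "\<phi> (torus_cover v) - \<phi> (torus_cover w) \<in> horizontal" for v w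
    proof -
      have "leaf_coord v = leaf_coord w"
        using vw(3) straightened_chart_apply[of v a b] straightened_chart_apply[of w a b] vw(1,2)
          leaf_coord_square[OF ab(1), of v b] leaf_coord_square[OF ab(1), of w b]
        by (simp add: ab(3) horizontal_def del: o_apply)
      moreover have "\<psi> (torus_cover u) = straighten (u + lattice_vec i n)" if "u \<in> W" for u
        using W(4)[OF that] by (simp add: ab'(3))
      moreover have "snd (straighten (u + lattice_vec i n)) = ret_pow i (leaf_coord u) + of_int n" if "u \<in> W" for u
        using leaf_coord_square[OF ab'(1) W(3)[OF that]] by (simp only: leaf_coord_lattice)
      ultimately show ?thesis using vw(1,2) by (simp add: horizontal_def)
    qed
    then have "\<forall>y\<in>?W. \<forall>z\<in>?W. \<phi> y - \<phi> z \<in> horizontal \<longrightarrow> \<psi> y - \<psi> z \<in> horizontal"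
      by (simp only: ball_simps) simp
    moreover have "p \<in> ?W" unfolding z(2) using z(1) W(2) by (intro imageI IntI)
    ultimately show ?thesis using op sub by (intro exI[of _ ?W] conjI)
  qed
  then show "\<forall>(U, \<phi>)\<in>foliated_charts. \<forall>(V, \<psi>)\<in>foliated_charts. \<forall>p\<in>U \<inter> V. \<exists>W. openin torus W \<and> p \<in> W \<and>
     W \<subseteq> U \<inter> V \<and> (\<forall>y\<in>W. \<forall>z\<in>W. \<phi> y - \<phi> z \<in> horizontal \<longrightarrow> \<psi> y - \<psi> z \<in> horizontal)"
    by blast
qed

abbreviation plaque_rel :: "((complex \<times> complex) \<times> complex \<times> complex) set" where
  "plaque_rel \<equiv> same_plaque horizontal foliated_charts"

lemma same_plaqueI:
  assumes "a = 0 \<or> a = -1/3" "b = 0 \<or> b = 3/4" "z \<in> square a b" "w \<in> square a b"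
    and "leaf_coord z = leaf_coord w"
  shows "(torus_cover z, torus_cover w) \<in> plaque_rel"
proof -
  let ?U = "torus_cover ` square a b" and ?\<phi> = "straighten \<circ> inv_into (square a b) torus_cover"
  have "(?U, ?\<phi>) \<in> foliated_charts" by (rule foliated_chartsI[OF assms(1,2)])
  moreover have "?\<phi> (torus_cover z) - ?\<phi> (torus_cover w) \<in> horizontal"
    unfolding straightened_chart_apply[OF assms(3)] straightened_chart_apply[OF assms(4)]
    using leaf_coord_square[OF assms(1,3)] leaf_coord_square[OF assms(1,4)] assms(5)
    by (simp add: horizontal_def)
  ultimately show ?thesis
    unfolding same_plaque_def using imageI[OF assms(3), of torus_cover] imageI[OF assms(4), of torus_cover]
    by (intro CollectI case_prodI bexI[of _ "(?U, ?\<phi>)"] conjI) auto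
qed

lemma same_plaque_orbit_related:
  assumes "(p, q) \<in> plaque_rel"
  shows "\<exists>z w. p = torus_cover z \<and> q = torus_cover w \<and> orbit_related (leaf_coord z) (leaf_coord w)"
proof -
  obtain U \<phi> where U: "(U, \<phi>) \<in> foliated_charts" "p \<in> U" "q \<in> U" "\<phi> p - \<phi> q \<in> horizontal"
    using assms unfolding same_plaque_def by blast
  obtain a b where ab: "a = 0 \<or> a = -1/3" "U = torus_cover ` square a b"
      "\<phi> = straighten \<circ> inv_into (square a b) torus_cover" using U(1) by (rule foliated_charts_cases)
  from U(2,3) have "p \<in> torus_cover ` square a b" "q \<in> torus_cover ` square a b" by (simp_all only: ab(2))
  then obtain z w where z: "z \<in> square a b" "p = torus_cover z" and w: "w \<in> square a b" "q = torus_cover w"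
    by (elim imageE)
  have "leaf_coord z = leaf_coord w"
    using U(4) leaf_coord_square[OF ab(1) z(1)] leaf_coord_square[OF ab(1) w(1)]
    unfolding ab(3) z(2) w(2) straightened_chart_apply[OF z(1)] straightened_chart_apply[OF w(1)]
    by (simp add: horizontal_def)
  then show ?thesis using z(2) w(2) orbit_related_refl by metis
qed

lemma plaque_chain_orbit_related:
  assumes "(torus_cover z, torus_cover w) \<in> plaque_rel\<^sup>+"
  shows "orbit_related (leaf_coord z) (leaf_coord w)"
proof -
  have "\<forall>w. q = torus_cover w \<longrightarrow> orbit_related (leaf_coord z) (leaf_coord w)"
    if "(torus_cover z, q) \<in> plaque_rel\<^sup>+" for q
    using that
  proof (induction rule: trancl_induct)
    case (base q)
    then obtain u v where "torus_cover z = torus_cover u" "q = torus_cover v"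
      "orbit_related (leaf_coord u) (leaf_coord v)" using same_plaque_orbit_related by blast
    then show ?case using orbit_related_same_point orbit_related_trans by metis
  next
    case (step q q')
    then obtain u v where "q = torus_cover u" "q' = torus_cover v"
      "orbit_related (leaf_coord u) (leaf_coord v)" using same_plaque_orbit_related by blast
    then show ?case using step.IH orbit_related_same_point orbit_related_trans by metis
  qed
  then show ?thesis using assms by blast
qed

text \<open>Being joined by a chain of plaques is an equivalence relation with open classes on the
  connected curve \<open>leaf_point c\<close>.\<close>

lemma plaque_chain_along_leaf:
  "(torus_cover (leaf_point c x), torus_cover (leaf_point c x')) \<in> plaque_rel\<^sup>+"
proof (rule connected_equivalence_relation[of UNIV x x'
      "\<lambda>x x'. (torus_cover (leaf_point c x), torus_cover (leaf_point c x')) \<in> plaque_rel\<^sup>+"])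
  have "sym plaque_rel"
    unfolding sym_def same_plaque_def
  proof (intro allI impI, elim CollectE case_prodE bexE, clarify)
    fix p q U \<phi> assume *: "(U, \<phi>) \<in> foliated_charts" "p \<in> U" "q \<in> U" "\<phi> p - \<phi> q \<in> horizontal"
    then have "\<phi> q - \<phi> p \<in> horizontal" by (simp add: horizontal_def)
    with * show "\<exists>(U, \<phi>)\<in>foliated_charts. q \<in> U \<and> p \<in> U \<and> \<phi> q - \<phi> p \<in> horizontal" by blast
  qed
  then show "(torus_cover (leaf_point c y), torus_cover (leaf_point c x)) \<in> plaque_rel\<^sup>+"
    if "(torus_cover (leaf_point c x), torus_cover (leaf_point c y)) \<in> plaque_rel\<^sup>+" for x y
    using that sym_trancl symD by metis
  fix x0 :: real
  obtain a b i n where ab: "a = 0 \<or> a = -1/3" "b = 0 \<or> b = 3/4" "leaf_point c x0 + lattice_vec i n \<in> square a b"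
    by (rule squares_cover)
  let ?N = "(\<lambda>x. leaf_point c x + lattice_vec i n) -` square a b"
  have "open ?N"
    by (intro open_vimage open_square continuous_on_add continuous_on_leaf_point continuous_on_const)
  moreover have "(torus_cover (leaf_point c x0), torus_cover (leaf_point c x)) \<in> plaque_rel\<^sup>+" if "x \<in> ?N" for x
  proof -
    have "(torus_cover (leaf_point c x0 + lattice_vec i n), torus_cover (leaf_point c x + lattice_vec i n)) \<in> plaque_rel"
      using that by (intro same_plaqueI[OF ab]) (simp_all only: leaf_coord_lattice leaf_coord_leaf_point vimage_eq)
    then show ?thesis unfolding torus_cover_lattice by (rule r_into_trancl)
  qed
  ultimately show "\<exists>T. openin (top_of_set UNIV) T \<and> x0 \<in> T \<and>
      (\<forall>x\<in>T. (torus_cover (leaf_point c x0), torus_cover (leaf_point c x)) \<in> plaque_rel\<^sup>+)"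
    using ab(3) by (intro exI[of _ ?N]) simp
qed (auto intro: trancl_trans)

lemma plaque_chain_iff:
  "(torus_cover z, torus_cover w) \<in> plaque_rel\<^sup>+ \<longleftrightarrow> orbit_related (leaf_coord z) (leaf_coord w)"
proof
  assume "orbit_related (leaf_coord z) (leaf_coord w)"
  then obtain i n where "leaf_coord w = leaf_coord (z + lattice_vec i n)"
    unfolding orbit_related_def leaf_coord_lattice by auto
  then have "leaf_point (leaf_coord w) (fst (z + lattice_vec i n)) = z + lattice_vec i n"
     "leaf_point (leaf_coord w) (fst w) = w" by (metis leaf_point_unique)+
  then have "(torus_cover (z + lattice_vec i n), torus_cover w) \<in> plaque_rel\<^sup>+"
    using plaque_chain_along_leaf by metis
  then show "(torus_cover z, torus_cover w) \<in> plaque_rel\<^sup>+" by (simp only: torus_cover_lattice)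
qed (rule plaque_chain_orbit_related)

definition suspension :: "(complex \<times> complex) set set" where
  "suspension = leaves torus horizontal foliated_charts"

lemma smooth_foliation_suspension: "smooth_foliation torus torus_atlas suspension"
  unfolding smooth_foliation_def suspension_def using foliated_atlas_suspension by blast

definition leaf :: "real \<times> real \<Rightarrow> (complex \<times> complex) set" where
  "leaf z = {torus_cover w | w. orbit_related (leaf_coord z) (leaf_coord w)}"

lemma plaque_rel_image: "plaque_rel\<^sup>+ `` {torus_cover z} = leaf z"
proof (intro equalityI subsetI)
  fix q assume "q \<in> plaque_rel\<^sup>+ `` {torus_cover z}"
  then have q: "(torus_cover z, q) \<in> plaque_rel\<^sup>+" by blast
  then obtain p where "(p, q) \<in> plaque_rel" by (metis tranclE)
  then obtain w where "q = torus_cover w" using same_plaque_orbit_related by blast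
  then show "q \<in> leaf z" using q plaque_chain_iff unfolding leaf_def by blast
next
  fix q assume "q \<in> leaf z"
  then show "q \<in> plaque_rel\<^sup>+ `` {torus_cover z}" using plaque_chain_iff unfolding leaf_def by blast
qed

lemma suspension_eq: "suspension = range leaf"
proof -
  have "suspension = (\<lambda>p. plaque_rel\<^sup>+ `` {p}) ` topspace torus"
    unfolding suspension_def leaves_def quotient_def by blast
  also have "topspace torus = range torus_cover"
    using torus_cover_in_torus by (auto elim: torus_cover_surj simp del: split_paired_All)
  finally show ?thesis by (simp only: image_image plaque_rel_image)
qed

lemma same_leaf_image_related:
  assumes "f \<in> foliation_diffeos torus torus_atlas suspension" "\<And>z. torus_cover (F z) = f (torus_cover z)"
    and "orbit_related (leaf_coord z) (leaf_coord w)"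
  shows "orbit_related (leaf_coord (F z)) (leaf_coord (F w))"
proof -
  have "f ` leaf z \<in> suspension"
    using assms(1) suspension_eq unfolding foliation_diffeos_def by blast
  then obtain u where u: "f ` leaf z = leaf u" using suspension_eq by blast
  have "torus_cover z \<in> leaf z" "torus_cover w \<in> leaf z"
    using assms(3) orbit_related_refl unfolding leaf_def by blast+
  then have "torus_cover (F z) \<in> leaf u" "torus_cover (F w) \<in> leaf u"
    using u assms(2) by (metis imageI)+
  then have "orbit_related (leaf_coord u) (leaf_coord (F z))" "orbit_related (leaf_coord u) (leaf_coord (F w))"
    unfolding leaf_def using orbit_related_same_point orbit_related_trans by (clarify, metis)+
  then show ?thesis using orbit_related_trans orbit_related_sym by blast
qed

lemma countable_orbit: "countable {d. orbit_related c d}"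
proof -
  have "{d. orbit_related c d} = (\<lambda>(j, n). ret_pow j c + of_int n) ` UNIV"
    unfolding orbit_related_def by auto
  then show ?thesis by simp
qed

text \<open>Along a leaf of the lifted foliation the image moves continuously but within countably many
  leaves, hence within one.\<close>

lemma lift_preserves_leaf_coord:
  assumes "f \<in> foliation_diffeos torus torus_atlas suspension" "\<And>z. torus_cover (F z) = f (torus_cover z)"
    and F: "continuous_on UNIV F" and eq: "leaf_coord z = leaf_coord w"
  shows "leaf_coord (F z) = leaf_coord (F w)"
proof (rule ccontr)
  assume ne: "leaf_coord (F z) \<noteq> leaf_coord (F w)"
  define c where "c = leaf_coord z"
  let ?v = "\<lambda>x. leaf_coord (F (leaf_point c x))"
  have "connected (range ?v)"
    by (intro connected_continuous_image connected_UNIV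
        continuous_on_compose2[OF continuous_on_leaf_coord[of UNIV]] continuous_on_compose2[OF F]
        continuous_on_leaf_point subset_UNIV)
  moreover have "leaf_point c (fst z) = z" "leaf_point c (fst w) = w"
    using eq by (simp_all add: c_def leaf_point_unique)
  then have "leaf_coord (F z) \<in> range ?v" "leaf_coord (F w) \<in> range ?v" by (metis rangeI)+
  ultimately have "uncountable (range ?v)" using ne by (rule connected_uncountable)
  moreover have "range ?v \<subseteq> {d. orbit_related (leaf_coord (F z)) d}"
  proof clarify
    fix x
    show "orbit_related (leaf_coord (F z)) (?v x)"
      by (rule same_leaf_image_related[OF assms(1,2)]) (simp add: leaf_coord_leaf_point c_def orbit_related_refl)
  qed
  ultimately show False using countable_orbit countable_subset by blast
qed

section \<open>Uncountably many foliation preserving diffeomorphisms\<close>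

text \<open>The map that keeps the first coordinate and acts on the leaves of the lifted foliation by \<open>u\<close>.\<close>

definition fibre_map :: "(real \<Rightarrow> real) \<Rightarrow> real \<times> real \<Rightarrow> real \<times> real" where
  "fibre_map u z = leaf_point (u (leaf_coord z)) (fst z)"

lemma leaf_coord_fibre_map: "leaf_coord (fibre_map u z) = u (leaf_coord z)"
  by (simp add: fibre_map_def leaf_coord_leaf_point)

lemma fst_fibre_map: "fst (fibre_map u z) = fst z"
  by (simp add: fibre_map_def leaf_point_def)

lemma leaf_coord_eqD: "leaf_coord z = leaf_coord w \<Longrightarrow> fst z = fst w \<Longrightarrow> z = w"
  by (metis leaf_point_unique)

lemma fibre_map_inverse: "(\<And>y. u (v y) = y) \<Longrightarrow> fibre_map u (fibre_map v z) = z"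
  by (rule leaf_coord_eqD) (simp_all add: leaf_coord_fibre_map fst_fibre_map)

lemma ret_pow_commute:
  assumes "\<And>y. u (ret y) = ret (u y)" "\<And>y. u (ret_inv y) = ret_inv (u y)"
  shows "u (ret_pow j y) = ret_pow j (u y)"
  unfolding ret_pow_def by (rule int_iterate_commute) (rule assms)+

lemma fibre_map_lattice:
  assumes "\<And>y j. u (y + of_int j) = u y + of_int j"
    and "\<And>y. u (ret y) = ret (u y)" "\<And>y. u (ret_inv y) = ret_inv (u y)"
  shows "fibre_map u (z + lattice_vec i n) = fibre_map u z + lattice_vec i n"
  by (rule leaf_coord_eqD)
    (simp_all only: leaf_coord_fibre_map leaf_coord_lattice assms(1) ret_pow_commute[of u, OF assms(2,3)]
      fst_fibre_map fst_add)

lemma smooth_fibre_map: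
  assumes u: "smooth_on UNIV u" and "\<And>y. u (ret y) = ret (u y)" "\<And>y. u (ret_inv y) = ret_inv (u y)"
  shows "smooth_on UNIV (fibre_map u)"
proof (rule smooth_on_local)
  fix z :: "real \<times> real"
  define j where "j = \<lfloor>fst z\<rfloor>"
  let ?W = "{of_int j - 1/3 <..< of_int j + 1} \<times> (UNIV :: real set)"
  let ?b = "\<lambda>w. u (bend (ramp (fst (w - lattice_vec j 0))) (snd (w - lattice_vec j 0)))"
  let ?g = "\<lambda>w. (fst w, unbend (ramp (fst (fst (w - lattice_vec j 0), ?b w))) (snd (fst (w - lattice_vec j 0), ?b w)))"
  have b: "smooth_on ?W ?b"
    by (intro smooth_on_compose_UNIV[OF open_window u] smooth_on_compose_UNIV[OF open_window smooth_bend]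
        smooth_intros open_window)
  have "smooth_on ?W ?g"
    by (intro smooth_on_Pair smooth_on_compose_UNIV[OF open_window smooth_unbend] b
        smooth_intros open_window)
  moreover have "z \<in> ?W" using floor_window[of "fst z"] by (cases z) (simp add: j_def)
  moreover have "fibre_map u w = ?g w" if "w \<in> ?W" for w
  proof (rule leaf_coord_eqD)
    have w: "of_int j - 1/3 < fst w" "fst w < of_int j + 1" using that by (cases w, simp)+
    have "leaf_coord w = ret_pow j (bend (ramp (fst w - of_int j)) (snd w))"
      using leaf_coord_local[OF w, of "snd w"] by (simp only: prod.collapse)
    then show "leaf_coord (fibre_map u w) = leaf_coord (?g w)"
      using leaf_coord_local[OF w]
      by (simp add: leaf_coord_fibre_map unbend_ramp ret_pow_commute[of u, OF assms(2,3)])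
    show "fst (fibre_map u w) = fst (?g w)" by (simp add: fst_fibre_map)
  qed
  ultimately show "\<exists>W g. open W \<and> z \<in> W \<and> smooth_on W g \<and> (\<forall>w\<in>W. fibre_map u w = g w)"
    using open_window by (intro exI[of _ ?W] exI[of _ ?g]) blast
qed

definition diffeo :: "nat set \<Rightarrow> complex \<times> complex \<Rightarrow> complex \<times> complex" where
  "diffeo S = torus_map (fibre_map (hol S))"

lemma fibre_map_hol_lattice: "fibre_map (hol S) (z + lattice_vec i n) = fibre_map (hol S) z + lattice_vec i n"
  by (rule fibre_map_lattice) (rule hol_periodic hol_ret)+

lemma diffeo_cover: "diffeo S (torus_cover z) = torus_cover (fibre_map (hol S) z)"
  unfolding diffeo_def by (rule torus_map_cover) (rule fibre_map_hol_lattice)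

lemma diffeo_preserves_suspension: "diffeo S \<in> foliation_diffeos torus torus_atlas suspension"
proof -
  let ?F = "fibre_map (hol S)" and ?F' = "fibre_map (hol_inv S)"
  have "diffeo S \<in> diffeos torus torus_atlas"
    unfolding diffeo_def
    by (rule torus_map_diffeo[OF _ fibre_map_hol_lattice, where F' = ?F'])
      (intro smooth_fibre_map smooth_hol smooth_hol_inv hol_ret fibre_map_inverse hol_inv)+
  moreover have image: "diffeo S ` leaf z = leaf (?F z)" for z
  proof -
    have rel: "orbit_related (leaf_coord (?F z)) (leaf_coord (?F w)) \<longleftrightarrow> orbit_related (leaf_coord z) (leaf_coord w)" for w
    proof -
      have "(hol S d = ret_pow j (hol S c) + of_int n) \<longleftrightarrow> (d = ret_pow j c + of_int n)" for c d j n
      proof -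
        have "ret_pow j (hol S c) + of_int n = hol S (ret_pow j c + of_int n)"
          by (simp only: hol_periodic ret_pow_commute[of "hol S", OF hol_ret(1,2)])
        then show ?thesis by (metis hol_inv(2))
      qed
      then show ?thesis by (simp only: orbit_related_def leaf_coord_fibre_map)
    qed
    have surj: "?F (?F' w) = w" for w by (rule fibre_map_inverse) (rule hol_inv)
    show ?thesis
    proof (intro equalityI subsetI)
      fix q assume "q \<in> diffeo S ` leaf z"
      then obtain w where "q = torus_cover (?F w)" "orbit_related (leaf_coord z) (leaf_coord w)"
        unfolding leaf_def using diffeo_cover by blast
      then show "q \<in> leaf (?F z)" unfolding leaf_def using rel by blast
    next
      fix q assume "q \<in> leaf (?F z)"
      then obtain w where w: "q = torus_cover w" "orbit_related (leaf_coord (?F z)) (leaf_coord w)"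
        unfolding leaf_def by blast
      then have "orbit_related (leaf_coord z) (leaf_coord (?F' w))" using rel[of "?F' w"] surj by simp
      then have "torus_cover (?F' w) \<in> leaf z" unfolding leaf_def by blast
      moreover have "q = diffeo S (torus_cover (?F' w))" by (simp only: diffeo_cover surj w(1))
      ultimately show "q \<in> diffeo S ` leaf z" by blast
    qed
  qed
  moreover have "(\<lambda>L. diffeo S ` L) ` suspension = suspension"
  proof -
    have "(\<lambda>L. diffeo S ` L) ` suspension = leaf ` range ?F"
      unfolding suspension_eq by (simp only: image_image image)
    also have "range ?F = UNIV"
      by (rule surjI[where f = ?F']) (rule fibre_map_inverse, rule hol_inv)
    finally show ?thesis by (simp only: suspension_eq)
  qed
  ultimately show ?thesis unfolding foliation_diffeos_def by blast
qed

end

section \<open>Paths of foliation preserving diffeomorphisms\<close>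

lemma clopen_on_unit_interval:
  fixes P :: "real \<Rightarrow> bool"
  assumes "P 0" "t \<in> {0..1}"
    and pos: "\<And>t. t \<in> {0..1} \<Longrightarrow> P t \<Longrightarrow> \<forall>\<^sub>F s in at t within {0..1}. P s"
    and neg: "\<And>t. t \<in> {0..1} \<Longrightarrow> \<not> P t \<Longrightarrow> \<forall>\<^sub>F s in at t within {0..1}. \<not> P s"
  shows "P t"
proof (rule connected_induction_simple[of "{0..1::real}" 0 t P])
  fix a :: real assume a: "a \<in> {0..1}"
  have "\<forall>\<^sub>F s in at a within {0..1}. P s \<longleftrightarrow> P a"
    using pos[OF a] neg[OF a] by (cases "P a") simp_all
  then obtain A where A: "open A" "a \<in> A" "\<And>s. s \<in> A \<Longrightarrow> s \<noteq> a \<Longrightarrow> s \<in> {0..1} \<Longrightarrow> P s \<longleftrightarrow> P a"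
    unfolding eventually_at_topological by blast
  have const: "P s \<longleftrightarrow> P a" if "s \<in> {0..1} \<inter> A" for s using A(3)[of s] that by (cases "s = a") auto
  show "\<exists>T. openin (top_of_set {0..1}) T \<and> a \<in> T \<and> (\<forall>x\<in>T. \<forall>y\<in>T. P x \<longrightarrow> P y)"
  proof (intro exI conjI ballI impI)
    show "openin (top_of_set {0..1}) ({0..1} \<inter> A)" using A(1) by (rule openin_open_Int)
    show "a \<in> {0..1} \<inter> A" using A(2) a by simp
    show "P y" if "x \<in> {0..1} \<inter> A" "y \<in> {0..1} \<inter> A" "P x" for x y
      using const[OF that(1)] const[OF that(2)] that(3) by simp
  qed
qed (use assms(1,2) in auto)

context twisted_strips
begin

lemma hol_fixes_ends: "hol S (lo n) = lo n" "hol S (hi n) = hi n"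
proof -
  have "lo n \<in> {lo n..hi n}" "hi n \<in> {lo n..hi n}" using r_pos[of n] by (simp_all add: lo_def hi_def)
  moreover have "lo n + \<eta> n (lo n) = lo n" "hi n + \<eta> n (hi n) = hi n"
    using twisted[of n] by (simp_all add: twisted_translation_def lo_def hi_def)
  ultimately show "hol S (lo n) = lo n" "hol S (hi n) = hi n"
    using hol_on_strip[of "lo n" n S] hol_on_strip[of "hi n" n S] by auto
qed

lemma ret_fixed_iff: "ret y = y \<longleftrightarrow> hol UNIV y = y"
proof
  assume "ret y = y"
  show "hol UNIV y = y"
  proof (rule ccontr)
    assume "hol UNIV y \<noteq> y"
    then consider "hol UNIV y < y" | "y < hol UNIV y" by linarith
    then show False
      using strict_monoD[OF strict_mono_hol[of UNIV], of "hol UNIV y" y]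
        strict_monoD[OF strict_mono_hol[of UNIV], of y "hol UNIV y"] \<open>ret y = y\<close>
      by cases (simp_all add: ret_def)
  qed
qed (simp add: ret_def)

lemma hol_moves_up:
  assumes "y \<in> {lo n<..<hi n}"
  shows "hol UNIV y \<in> {lo n<..<hi n}" "y < hol UNIV y"
proof -
  have tw: "twisted_translation (lo n) (hi n) (T n) (hol UNIV)" by (rule twisted_hol) simp
  then show in_strip: "hol UNIV y \<in> {lo n<..<hi n}" using assms by (simp only: twisted_translation_def)
  have "moebius_coord (lo n) (hi n) y < moebius_coord (lo n) (hi n) (hol UNIV y)"
    using tw assms unfolding twisted_translation_def by fastforce
  then show "y < hol UNIV y" using moebius_coord_strict_mono[OF assms in_strip] by simp
qed

text \<open>In a strip, \<open>h\<close> moves points upwards, but less than \<open>h \<circ> h\<close> does.  This distinguishes the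
  effects of \<open>hol S\<close> and \<open>hol U\<close> on the leaves of the torus, where the return map acts trivially.\<close>

lemma ret_pow_not_hol:
  assumes y: "y \<in> {lo n<..<hi n}"
  shows "ret_pow i y \<noteq> hol UNIV y"
proof (cases "i \<ge> 1")
  case True
  have "ret_pow i y = ret_pow (i - 1) (ret y)"
    using ret_pow_add[of "i - 1" 1 y] by (simp add: ret_pow_1)
  also have "\<dots> = (ret ^^ nat (i - 1)) (ret y)" using True by (simp add: ret_pow_def int_iterate_def)
  finally have eq: "ret_pow i y = (ret ^^ nat (i - 1)) (ret y)" .
  have "(ret ^^ k) (ret y) \<in> {lo n<..<hi n} \<and> ret y \<le> (ret ^^ k) (ret y)" for k
  proof (induction k)
    case 0
    then show ?case using hol_moves_up(1)[OF y] hol_moves_up(1) by (simp add: ret_def)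
  next
    case (Suc k)
    define z where "z = (ret ^^ k) (ret y)"
    have z: "z \<in> {lo n<..<hi n}" "ret y \<le> z" using Suc by (simp_all add: z_def)
    have "ret z \<in> {lo n<..<hi n} \<and> z < ret z"
      using hol_moves_up[OF z(1)] hol_moves_up[OF hol_moves_up(1)[OF z(1)]] unfolding ret_def
      by (intro conjI) (assumption, linarith)
    then show ?case using z(2) by (simp add: z_def)
  qed
  from this[of "nat (i - 1)"] have "ret y \<le> ret_pow i y" by (simp only: eq)
  moreover have "hol UNIV y < ret y" using hol_moves_up(2)[OF hol_moves_up(1)[OF y]] by (simp add: ret_def)
  ultimately show ?thesis by linarith
next
  case False
  have inv: "ret_inv z \<in> {lo n<..<hi n} \<and> ret_inv z < z" if z: "z \<in> {lo n<..<hi n}" for z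
  proof -
    have "ret (lo n) < ret (ret_inv z)" "ret (ret_inv z) < ret (hi n)"
      using z by (simp_all add: ret_inv) (simp_all add: ret_def hol_fixes_ends)
    then have in_strip: "ret_inv z \<in> {lo n<..<hi n}" by (simp add: strict_mono_less[OF strict_mono_ret])
    have "ret_inv z < ret (ret_inv z)"
      using hol_moves_up[OF in_strip] hol_moves_up(2)[OF hol_moves_up(1)[OF in_strip]] unfolding ret_def by linarith
    with in_strip show ?thesis by (simp add: ret_inv)
  qed
  have "(ret_inv ^^ k) y \<in> {lo n<..<hi n} \<and> (ret_inv ^^ k) y \<le> y" for k
  proof (induction k)
    case (Suc k)
    then show ?case using inv[of "(ret_inv ^^ k) y"] by auto
  qed (use y in simp)
  moreover have "ret_pow i y = (ret_inv ^^ nat (- i)) y"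
    using False by (cases "i = 0") (simp_all add: ret_pow_def int_iterate_def)
  ultimately have "ret_pow i y \<le> y" by simp
  then show ?thesis using hol_moves_up(2)[OF y] by linarith
qed

lemma ret_pow_fixes_lo: "ret_pow i (lo n) = lo n"
proof -
  have "ret (lo n) = lo n" by (simp add: ret_def hol_fixes_ends)
  moreover from this have "ret_inv (lo n) = lo n" by (metis ret_inv(2))
  ultimately show ?thesis
    unfolding ret_pow_def by (intro int_iterate_invariant[where P = "\<lambda>y. y = lo n"]) simp_all
qed

text \<open>A path of diffeomorphisms preserving the foliation lifts to the plane and induces a path of maps of
  the space of lifted leaves, the line, that commute with the return map.  Composed with the inverse of
  the initial one, these maps start at the identity.  They fix the ends of each strip, since these are
  isolated fixed points of the return map, and by the lack of small symmetries the times at which they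
  are the identity on a strip form an open set, which is also closed.\<close>

lemma path_joins_only_equal_sets:
  assumes \<gamma>: "continuous_map (top_of_set {0..1::real}) (diffeo_topology torus torus_atlas) \<gamma>"
    and fol: "\<And>t. t \<in> {0..1} \<Longrightarrow> \<gamma> t \<in> foliation_diffeos torus torus_atlas suspension"
    and ends: "\<gamma> 0 = diffeo S" "\<gamma> 1 = diffeo U"
  shows "S = U"
proof -
  obtain \<Gamma>0 where \<Gamma>0: "continuous_on ({0..1} \<times> UNIV) \<Gamma>0"
    "\<And>t z. t \<in> {0..1} \<Longrightarrow> torus_cover (\<Gamma>0 (t, z)) = \<gamma> t (torus_cover z)"
    using diffeo_path_lift[OF \<gamma>] by blast
  have cont_fibre: "continuous_on UNIV (fibre_map (hol V))" for V
    by (intro smooth_on_imp_continuous_on smooth_fibre_map smooth_hol hol_ret)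
  have slice: "continuous_on UNIV (\<lambda>z. G (t, z))"
    if "continuous_on ({0..1} \<times> UNIV) G" "t \<in> {0..1}"
    for t :: real and G :: "real \<times> real \<times> real \<Rightarrow> real \<times> real"
    by (rule continuous_on_compose2[OF that(1)]) (use that(2) in \<open>auto intro!: continuous_intros\<close>)
  have "continuous_on UNIV (\<lambda>z. \<Gamma>0 (0, z))" by (rule slice[OF \<Gamma>0(1)]) simp
  moreover have "torus_cover (\<Gamma>0 (0, z)) = torus_cover (fibre_map (hol S) z)" for z
    using \<Gamma>0(2)[of 0 z] by (simp add: ends diffeo_cover)
  ultimately obtain i0 n0 where i0: "\<And>z. \<Gamma>0 (0, z) = fibre_map (hol S) z + lattice_vec i0 n0"
    using lifts_differ_by_lattice[OF _ cont_fibre] by metis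
  define \<Gamma> where "\<Gamma> x = \<Gamma>0 x + lattice_vec (- i0) (- n0)" for x
  have \<Gamma>_cont: "continuous_on ({0..1} \<times> UNIV) \<Gamma>"
    unfolding \<Gamma>_def by (intro continuous_on_add \<Gamma>0(1) continuous_on_const)
  have \<Gamma>_lift: "torus_cover (\<Gamma> (t, z)) = \<gamma> t (torus_cover z)" if "t \<in> {0..1}" for t z
    unfolding \<Gamma>_def torus_cover_lattice by (rule \<Gamma>0(2)[OF that])
  have \<Gamma>_0: "\<Gamma> (0, z) = fibre_map (hol S) z" for z
    by (simp add: \<Gamma>_def i0 prod_eq_iff)
  have \<Gamma>_slice: "continuous_on UNIV (\<lambda>z. \<Gamma> (t, z))" if "t \<in> {0..1}" for t
    by (rule slice[OF \<Gamma>_cont that])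
  \<comment> \<open>The action on the fundamental group is constant along the path, hence trivial.\<close>
  have deck: "\<Gamma> (t, z + lattice_vec i n) = \<Gamma> (t, z) + lattice_vec i n" if t: "t \<in> {0..1}" for t z i n
  proof -
    let ?S = "{0..1::real} \<times> (UNIV :: (real \<times> real) set)"
    let ?d = "\<lambda>x. \<Gamma> (fst x, snd x + lattice_vec i n) - \<Gamma> x"
    have "?d (t, z) = ?d (0, z)"
    proof (rule lattice_valued_constant[of ?S ?d])
      show "connected ?S" by (intro convex_connected convex_Times) auto
      show "continuous_on ?S ?d"
        by (intro continuous_on_diff \<Gamma>_cont continuous_on_compose2[OF \<Gamma>_cont]) (auto intro!: continuous_intros)
      fix x assume "x \<in> ?S"
      then obtain t z where x: "x = (t, z)" "t \<in> {0..1}" by (cases x) simp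
      have "torus_cover (\<Gamma> (t, z + lattice_vec i n)) = torus_cover (\<Gamma> (t, z))"
        by (simp only: \<Gamma>_lift[OF x(2)] torus_cover_lattice)
      then obtain k l where "\<Gamma> (t, z + lattice_vec i n) = \<Gamma> (t, z) + lattice_vec k l"
        using torus_cover_periodic by blast
      then show "\<exists>m n. ?d x = lattice_vec m n" using x(1) by (intro exI[of _ k] exI[of _ l]) simp
    qed (use t in simp_all)
    then show ?thesis by (simp add: \<Gamma>_0 fibre_map_hol_lattice algebra_simps)
  qed
  \<comment> \<open>The leaf coordinate at \<open>(0, c)\<close> is \<open>c\<close>, so this is the induced map on lifted leaves.\<close>
  define k where "k t c = hol_inv S (leaf_coord (\<Gamma> (t, (0, c))))" for t c
  have k_leaf: "hol_inv S (leaf_coord (\<Gamma> (t, z))) = k t (leaf_coord z)" if t: "t \<in> {0..1}" for t z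
    unfolding k_def
    using lift_preserves_leaf_coord[OF fol[OF t] \<Gamma>_lift[OF t] \<Gamma>_slice[OF t], of z "(0, leaf_coord z)"]
    by (simp add: leaf_coord_0)
  have hol_inv_ret: "hol_inv S (ret y) = ret (hol_inv S y)" for y by (rule hol_ret)
  have comm: "k t (ret c) = ret (k t c)" if t: "t \<in> {0..1}" for t c
  proof -
    have "leaf_coord (z + lattice_vec 1 0) = ret (leaf_coord z)" for z
      by (simp only: leaf_coord_lattice ret_pow_1)
    then have "ret c = leaf_coord ((0, c) + lattice_vec 1 0)" by (simp only: leaf_coord_0)
    then have "k t (ret c) = hol_inv S (leaf_coord (\<Gamma> (t, (0, c) + lattice_vec 1 0)))" by (simp only: k_leaf[OF t])
    also have "\<dots> = hol_inv S (ret (leaf_coord (\<Gamma> (t, (0, c)))))"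
      by (simp only: deck[OF t] \<open>\<And>z. leaf_coord (z + lattice_vec 1 0) = ret (leaf_coord z)\<close>)
    also have "\<dots> = ret (k t c)" by (simp only: hol_inv_ret k_def)
    finally show ?thesis .
  qed
  have k0: "k 0 c = c" for c
    by (simp add: k_def \<Gamma>_0 leaf_coord_fibre_map leaf_coord_0 hol_inv)
  have k_cont: "((\<lambda>s. k s c) \<longlongrightarrow> k t c) (at t within {0..1})" if t: "t \<in> {0..1}" for t c
  proof -
    have "continuous_on {0..1} (\<lambda>t. \<Gamma> (t, (0, c)))"
      by (rule continuous_on_compose2[OF \<Gamma>_cont]) (auto intro!: continuous_intros)
    then have "continuous_on {0..1} (\<lambda>t. leaf_coord (\<Gamma> (t, (0, c))))"
      by (rule continuous_on_compose2[OF continuous_on_leaf_coord[of UNIV]]) simp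
    then have "continuous_on {0..1} (\<lambda>t. k t c)"
      unfolding k_def
      by (rule continuous_on_compose2[OF smooth_on_imp_continuous_on[OF smooth_hol_inv]]) simp
    then show ?thesis using t by (simp only: continuous_on_def)
  qed
  have k_diff: "\<exists>D. (k t has_real_derivative D) (at c)" if t: "t \<in> {0..1}" for t c
  proof -
    have "smooth_map torus torus_atlas torus torus_atlas (\<gamma> t)"
      using fol[OF t] by (simp add: foliation_diffeos_def diffeos_def)
    from lift_differentiable[OF this \<Gamma>_slice[OF t] \<Gamma>_lift[OF t]]
    have d1: "(\<lambda>z. \<Gamma> (t, z)) differentiable at z" for z .
    have d0: "(\<lambda>c::real. (0::real, c)) differentiable at c"
      by (auto simp: differentiable_def intro!: derivative_eq_intros exI)
    have "(hol_inv S \<circ> (leaf_coord \<circ> ((\<lambda>z. \<Gamma> (t, z)) \<circ> (\<lambda>c. (0, c))))) differentiable at c"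
      by (intro differentiable_chain_at d0 d1 smooth_on_imp_differentiable[OF smooth_leaf_coord]
          smooth_on_imp_differentiable[OF smooth_hol_inv] UNIV_I)
    then have "k t differentiable at c" unfolding k_def[abs_def] by (simp only: o_def)
    then show ?thesis by (simp only: real_differentiable_def)
  qed
  have fixes_ends: "k t p = p" if t: "t \<in> {0..1}" and p: "p = lo n \<or> p = hi n" for t n p
  proof (rule clopen_on_unit_interval[where P = "\<lambda>t. k t p = p" and t = t])
    show "k 0 p = p" by (rule k0)
    fix s :: real assume s: "s \<in> {0..1}"
    have ret_p: "ret p = p" using p by (auto simp: ret_def hol_fixes_ends)
    show "\<forall>\<^sub>F s in at s within {0..1}. k s p = p" if "k s p = p"
    proof -
      have "\<forall>\<^sub>F s in at s within {0..1}. dist (k s p) p < r n"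
        using tendstoD[OF k_cont[OF s, of p] r_pos[of n]] by (simp only: that)
      moreover have "\<forall>\<^sub>F s in at s within {0..1}. s \<in> {0..1}" by (simp add: eventually_at_filter)
      ultimately show ?thesis
      proof eventually_elim
        case (elim v)
        have "ret (k v p) = k v p" using comm[OF elim(2), of p] by (simp only: ret_p)
        then have "hol UNIV (k v p) = k v p" by (simp only: ret_fixed_iff)
        then show ?case using hol_fixed_isolated[OF p, of "k v p"] elim(1) by (simp add: dist_real_def)
      qed
    qed
    show "\<forall>\<^sub>F s in at s within {0..1}. k s p \<noteq> p" if "k s p \<noteq> p"
      using tendsto_imp_eventually_ne[OF k_cont[OF s, of p] that] .
  qed (rule t)
  have identity: "k t y = y" if t: "t \<in> {0..1}" and y: "y \<in> {lo n..hi n}" for t y n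
  proof -
    let ?p = "lo n" and ?q = "hi n"
    let ?\<omega> = "moebius_coord ?p ?q"
    have tw: "twisted_translation ?p ?q (T n) (hol UNIV)" by (rule twisted_hol) simp
    then have pq: "?p < ?q" "T n > 0" by (simp_all add: twisted_translation_def)
    \<comment> \<open>Test points on either side of the region where the return map is not a translation.\<close>
    define y1 where "y1 = moebius_point ?p ?q (- (2 * T n))"
    define y2 where "y2 = moebius_point ?p ?q (2 * T n)"
    have y1: "y1 \<in> {?p<..<?q}" "?\<omega> y1 = - (2 * T n)" and y2: "y2 \<in> {?p<..<?q}" "?\<omega> y2 = 2 * T n"
      using pq(1) unfolding y1_def y2_def by (simp_all only: moebius_point_in moebius_coord_point)
    have "\<forall>y\<in>{?p..?q}. k t y = y"
    proof (rule clopen_on_unit_interval[where P = "\<lambda>t. \<forall>y\<in>{?p..?q}. k t y = y" and t = t])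
      show "\<forall>y\<in>{?p..?q}. k 0 y = y" by (simp add: k0)
      fix s :: real assume s: "s \<in> {0..1}"
      show "\<forall>\<^sub>F v in at s within {0..1}. \<not> (\<forall>y\<in>{?p..?q}. k v y = y)" if not: "\<not> (\<forall>y\<in>{?p..?q}. k s y = y)"
      proof -
        obtain y where y: "y \<in> {?p..?q}" "k s y \<noteq> y" using not by blast
        have "\<forall>\<^sub>F v in at s within {0..1}. k v y \<noteq> y"
          using tendsto_imp_eventually_ne[OF k_cont[OF s, of y] y(2)] .
        then show ?thesis by eventually_elim (use y(1) in blast)
      qed
      show "\<forall>\<^sub>F v in at s within {0..1}. \<forall>y\<in>{?p..?q}. k v y = y" if id: "\<forall>y\<in>{?p..?q}. k s y = y"
      proof -
        have near: "\<forall>\<^sub>F v in at s within {0..1}. k v z \<in> {?p<..<?q} \<and> \<bar>?\<omega> (k v z) - ?\<omega> z\<bar> \<le> T n / 4"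
          if z: "z \<in> {?p<..<?q}" for z
        proof -
          have lim: "((\<lambda>v. k v z) \<longlongrightarrow> z) (at s within {0..1})"
            using k_cont[OF s, of z] id z by simp
          have "(?\<omega> has_real_derivative ((1 * (?q - z) - (z - ?p) * (0 - 1)) / ((?q - z) * (?q - z))) / ((z - ?p) / (?q - z))) (at z)"
            unfolding moebius_coord_def[abs_def] using z
            by (auto intro!: derivative_eq_intros simp: divide_simps)
          then have "isCont ?\<omega> z" by (rule DERIV_isCont)
          from isCont_tendsto_compose[OF this lim]
          have "((\<lambda>v. ?\<omega> (k v z)) \<longlongrightarrow> ?\<omega> z) (at s within {0..1})" .
          then have "\<forall>\<^sub>F v in at s within {0..1}. dist (?\<omega> (k v z)) (?\<omega> z) < T n / 4"
            by (rule tendstoD) (use pq(2) in simp)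
          moreover have "\<forall>\<^sub>F v in at s within {0..1}. k v z \<in> {?p<..<?q}"
            using lim z by (intro topological_tendstoD) auto
          ultimately show ?thesis by eventually_elim (auto simp: dist_real_def)
        qed
        have "\<forall>\<^sub>F v in at s within {0..1}. v \<in> {0..1}" by (simp add: eventually_at_filter)
        with near[OF y1(1)] near[OF y2(1)] show ?thesis
        proof eventually_elim
          case (elim v)
          obtain D where D: "(k v has_real_derivative D) (at ?p)" using k_diff[OF elim(3)] by blast
          obtain D' where D': "(k v has_real_derivative D') (at ?q)" using k_diff[OF elim(3)] by blast
          have comm': "k v (hol UNIV (hol UNIV y)) = hol UNIV (hol UNIV (k v y))" for y
            using comm[OF elim(3)] by (simp only: ret_def)
          show ?case
            using small_commuting_is_identity[OF tw strict_mono_hol hol_inv comm' _ D _ D' y1(1) _ y1(2) _ y2(1) _ y2(2)]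
              fixes_ends[OF elim(3), of ?p n] fixes_ends[OF elim(3), of ?q n] elim(1,2) by blast
        qed
      qed
    qed (rule t)
    then show ?thesis using y by blast
  qed
  have "continuous_on UNIV (\<lambda>z. \<Gamma> (1, z))" by (rule \<Gamma>_slice) simp
  moreover have "torus_cover (\<Gamma> (1, z)) = torus_cover (fibre_map (hol U) z)" for z
    using \<Gamma>_lift[of 1 z] by (simp add: ends diffeo_cover)
  ultimately obtain i l where il: "\<And>z. \<Gamma> (1, z) = fibre_map (hol U) z + lattice_vec i l"
    using lifts_differ_by_lattice[OF _ cont_fibre] by metis
  have final: "ret_pow i (hol U y) + of_int l = hol S y" if y: "y \<in> {lo n..hi n}" for y n
  proof -
    have "hol_inv S (ret_pow i (hol U y) + of_int l) = y"
      using identity[OF _ y, of 1] by (simp add: k_def il leaf_coord_lattice leaf_coord_fibre_map leaf_coord_0)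
    then show ?thesis by (metis hol_inv(1))
  qed
  have "lo 0 \<in> {lo 0..hi 0}" using r_pos[of 0] by (simp add: lo_def hi_def)
  from final[OF this] have "l = 0" by (simp add: hol_fixes_ends ret_pow_fixes_lo)
  have "n \<in> S \<longleftrightarrow> n \<in> U" for n
  proof (rule ccontr)
    assume neq: "\<not> (n \<in> S \<longleftrightarrow> n \<in> U)"
    define y where "y = m n"
    have y: "y \<in> {lo n<..<hi n}" "y \<in> {lo n..hi n}" using r_pos[of n] by (simp_all add: y_def lo_def hi_def)
    have hol: "hol V y = (if n \<in> V then hol UNIV y else y)" for V
      using hol_on_strip[OF y(2), of V] hol_on_strip[OF y(2), of UNIV] by simp
    have eq: "ret_pow i (hol U y) = hol S y" using final[OF y(2)] \<open>l = 0\<close> by simp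
    show False
    proof (cases "n \<in> S")
      case True
      then have "ret_pow i y = hol UNIV y" using neq eq hol[of S] hol[of U] by simp
      then show False using ret_pow_not_hol[OF y(1)] by blast
    next
      case False
      then have "ret_pow i (hol UNIV y) = y" using neq eq hol[of S] hol[of U] by simp
      then have "ret_pow (- i) y = hol UNIV y" by (metis ret_pow_inverse(1))
      then show False using ret_pow_not_hol[OF y(1)] by blast
    qed
  qed
  then show ?thesis by blast
qed

end

text \<open>Each \<open>f i\<close> has a basic open neighbourhood inside a path-connected set, and distinct indices
  need distinct ones.\<close>

lemma countable_if_pairwise_not_path_joined:
  fixes f :: "'i \<Rightarrow> 'a"
  assumes T: "second_countable X" "locally_path_connected_space X"
    and f: "\<And>i. f i \<in> topspace X"
    and sep: "\<And>i j g. pathin X g \<Longrightarrow> g 0 = f i \<Longrightarrow> g 1 = f j \<Longrightarrow> i = j"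
  shows "countable (UNIV :: 'i set)"
proof -
  from T(1) obtain \<B> where \<B>: "countable \<B> \<and> (\<forall>V\<in>\<B>. openin X V) \<and>
      (\<forall>W x. openin X W \<and> x \<in> W \<longrightarrow> (\<exists>V\<in>\<B>. x \<in> V \<and> V \<subseteq> W))"
    unfolding second_countable_def ..
  have "\<exists>B. B \<in> \<B> \<and> f i \<in> B \<and> (\<exists>V. path_connectedin X V \<and> B \<subseteq> V)" for i
  proof -
    have "neighbourhood_base_at (f i) (path_connectedin X) X"
      using T(2) f[of i] by (simp add: locally_path_connected_space_def neighbourhood_base_of_def)
    then have "\<exists>W V. openin X W \<and> path_connectedin X V \<and> f i \<in> W \<and> W \<subseteq> V \<and> V \<subseteq> topspace X"
      using f[of i] by (simp add: neighbourhood_base_at_def)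
    then obtain W V where W: "openin X W" "path_connectedin X V" "f i \<in> W" "W \<subseteq> V"
      by (elim exE conjE)
    then obtain B where "B \<in> \<B>" "f i \<in> B" "B \<subseteq> W" using \<B> by meson
    then show ?thesis using W(2,4) by (intro exI[of _ B] exI[of _ V] conjI) auto
  qed
  then have "\<exists>B. \<forall>i. B i \<in> \<B> \<and> f i \<in> B i \<and> (\<exists>V. path_connectedin X V \<and> B i \<subseteq> V)"
    by (intro choice allI)
  then obtain B where B: "\<And>i. B i \<in> \<B>" "\<And>i. f i \<in> B i" "\<And>i. \<exists>V. path_connectedin X V \<and> B i \<subseteq> V" by blast
  have "inj B"
  proof (rule injI)
    fix i j assume "B i = B j"
    obtain V where V: "path_connectedin X V" "B i \<subseteq> V" using B(3) by blast
    then have "f i \<in> V" "f j \<in> V" using B(2)[of i] B(2)[of j] \<open>B i = B j\<close> by auto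
    moreover have "V \<subseteq> topspace X" "path_connected_space (subtopology X V)"
      using V(1) by (simp_all add: path_connectedin_def)
    ultimately have "\<exists>g. pathin (subtopology X V) g \<and> g 0 = f i \<and> g 1 = f j"
      unfolding path_connected_space_def by (simp add: inf.absorb2)
    then obtain g where "pathin X g" "g 0 = f i" "g 1 = f j" by (auto simp: pathin_subtopology)
    then show "i = j" by (rule sep)
  qed
  moreover have "countable (range B)" using \<B> B(1) by (meson countable_subset image_subsetI)
  ultimately show ?thesis by (rule countable_image_inj_on[rotated])
qed

lemma uncountable_nat_sets: "uncountable (UNIV :: nat set set)"
proof
  assume "countable (UNIV :: nat set set)"
  then have "range (from_nat_into (UNIV :: nat set set)) = Pow UNIV"
    by (simp add: range_from_nat_into)
  with Cantors_theorem[of "UNIV :: nat set"] show False by (elim notE) (rule exI)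
qed

theorem theorem2p9:
  shows "\<exists>\<F>. smooth_foliation torus torus_atlas \<F> \<and>
    \<not> (\<exists>T. group_topology (foliation_diffeo_group torus torus_atlas \<F>) T \<and>
            continuous_map T (diffeo_topology torus torus_atlas) (\<lambda>f. f) \<and>
            second_countable T \<and>
            locally_path_connected_space T)"
proof -
  obtain \<eta> m r \<tau> where "twisted_strips \<eta> m r \<tau>" using twisted_strips_exist by (elim exE)
  then interpret twisted_strips \<eta> m r \<tau> .
  have "False"
    if T: "group_topology (foliation_diffeo_group torus torus_atlas suspension) T"
      "continuous_map T (diffeo_topology torus torus_atlas) (\<lambda>f. f)"
      "second_countable T" "locally_path_connected_space T" for T
  proof -
    have top: "topspace T = foliation_diffeos torus torus_atlas suspension"
      using T(1) by (simp add: group_topology_def foliation_diffeo_group_def)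
    have "countable (UNIV :: nat set set)"
    proof (rule countable_if_pairwise_not_path_joined[OF T(3,4), of diffeo])
      show "diffeo S \<in> topspace T" for S unfolding top by (rule diffeo_preserves_suspension)
      fix S U g assume g: "pathin T g" "g 0 = diffeo S" "g 1 = diffeo U"
      show "S = U"
      proof (rule path_joins_only_equal_sets[OF _ _ g(2,3)])
        show "continuous_map (top_of_set {0..1}) (diffeo_topology torus torus_atlas) g"
          using continuous_map_compose[OF g(1)[unfolded pathin_def] T(2)] by (simp only: o_def)
        show "g t \<in> foliation_diffeos torus torus_atlas suspension" if "t \<in> {0..1}" for t
        proof -
          have "g \<in> topspace (top_of_set {0..1}) \<rightarrow> topspace T"
            using g(1) unfolding pathin_def by (rule continuous_map_funspace)
          then show ?thesis using that by (simp add: top Pi_iff)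
        qed
      qed
    qed
    with uncountable_nat_sets show False by (rule notE)
  qed
  then have "\<not> (\<exists>T. group_topology (foliation_diffeo_group torus torus_atlas suspension) T \<and>
            continuous_map T (diffeo_topology torus torus_atlas) (\<lambda>f. f) \<and>
            second_countable T \<and> locally_path_connected_space T)"
    by (intro notI) (elim exE conjE)
  with smooth_foliation_suspension show ?thesis by (intro exI[of _ suspension] conjI)
qed

end
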